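(* Let $S$ be a finitely aligned $k$-monoid, each of whose alphabets is finite and has cardinality at least $2$, with an aperiodic $k$-tiling and such that $S^\infty$ is the Cantor space. Then: (1) the Boolean inverse monoid $\mathsf{C}(S)$ is isomorphic to the Boolean inverse monoid $\mathsf{KB}(\mathcal{G}(S))$; (2) the group $\mathscr{G}(S)$ is therefore (isomorphic to) the topological full group of the Boolean groupoid $\mathcal{G}(S)$.
   Context: A $k$-monoid ($k\ge1$) is a countable monoid $S$ with a monoid homomorphism $d\colon S\to\mathbb{N}^k$ such that whenever $d(x)=\mathbf{m}+\mathbf{n}$ there are unique $x_1,x_2\in S$ with $x=x_1x_2$, $d(x_1)=\mathbf{m}$, $d(x_2)=\mathbf{n}$. Its alphabets are $X_i=d^{-1}(\mathbf{e}_i)$. $S$ is finitely aligned if each $aS\cap bS$ is empty or a finitely generated right ideal. Tilings. A $k$-tiling is a function $w$ assigning to each pair $\mathbf{m}\le\mathbf{n}$ in $\mathbb{N}^k$ (componentwise order) an element $w(\mathbf{m},\mathbf{n})\in S$ with $w(\mathbf{m},\mathbf{m})=1$, $w(\mathbf{m},\mathbf{n})w(\mathbf{n},\mathbf{p})=w(\mathbf{m},\mathbf{p})$ and $d(w(\mathbf{m},\mathbf{n}))=\mathbf{n}-\mathbf{m}$. $S^\infty$ is the set of all $k$-tilings. The shift is $\sigma^{\mathbf{p}}(w)(\mathbf{m},\mathbf{n})=w(\mathbf{m}+\mathbf{p},\mathbf{n}+\mathbf{p})$, $\mathbf{p}\in\mathbb{N}^k$. $w$ has period $\mathbf{p}\in\mathbb{Z}^k$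 if $w(\mathbf{m}+\mathbf{p},\mathbf{n}+\mathbf{p})=w(\mathbf{m},\mathbf{n})$ for all $\mathbf{m}\le\mathbf{n}$ in $\mathbb{N}^k$ with $\mathbf{m}+\mathbf{p}\ge\mathbf{0}$; it is periodic if it has a non-zero period, eventually periodic if some $\sigma^{\mathbf{q}}(w)$ is periodic, aperiodic if not eventually periodic. For $a\in S$, $w\in S^\infty$, $aw$ is the unique tiling with $(aw)(\mathbf{0},d(a))=a$ and $\sigma^{d(a)}(aw)=w$; the sets $aS^\infty=\{aw:w\in S^\infty\}$ form a basis of the topology on $S^\infty$. Monoids and group. $\mathsf{R}(S)$ is the inverse monoid, under composition of partial functions, of all bijective morphisms $\alpha\colon XS\to YS$ between finitely generated right ideals of $S$ ($X,Y$ finite, empty ideal and empty function included), where a morphism satisfies $\alpha(as)=\alpha(a)s$. It has binary meets for the natural partial order (restriction). $s\equiv t$ iff for each $0<x\le s$ we have $x\wedge t\neq0$ and for each $0<y\le t$ we have $y\wedge s\ne0$; this is a congruence and $\mathsf{C}(S)=\mathsf{R}(S)/{\equiv}$. A non-zero idempotent $e$ is essential if $ef\ne0$ for every non-zero idempotent $f$; $\mathsf{R}(S)^e$ is the set of $s$ with $s^{-1}s$, $ss^{-1}$ essential; $s\,\sigma\,t$ iff there is $u\le s,t$ in $\mathsf{R}(S)^e$; $\mathscr{G}(S)=\mathsf{R}(S)^e/\sigma$. Boolean inverse monoid: an inverse monoid with zero in which each compatible pair $a,b$ ($a^{-1}b$ and $ab^{-1}$ idempotent) has a join, multiplication distributes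 over such joins, and the idempotents form a Boolean algebra. Groupoid. $\mathcal{G}(S)$ consists of the triples $(w_2,\mathbf{n},w_1)\in S^\infty\times\mathbb{Z}^k\times S^\infty$ for which there are $\mathbf{l},\mathbf{m}\in\mathbb{N}^k$ with $\sigma^{\mathbf{l}}(w_2)=\sigma^{\mathbf{m}}(w_1)$, $\mathbf{n}=\mathbf{l}-\mathbf{m}$; product $(w_3,\mathbf{n}',w_2)(w_2,\mathbf{n},w_1)=(w_3,\mathbf{n}'+\mathbf{n},w_1)$, inverse $(w_1,-\mathbf{n},w_2)$; topology with basis the sets $Z(x,y)=\{(xw,d(x)-d(y),yw):w\in S^\infty\}$, $x,y\in S$. It is a Boolean groupoid, i.e. an étale groupoid whose space of identities is compact Hausdorff with a basis of clopen sets. A local bisection of a groupoid $G$ is a subset $A$ such that for $g,h\in A$ each of $g^{-1}g=h^{-1}h$ and $gg^{-1}=hh^{-1}$ implies $g=h$; it is a bisection if moreover $A^{-1}A=G_o=AA^{-1}$, $G_o$ the set of identities. $\mathsf{KB}(G)$ is the Boolean inverse monoid of compact-open local bisections of a Boolean groupoid $G$ under multiplication of subsets; the topological full group of $G$ is the group of compact-open bisections. *)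

theory Defs
  imports "HOL-Analysis.Analysis" "HOL-Algebra.Coset" "HOL-Algebra.Lattice"
begin

section \<open>Inverse monoids\<close>

definition idempotents :: "('a, 'm) monoid_scheme \<Rightarrow> 'a set" where
  "idempotents M = {e \<in> carrier M. e \<otimes>\<^bsub>M\<^esub> e = e}"

definition gen_inverse :: "('a, 'm) monoid_scheme \<Rightarrow> 'a \<Rightarrow> 'a" where
  "gen_inverse M x =
     (THE y. y \<in> carrier M \<and> x \<otimes>\<^bsub>M\<^esub> y \<otimes>\<^bsub>M\<^esub> x = x \<and> y \<otimes>\<^bsub>M\<^esub> x \<otimes>\<^bsub>M\<^esub> y = y)"

locale inverse_monoid = monoid M for M (structure) +
  assumes ex1_gen_inverse:
    "x \<in> carrier M \<Longrightarrow> \<exists>!y. y \<in> carrier M \<and> x \<otimes> y \<otimes> x = x \<and> y \<otimes> x \<otimes> y = y"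

definition is_zero :: "('a, 'm) monoid_scheme \<Rightarrow> 'a \<Rightarrow> bool" where
  "is_zero M z \<longleftrightarrow> z \<in> carrier M \<and> (\<forall>x\<in>carrier M. z \<otimes>\<^bsub>M\<^esub> x = z \<and> x \<otimes>\<^bsub>M\<^esub> z = z)"

definition mzero :: "('a, 'm) monoid_scheme \<Rightarrow> 'a" where
  "mzero M = (THE z. is_zero M z)"

definition natural_le :: "('a, 'm) monoid_scheme \<Rightarrow> 'a \<Rightarrow> 'a \<Rightarrow> bool" where
  "natural_le M a b \<longleftrightarrow> (\<exists>e\<in>idempotents M. a = b \<otimes>\<^bsub>M\<^esub> e)"

definition natural_order :: "('a, 'm) monoid_scheme \<Rightarrow> 'a gorder" where
  "natural_order M = \<lparr>carrier = carrier M, eq = (=), le = natural_le M\<rparr>"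

definition idempotent_order :: "('a, 'm) monoid_scheme \<Rightarrow> 'a gorder" where
  "idempotent_order M = \<lparr>carrier = idempotents M, eq = (=), le = natural_le M\<rparr>"

definition compatible :: "('a, 'm) monoid_scheme \<Rightarrow> 'a \<Rightarrow> 'a \<Rightarrow> bool" where
  "compatible M a b \<longleftrightarrow>
     gen_inverse M a \<otimes>\<^bsub>M\<^esub> b \<in> idempotents M \<and> a \<otimes>\<^bsub>M\<^esub> gen_inverse M b \<in> idempotents M"

definition is_join :: "('a, 'm) monoid_scheme \<Rightarrow> 'a \<Rightarrow> 'a \<Rightarrow> 'a \<Rightarrow> bool" where
  "is_join M c a b \<longleftrightarrow> least (natural_order M) c (Upper (natural_order M) {a, b})"

locale boolean_lattice = bounded_lattice L for L (structure) +
  assumes meet_join_distrib: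
      "\<lbrakk>x \<in> carrier L; y \<in> carrier L; z \<in> carrier L\<rbrakk> \<Longrightarrow> x \<sqinter> (y \<squnion> z) = (x \<sqinter> y) \<squnion> (x \<sqinter> z)"
    and ex_complement:
      "x \<in> carrier L \<Longrightarrow> \<exists>y\<in>carrier L. x \<sqinter> y = \<bottom> \<and> x \<squnion> y = \<top>"

locale boolean_inverse_monoid = inverse_monoid M for M (structure) +
  assumes ex_zero: "\<exists>z. is_zero M z"
    and ex_join:
      "\<lbrakk>a \<in> carrier M; b \<in> carrier M; compatible M a b\<rbrakk> \<Longrightarrow> \<exists>c. is_join M c a b"
    and mult_join_distrib:
      "\<lbrakk>a \<in> carrier M; b \<in> carrier M; compatible M a b; is_join M c a b; s \<in> carrier M\<rbrakk>
        \<Longrightarrow> is_join M (s \<otimes> c) (s \<otimes> a) (s \<otimes> b) \<and> is_join M (c \<otimes> s) (a \<otimes> s) (b \<otimes> s)"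
    and boolean_idempotents: "boolean_lattice (idempotent_order M)"

definition quotient_monoid ::
    "('a, 'm) monoid_scheme \<Rightarrow> ('a \<times> 'a) set \<Rightarrow> 'a set monoid" where
  "quotient_monoid M r =
     \<lparr>carrier = carrier M // r,
      mult = (\<lambda>A B. \<Union>a\<in>A. \<Union>b\<in>B. r `` {a \<otimes>\<^bsub>M\<^esub> b}),
      one = r `` {\<one>\<^bsub>M\<^esub>}\<rparr>"

text \<open>The congruence \<open>\<equiv>\<close>; meaningful for inverse monoids with zero and binary meets.\<close>

definition dense_rel :: "('a, 'm) monoid_scheme \<Rightarrow> ('a \<times> 'a) set" where
  "dense_rel M = {(s, t). s \<in> carrier M \<and> t \<in> carrier M \<and>
     (\<forall>x\<in>carrier M. x \<noteq> mzero M \<and> natural_le M x s \<longrightarrow> x \<sqinter>\<^bsub>natural_order M\<^esub> t \<noteq> mzero M) \<and>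
     (\<forall>y\<in>carrier M. y \<noteq> mzero M \<and> natural_le M y t \<longrightarrow> y \<sqinter>\<^bsub>natural_order M\<^esub> s \<noteq> mzero M)}"

definition essential_idempotent :: "('a, 'm) monoid_scheme \<Rightarrow> 'a \<Rightarrow> bool" where
  "essential_idempotent M e \<longleftrightarrow> e \<in> idempotents M \<and> e \<noteq> mzero M \<and>
     (\<forall>f\<in>idempotents M. f \<noteq> mzero M \<longrightarrow> e \<otimes>\<^bsub>M\<^esub> f \<noteq> mzero M)"

definition essential_part :: "('a, 'm) monoid_scheme \<Rightarrow> ('a, 'm) monoid_scheme" where
  "essential_part M = M\<lparr>carrier := {s \<in> carrier M.
     essential_idempotent M (gen_inverse M s \<otimes>\<^bsub>M\<^esub> s) \<and>
     essential_idempotent M (s \<otimes>\<^bsub>M\<^esub> gen_inverse M s)}\<rparr>"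

definition sigma_rel :: "('a, 'm) monoid_scheme \<Rightarrow> ('a \<times> 'a) set" where
  "sigma_rel M = {(s, t). s \<in> carrier (essential_part M) \<and> t \<in> carrier (essential_part M) \<and>
     (\<exists>u\<in>carrier (essential_part M). natural_le M u s \<and> natural_le M u t)}"


section \<open>Boolean groupoids\<close>

text \<open>Groupoids are given by their arrows only; the partial multiplication returns
  \<open>None\<close> on pairs that are not composable.\<close>

record 'g groupoid = "'g partial_object" +
  gmult :: "'g \<Rightarrow> 'g \<Rightarrow> 'g option"
  ginv :: "'g \<Rightarrow> 'g"

record 'g top_groupoid = "'g groupoid" +
  gtop :: "'g topology"

definition gsrc :: "('g, 'm) groupoid_scheme \<Rightarrow> 'g \<Rightarrow> 'g" where
  "gsrc G g = the (gmult G (ginv G g) g)"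

definition gtgt :: "('g, 'm) groupoid_scheme \<Rightarrow> 'g \<Rightarrow> 'g" where
  "gtgt G g = the (gmult G g (ginv G g))"

definition identities :: "('g, 'm) groupoid_scheme \<Rightarrow> 'g set" where
  "identities G = gsrc G ` carrier G"

definition composable_pairs :: "('g, 'm) groupoid_scheme \<Rightarrow> ('g \<times> 'g) set" where
  "composable_pairs G = {(g, h). g \<in> carrier G \<and> h \<in> carrier G \<and> gmult G g h \<noteq> None}"

locale groupoid =
  fixes G :: "('g, 'm) groupoid_scheme" (structure)
  assumes ginv_closed: "g \<in> carrier G \<Longrightarrow> ginv G g \<in> carrier G"
    and gmult_closed:
      "\<lbrakk>g \<in> carrier G; h \<in> carrier G; gmult G g h = Some x\<rbrakk> \<Longrightarrow> x \<in> carrier G"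
    and gmult_assoc:
      "\<lbrakk>g \<in> carrier G; h \<in> carrier G; k \<in> carrier G; gmult G g h = Some x; gmult G h k = Some y\<rbrakk>
        \<Longrightarrow> \<exists>z. gmult G x k = Some z \<and> gmult G g y = Some z"
    and ginv_ginv: "g \<in> carrier G \<Longrightarrow> ginv G (ginv G g) = g"
    and ginv_composable: "g \<in> carrier G \<Longrightarrow> gmult G (ginv G g) g \<noteq> None"
    and ginv_cancel:
      "\<lbrakk>g \<in> carrier G; h \<in> carrier G; gmult G g h = Some x\<rbrakk>
        \<Longrightarrow> gmult G (ginv G g) x = Some h \<and> gmult G x (ginv G h) = Some g"

locale etale_groupoid = groupoid G for G :: "('g, 'm) top_groupoid_scheme" (structure) +
  assumes topspace_gtop: "topspace (gtop G) = carrier G"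
    and continuous_gmult:
      "continuous_map (subtopology (prod_topology (gtop G) (gtop G)) (composable_pairs G)) (gtop G)
         (\<lambda>(g, h). the (gmult G g h))"
    and continuous_ginv: "continuous_map (gtop G) (gtop G) (ginv G)"
    and gsrc_local_homeomorphism:
      "g \<in> carrier G \<Longrightarrow> \<exists>U. openin (gtop G) U \<and> g \<in> U \<and>
         openin (subtopology (gtop G) (identities G)) (gsrc G ` U) \<and>
         homeomorphic_map (subtopology (gtop G) U) (subtopology (gtop G) (gsrc G ` U)) (gsrc G)"

abbreviation identity_space :: "('g, 'm) top_groupoid_scheme \<Rightarrow> 'g topology" where
  "identity_space G \<equiv> subtopology (gtop G) (identities G)"

locale boolean_groupoid = etale_groupoid +
  assumes compact_identity_space: "compact_space (identity_space G)"
    and Hausdorff_identity_space: "Hausdorff_space (identity_space G)"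
    and clopen_basis_identity_space:
      "neighbourhood_base_of
         (\<lambda>V. openin (identity_space G) V \<and> closedin (identity_space G) V) (identity_space G)"

definition gset_mult :: "('g, 'm) groupoid_scheme \<Rightarrow> 'g set \<Rightarrow> 'g set \<Rightarrow> 'g set" where
  "gset_mult G A B = {x. \<exists>g\<in>A. \<exists>h\<in>B. gmult G g h = Some x}"

definition local_bisection :: "('g, 'm) groupoid_scheme \<Rightarrow> 'g set \<Rightarrow> bool" where
  "local_bisection G A \<longleftrightarrow> A \<subseteq> carrier G \<and>
     (\<forall>g\<in>A. \<forall>h\<in>A. (gsrc G g = gsrc G h \<longrightarrow> g = h) \<and> (gtgt G g = gtgt G h \<longrightarrow> g = h))"

definition bisection :: "('g, 'm) groupoid_scheme \<Rightarrow> 'g set \<Rightarrow> bool" where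
  "bisection G A \<longleftrightarrow> local_bisection G A \<and>
     gset_mult G (ginv G ` A) A = identities G \<and> gset_mult G A (ginv G ` A) = identities G"

definition KB :: "('g, 'm) top_groupoid_scheme \<Rightarrow> 'g set monoid" where
  "KB G = \<lparr>carrier = {A. openin (gtop G) A \<and> compactin (gtop G) A \<and> local_bisection G A},
           mult = gset_mult G, one = identities G\<rparr>"

definition topological_full_group :: "('g, 'm) top_groupoid_scheme \<Rightarrow> 'g set monoid" where
  "topological_full_group G =
     \<lparr>carrier = {A. openin (gtop G) A \<and> compactin (gtop G) A \<and> bisection G A},
      mult = gset_mult G, one = identities G\<rparr>"


section \<open>k-monoids\<close>

text \<open>\<open>\<nat>\<^sup>k\<close> and \<open>\<int>\<^sup>k\<close> are \<open>nat ^ 'k\<close> and \<open>int ^ 'k\<close>, with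
  \<open>k = CARD('k) \<ge> 1\<close> and the componentwise order.\<close>

locale k_monoid = monoid S for S (structure) +
  fixes d :: "'a \<Rightarrow> nat ^ 'k::finite"
  assumes countable_carrier: "countable (carrier S)"
    and d_one: "d \<one> = 0"
    and d_mult: "\<lbrakk>x \<in> carrier S; y \<in> carrier S\<rbrakk> \<Longrightarrow> d (x \<otimes> y) = d x + d y"
    and unique_factorization:
      "\<lbrakk>x \<in> carrier S; d x = m + n\<rbrakk> \<Longrightarrow>
        \<exists>!p. case p of (x1, x2) \<Rightarrow>
          x1 \<in> carrier S \<and> x2 \<in> carrier S \<and> x = x1 \<otimes> x2 \<and> d x1 = m \<and> d x2 = n"

definition alphabet :: "('a, 'm) monoid_scheme \<Rightarrow> ('a \<Rightarrow> nat ^ 'k::finite) \<Rightarrow> 'k \<Rightarrow> 'a set" where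
  "alphabet S d i = {x \<in> carrier S. d x = axis i 1}"

text \<open>\<open>X <#> carrier S\<close> is the right ideal \<open>XS\<close> and \<open>a <# carrier S\<close> is \<open>aS\<close>;
  for \<open>X = {}\<close> the former is the empty ideal.\<close>

definition fg_right_ideal :: "('a, 'm) monoid_scheme \<Rightarrow> 'a set \<Rightarrow> bool" where
  "fg_right_ideal S I \<longleftrightarrow> (\<exists>X. finite X \<and> X \<subseteq> carrier S \<and> I = X <#>\<^bsub>S\<^esub> carrier S)"

definition finitely_aligned :: "('a, 'm) monoid_scheme \<Rightarrow> bool" where
  "finitely_aligned S \<longleftrightarrow> (\<forall>a\<in>carrier S. \<forall>b\<in>carrier S.
     (a <#\<^bsub>S\<^esub> carrier S) \<inter> (b <#\<^bsub>S\<^esub> carrier S) = {} \<or>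
     fg_right_ideal S ((a <#\<^bsub>S\<^esub> carrier S) \<inter> (b <#\<^bsub>S\<^esub> carrier S)))"


subsection \<open>Tilings\<close>

type_synonym ('a, 'k) tiling = "nat ^ 'k \<Rightarrow> nat ^ 'k \<Rightarrow> 'a"

definition vec_int :: "nat ^ 'k::finite \<Rightarrow> int ^ 'k" where
  "vec_int m = (\<chi> i. int (m $ i))"

definition vec_nat :: "int ^ 'k::finite \<Rightarrow> nat ^ 'k" where
  "vec_nat p = (\<chi> i. nat (p $ i))"

text \<open>Tilings are functions on pairs \<open>m \<le> n\<close>; the value \<open>undefined\<close> elsewhere makes
  equality of tilings the equality of functions on such pairs.\<close>

definition tilings ::
    "('a, 'm) monoid_scheme \<Rightarrow> ('a \<Rightarrow> nat ^ 'k::finite) \<Rightarrow> ('a, 'k) tiling set" where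
  "tilings S d = {w.
     (\<forall>m n. m \<le> n \<longrightarrow> w m n \<in> carrier S \<and> d (w m n) = n - m) \<and>
     (\<forall>m. w m m = \<one>\<^bsub>S\<^esub>) \<and>
     (\<forall>m n p. m \<le> n \<and> n \<le> p \<longrightarrow> w m n \<otimes>\<^bsub>S\<^esub> w n p = w m p) \<and>
     (\<forall>m n. \<not> m \<le> n \<longrightarrow> w m n = undefined)}"

definition shift :: "nat ^ 'k::finite \<Rightarrow> ('a, 'k) tiling \<Rightarrow> ('a, 'k) tiling" where
  "shift p w = (\<lambda>m n. w (m + p) (n + p))"

definition has_period :: "('a, 'k::finite) tiling \<Rightarrow> int ^ 'k \<Rightarrow> bool" where
  "has_period w p \<longleftrightarrow> (\<forall>m n. m \<le> n \<and> 0 \<le> vec_int m + p \<longrightarrow>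
     w (vec_nat (vec_int m + p)) (vec_nat (vec_int n + p)) = w m n)"

definition periodic :: "('a, 'k::finite) tiling \<Rightarrow> bool" where
  "periodic w \<longleftrightarrow> (\<exists>p. p \<noteq> 0 \<and> has_period w p)"

definition eventually_periodic :: "('a, 'k::finite) tiling \<Rightarrow> bool" where
  "eventually_periodic w \<longleftrightarrow> (\<exists>q. periodic (shift q w))"

definition aperiodic :: "('a, 'k::finite) tiling \<Rightarrow> bool" where
  "aperiodic w \<longleftrightarrow> \<not> eventually_periodic w"

definition prefix_tiling ::
    "('a, 'm) monoid_scheme \<Rightarrow> ('a \<Rightarrow> nat ^ 'k::finite) \<Rightarrow> 'a \<Rightarrow> ('a, 'k) tiling \<Rightarrow> ('a, 'k) tiling"
  where
  "prefix_tiling S d a w = (THE v. v \<in> tilings S d \<and> v 0 (d a) = a \<and> shift (d a) v = w)"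

text \<open>In a \<open>k\<close>-monoid the intersection of two sets \<open>aS\<^sup>\<infinity>\<close>, or of two sets \<open>Z(x,y)\<close>
  below, is a union of such sets, so these sets are bases of the topologies they generate.\<close>

definition tiling_topology ::
    "('a, 'm) monoid_scheme \<Rightarrow> ('a \<Rightarrow> nat ^ 'k::finite) \<Rightarrow> ('a, 'k) tiling topology" where
  "tiling_topology S d =
     topology_generated_by {prefix_tiling S d a ` tilings S d |a. a \<in> carrier S}"

definition Cantor_space :: "(nat \<Rightarrow> bool) topology" where
  "Cantor_space = product_topology (\<lambda>_. discrete_topology UNIV) UNIV"


subsection \<open>The inverse monoids R(S) and C(S), and the group G(S)\<close>

definition right_ideal_morphism :: "('a, 'm) monoid_scheme \<Rightarrow> ('a \<rightharpoonup> 'a) \<Rightarrow> bool" where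
  "right_ideal_morphism S \<alpha> \<longleftrightarrow>
     (\<forall>a\<in>dom \<alpha>. \<forall>s\<in>carrier S. \<alpha> (a \<otimes>\<^bsub>S\<^esub> s) = Some (the (\<alpha> a) \<otimes>\<^bsub>S\<^esub> s))"

definition R_monoid :: "('a, 'm) monoid_scheme \<Rightarrow> ('a \<rightharpoonup> 'a) monoid" where
  "R_monoid S =
     \<lparr>carrier = {\<alpha>. fg_right_ideal S (dom \<alpha>) \<and> fg_right_ideal S (ran \<alpha>) \<and>
                    inj_on \<alpha> (dom \<alpha>) \<and> right_ideal_morphism S \<alpha>},
      mult = (\<circ>\<^sub>m),
      one = Some |` carrier S\<rparr>"

definition C_monoid :: "('a, 'm) monoid_scheme \<Rightarrow> ('a \<rightharpoonup> 'a) set monoid" where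
  "C_monoid S = quotient_monoid (R_monoid S) (dense_rel (R_monoid S))"

definition G_group :: "('a, 'm) monoid_scheme \<Rightarrow> ('a \<rightharpoonup> 'a) set monoid" where
  "G_group S = quotient_monoid (essential_part (R_monoid S)) (sigma_rel (R_monoid S))"


subsection \<open>The groupoid of tilings\<close>

type_synonym ('a, 'k) tiling_arrow = "('a, 'k) tiling \<times> (int ^ 'k) \<times> ('a, 'k) tiling"

definition Z_set ::
    "('a, 'm) monoid_scheme \<Rightarrow> ('a \<Rightarrow> nat ^ 'k::finite) \<Rightarrow> 'a \<Rightarrow> 'a \<Rightarrow> ('a, 'k) tiling_arrow set"
  where
  "Z_set S d x y =
     (\<lambda>w. (prefix_tiling S d x w, vec_int (d x) - vec_int (d y), prefix_tiling S d y w)) `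
       tilings S d"

definition tiling_groupoid ::
    "('a, 'm) monoid_scheme \<Rightarrow> ('a \<Rightarrow> nat ^ 'k::finite) \<Rightarrow> ('a, 'k) tiling_arrow top_groupoid"
  where
  "tiling_groupoid S d =
     \<lparr>carrier = {(w2, n, w1). w2 \<in> tilings S d \<and> w1 \<in> tilings S d \<and>
                   (\<exists>l m. shift l w2 = shift m w1 \<and> n = vec_int l - vec_int m)},
      gmult = (\<lambda>(w3, n', w2) (w2', n, w1). if w2 = w2' then Some (w3, n' + n, w1) else None),
      ginv = (\<lambda>(w2, n, w1). (w1, - n, w2)),
      gtop = topology_generated_by {Z_set S d x y |x y. x \<in> carrier S \<and> y \<in> carrier S}\<rparr>"

end

theory Submission
  imports Defs
begin

text \<open>
  A morphism \<open>\<alpha>\<close> between right ideals acts on tilings by exchanging prefixes: it turns a tiling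
  \<open>xw\<close> with \<open>x\<close> in its domain into \<open>(\<alpha> x)w\<close>. The arrows of the groupoid that arise in this way
  form the set \<open>\<psi>(\<alpha>) = \<Union>x. Z(\<alpha> x, x)\<close>, called \<open>arrows_of \<alpha>\<close> below, and everything follows from
  the behaviour of \<open>\<psi>\<close>.

  \<^item> \<open>\<psi>\<close> maps \<open>R(S)\<close> into \<open>KB\<close> and is multiplicative. Compactness comes from a finite generating set
    of the domain, since each \<open>Z(y, x)\<close> is a continuous image of the Cantor space \<open>S\<^sup>\<infinity>\<close>.
    For the other properties one compares two arrows at the same tiling \<open>w\<close>: if \<open>\<alpha>\<close> is defined at one prefix of \<open>w\<close>, then it is defined at all longer ones, so two arrows
    can be examined at a common prefix, where \<open>\<alpha>\<close> is a function (\<open>arrows_of_level\<close>,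
    \<open>local_bisection_arrows_of\<close>, \<open>arrows_of_comp\<close>, \<open>arrows_of_agreement\<close>).

  \<^item> \<open>\<psi>\<close> is onto \<open>KB\<close>. A compact-open local bisection is a finite union of sets \<open>Z(y, x)\<close>. The
    assignments \<open>xs \<mapsto> ys\<close> fit together to an injective morphism: if \<open>xs = x's'\<close>, then for any
    tiling \<open>t\<close> the arrows from \<open>xst\<close> to \<open>yst\<close> and to \<open>y's't\<close> have the same source, hence
    coincide; their middle components show that \<open>ys\<close> and \<open>y's'\<close> have the same degree, and so
    both are the prefix of that degree of the same tiling
    (\<open>compact_open_bisection_is_arrows_of\<close>).

  \<^item> The kernel of \<open>\<psi>\<close> is the congruence that defines \<open>C(S)\<close>. Suppose that \<open>s\<close> and \<open>t\<close> agree
    somewhere below every non-zero restriction of \<open>s\<close>, and take an arrow of \<open>\<psi>(s)\<close> with source \<open>w\<close>.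
    Let \<open>a\<close> be a prefix of \<open>w\<close> in the domain of \<open>s\<close>, longer than all generators of the domain of
    \<open>t\<close>. Some \<open>ar\<close> lies in the domain of \<open>t\<close> with \<open>s(ar) = t(ar)\<close>. Being that long, \<open>a\<close> is itself
    in the domain of \<open>t\<close>, and \<open>s(a) r = t(a) r\<close> can be cancelled. So the arrow belongs to
    \<open>\<psi>(t)\<close> (\<open>arrows_of_subset_if_dense\<close>, \<open>dense_rel_eq_kernel\<close>).

  Hence \<open>\<psi>\<close> induces an isomorphism of \<open>C(S)\<close> onto \<open>KB\<close>. In the same way an idempotent is essential
  iff \<open>\<psi>\<close> maps it to the whole identity space, so \<open>R(S)\<^sup>e\<close> is the preimage of the bisections, and
  since a bisection contained in a local bisection equals it, \<open>\<sigma>\<close> is the kernel of \<open>\<psi>\<close> on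
  \<open>R(S)\<^sup>e\<close>. This identifies the group \<open>G(S)\<close> with the bisections, that is, the units of \<open>KB\<close>.

  The algebraic axioms are treated uniformly. A monoid that is faithfully represented by local
  bisections of a groupoid, with products and inverses computed there, is an inverse monoid whose
  natural order is inclusion; if moreover the image contains the empty set and is closed under unions
  that are local bisections and under complements of sets of identities, the monoid is Boolean
  (\<open>local_bisection_representation\<close>). This is applied to \<open>KB\<close>, to \<open>C(S)\<close> by way of its
  isomorphism with \<open>KB\<close>, and to \<open>R(S)\<close>, whose members are represented by their graphs in the
  groupoid of pairs.
\<close>

section \<open>Local bisections of a groupoid\<close>

context groupoid
begin

lemma gmult_ginv_left:
  assumes "g \<in> carrier G"
  shows "gmult G (ginv G g) g = Some (gsrc G g)"
  using ginv_composable[OF assms] by (auto simp: gsrc_def)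

lemma gmult_ginv_right:
  assumes "g \<in> carrier G"
  shows "gmult G g (ginv G g) = Some (gtgt G g)"
  using gmult_ginv_left[OF ginv_closed[OF assms]] by (simp add: gsrc_def gtgt_def ginv_ginv assms)

lemma gsrc_ginv: "g \<in> carrier G \<Longrightarrow> gsrc G (ginv G g) = gtgt G g"
  by (simp add: gsrc_def gtgt_def ginv_ginv)

lemma gtgt_ginv: "g \<in> carrier G \<Longrightarrow> gtgt G (ginv G g) = gsrc G g"
  by (simp add: gsrc_def gtgt_def ginv_ginv)

lemma gsrc_closed: "g \<in> carrier G \<Longrightarrow> gsrc G g \<in> carrier G"
  using gmult_closed gmult_ginv_left ginv_closed by blast

lemma identities_subset_carrier: "identities G \<subseteq> carrier G"
  by (auto simp: identities_def gsrc_closed)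

lemma gmult_gsrc:
  assumes "g \<in> carrier G"
  shows "gmult G g (gsrc G g) = Some g"
  using ginv_cancel[OF ginv_closed[OF assms] assms gmult_ginv_left[OF assms]]
  by (simp add: ginv_ginv assms)

lemma gmult_gtgt:
  assumes "g \<in> carrier G"
  shows "gmult G (gtgt G g) g = Some g"
  using ginv_cancel[OF assms ginv_closed[OF assms] gmult_ginv_right[OF assms]]
  by (simp add: ginv_ginv assms)

text \<open>The axioms of a groupoid speak of composability only through the partial multiplication; this
  brings it back to sources and targets. If \<open>gh = x\<close>, then \<open>(g\<^sup>-\<^sup>1 x) h\<^sup>-\<^sup>1\<close> and
  \<open>g\<^sup>-\<^sup>1 (x h\<^sup>-\<^sup>1)\<close> are the target of \<open>h\<close> and the source of \<open>g\<close>.\<close>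

lemma gmult_defined_iff:
  assumes "g \<in> carrier G" "h \<in> carrier G"
  shows "(\<exists>x. gmult G g h = Some x) \<longleftrightarrow> gsrc G g = gtgt G h"
proof
  assume "\<exists>x. gmult G g h = Some x"
  then obtain x where x: "gmult G g h = Some x" by blast
  note c = ginv_cancel[OF assms x]
  have "\<exists>z. gmult G h (ginv G h) = Some z \<and> gmult G (ginv G g) g = Some z"
    using gmult_assoc[of "ginv G g" x "ginv G h" h g] c assms ginv_closed gmult_closed x by blast
  then show "gsrc G g = gtgt G h"
    using gmult_ginv_left gmult_ginv_right assms by auto
next
  assume eq: "gsrc G g = gtgt G h"
  have "gmult G g (gsrc G g) = Some g" "gmult G (gsrc G g) h = Some h"
    using gmult_gsrc[OF assms(1)] gmult_gtgt[OF assms(2)] eq by simp_all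
  then show "\<exists>x. gmult G g h = Some x"
    using gmult_assoc[of g "gsrc G g" h] assms gsrc_closed by blast
qed

lemma gmult_gsrc_gtgt:
  assumes "g \<in> carrier G" "h \<in> carrier G" "gmult G g h = Some x"
  shows "gsrc G x = gsrc G h" "gtgt G x = gtgt G g"
proof -
  note c = ginv_cancel[OF assms]
  have x: "x \<in> carrier G" using assms gmult_closed by blast
  show "gsrc G x = gsrc G h"
    using gmult_defined_iff[of x "ginv G h"] c x assms ginv_closed gtgt_ginv by auto
  show "gtgt G x = gtgt G g"
    using gmult_defined_iff[of "ginv G g" x] c x assms ginv_closed gsrc_ginv by auto
qed

lemma identities_gsrc_gtgt:
  assumes "e \<in> identities G"
  shows "gsrc G e = e" "gtgt G e = e"
proof -
  obtain h where h: "h \<in> carrier G" "e = gsrc G h" using assms by (auto simp: identities_def)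
  have e: "e \<in> carrier G" using assms identities_subset_carrier by blast
  have m: "gmult G h e = Some h" using gmult_gsrc h by simp
  show "gsrc G e = e" using gmult_gsrc_gtgt(1)[OF h(1) e m] h by simp
  show "gtgt G e = e" using gmult_defined_iff[OF h(1) e] m h by auto
qed

lemma gmult_identity_right:
  assumes "g \<in> carrier G" "e \<in> identities G" "gmult G g e = Some x"
  shows "x = g" "gsrc G g = e"
proof -
  have "e \<in> carrier G" using assms identities_subset_carrier by blast
  then show "gsrc G g = e"
    using gmult_defined_iff assms identities_gsrc_gtgt by metis
  then show "x = g" using gmult_gsrc assms by auto
qed

lemma gmult_identity_left:
  assumes "g \<in> carrier G" "e \<in> identities G" "gmult G e g = Some x"
  shows "x = g" "gtgt G g = e"
proof -
  have "e \<in> carrier G" using assms identities_subset_carrier by blast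
  then show "gtgt G g = e"
    using gmult_defined_iff assms identities_gsrc_gtgt by metis
  then show "x = g" using gmult_gtgt assms by auto
qed

lemma gsrc_identity: "g \<in> carrier G \<Longrightarrow> gsrc G g \<in> identities G"
  by (simp add: identities_def)

lemma gtgt_identity: "g \<in> carrier G \<Longrightarrow> gtgt G g \<in> identities G"
  using gsrc_identity ginv_closed gsrc_ginv by metis

text \<open>The associativity axiom needs both inner products to be defined. Definedness of one bracketing
  provides the other inner product, because a product has the source of its right factor and the
  target of its left factor.\<close>

lemma gmult_middle_defined:
  assumes "g \<in> carrier G" "h \<in> carrier G" "k \<in> carrier G"
    and "gmult G g h = Some x" "gmult G x k = Some y"
  obtains z where "gmult G h k = Some z" "gmult G g z = Some y"
proof -
  have "x \<in> carrier G" using assms gmult_closed by blast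
  then have "gsrc G h = gtgt G k"
    using gmult_defined_iff[of x k] gmult_gsrc_gtgt(1)[OF assms(1,2,4)] assms(3,5) by metis
  then obtain z where z: "gmult G h k = Some z" using gmult_defined_iff assms by blast
  then show ?thesis using that gmult_assoc[OF assms(1-3) assms(4) z] assms(5) by auto
qed

lemma gmult_middle_defined':
  assumes "g \<in> carrier G" "h \<in> carrier G" "k \<in> carrier G"
    and "gmult G h k = Some z" "gmult G g z = Some y"
  obtains x where "gmult G g h = Some x" "gmult G x k = Some y"
proof -
  have "z \<in> carrier G" using assms gmult_closed by blast
  then have "gsrc G g = gtgt G h"
    using gmult_defined_iff[of g z] gmult_gsrc_gtgt(2)[OF assms(2,3,4)] assms(1,5) by metis
  then obtain x where x: "gmult G g h = Some x" using gmult_defined_iff assms by blast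
  then show ?thesis using that gmult_assoc[OF assms(1-3) x assms(4)] assms(5) by auto
qed

lemma gset_mult_assoc:
  assumes "A \<subseteq> carrier G" "B \<subseteq> carrier G" "C \<subseteq> carrier G"
  shows "gset_mult G (gset_mult G A B) C = gset_mult G A (gset_mult G B C)"
proof (intro equalityI subsetI)
  fix y assume "y \<in> gset_mult G (gset_mult G A B) C"
  then obtain g h k x where e: "g \<in> A" "h \<in> B" "k \<in> C" "gmult G g h = Some x" "gmult G x k = Some y"
    by (auto simp: gset_mult_def)
  then obtain z where "gmult G h k = Some z" "gmult G g z = Some y"
    using gmult_middle_defined[of g h k x y] assms by blast
  then show "y \<in> gset_mult G A (gset_mult G B C)" using e by (auto simp: gset_mult_def)
next
  fix y assume "y \<in> gset_mult G A (gset_mult G B C)"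
  then obtain g h k x where e: "g \<in> A" "h \<in> B" "k \<in> C" "gmult G h k = Some x" "gmult G g x = Some y"
    by (auto simp: gset_mult_def)
  then obtain z where "gmult G g h = Some z" "gmult G z k = Some y"
    using gmult_middle_defined'[of g h k x y] assms by blast
  then show "y \<in> gset_mult G (gset_mult G A B) C" using e by (auto simp: gset_mult_def)
qed

lemma gset_mult_identities:
  assumes "A \<subseteq> carrier G"
  shows "gset_mult G A (identities G) = A" "gset_mult G (identities G) A = A"
proof -
  have "g \<in> gset_mult G A (identities G) \<and> g \<in> gset_mult G (identities G) A" if "g \<in> A" for g
    using that assms gmult_gsrc[of g] gsrc_identity[of g] gmult_gtgt[of g] gtgt_identity[of g]
    unfolding gset_mult_def by blast
  moreover have "gset_mult G A (identities G) \<subseteq> A"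
    using assms gmult_identity_right(1) unfolding gset_mult_def by blast
  moreover have "gset_mult G (identities G) A \<subseteq> A"
    using assms gmult_identity_left(1) unfolding gset_mult_def by blast
  ultimately show "gset_mult G A (identities G) = A" "gset_mult G (identities G) A = A" by blast+
qed

lemma local_bisection_carrier: "local_bisection G A \<Longrightarrow> A \<subseteq> carrier G"
  by (simp add: local_bisection_def)

lemma local_bisection_gsrc_inj:
  "\<lbrakk>local_bisection G A; g \<in> A; h \<in> A; gsrc G g = gsrc G h\<rbrakk> \<Longrightarrow> g = h"
  by (simp add: local_bisection_def)

lemma local_bisection_gtgt_inj:
  "\<lbrakk>local_bisection G A; g \<in> A; h \<in> A; gtgt G g = gtgt G h\<rbrakk> \<Longrightarrow> g = h"
  by (simp add: local_bisection_def)

lemma local_bisection_identities: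
  assumes "A \<subseteq> identities G"
  shows "local_bisection G A"
proof -
  have "gsrc G g = g \<and> gtgt G g = g \<and> g \<in> carrier G" if "g \<in> A" for g
    using identities_gsrc_gtgt identities_subset_carrier assms that by blast
  then show ?thesis by (auto simp: local_bisection_def)
qed

lemma gset_mult_inverse:
  assumes "local_bisection G A"
  shows "gset_mult G (ginv G ` A) A = gsrc G ` A"
proof (intro equalityI subsetI)
  note c = local_bisection_carrier[OF assms]
  fix x assume "x \<in> gset_mult G (ginv G ` A) A"
  then obtain g h where gh: "g \<in> A" "h \<in> A" "gmult G (ginv G g) h = Some x"
    by (auto simp: gset_mult_def)
  then have "g \<in> carrier G" "h \<in> carrier G" using c by blast+
  then have "gtgt G g = gtgt G h"
    using gmult_defined_iff[of "ginv G g" h] gh(3) ginv_closed gsrc_ginv by auto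
  then have "g = h" using gh local_bisection_gtgt_inj[OF assms] by blast
  then have "x = gsrc G h" using gh gmult_ginv_left c by auto
  then show "x \<in> gsrc G ` A" using gh by blast
next
  note c = local_bisection_carrier[OF assms]
  fix x assume "x \<in> gsrc G ` A"
  then show "x \<in> gset_mult G (ginv G ` A) A"
    using gmult_ginv_left c unfolding gset_mult_def by blast
qed

lemma ginv_image_ginv_image:
  assumes "A \<subseteq> carrier G"
  shows "ginv G ` ginv G ` A = A"
proof -
  have "(\<lambda>g. ginv G (ginv G g)) ` A = (\<lambda>g. g) ` A"
    by (rule image_cong) (use assms ginv_ginv in auto)
  then show ?thesis by (simp add: image_image)
qed

lemma gset_mult_subset_identities:
  assumes "A \<subseteq> identities G" "B \<subseteq> identities G"
  shows "gset_mult G A B = A \<inter> B"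
proof (intro equalityI subsetI)
  fix x assume "x \<in> gset_mult G A B"
  then obtain g h where gh: "g \<in> A" "h \<in> B" "gmult G g h = Some x" by (auto simp: gset_mult_def)
  have "g \<in> carrier G" "h \<in> carrier G" using gh assms identities_subset_carrier by auto
  then have "x = g" "x = h"
    using gh gmult_identity_right(1) gmult_identity_left(1) assms by blast+
  then show "x \<in> A \<inter> B" using gh by blast
next
  fix x assume x: "x \<in> A \<inter> B"
  then have "x \<in> carrier G" "gsrc G x = x"
    using assms identities_subset_carrier identities_gsrc_gtgt by blast+
  then show "x \<in> gset_mult G A B" using x gmult_gsrc[of x] by (auto simp: gset_mult_def)
qed

text \<open>Inclusion of local bisections is restriction of the source, hence an instance of the natural
  order of an inverse monoid.\<close>

lemma gset_mult_restrict:
  assumes "B \<subseteq> carrier G" "A \<subseteq> B" "local_bisection G B"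
  shows "gset_mult G B (gsrc G ` A) = A"
proof (intro equalityI subsetI)
  fix x assume "x \<in> gset_mult G B (gsrc G ` A)"
  then obtain g h where gh: "g \<in> B" "h \<in> A" "gmult G g (gsrc G h) = Some x"
    by (auto simp: gset_mult_def)
  have "x = g" "gsrc G g = gsrc G h"
    using gmult_identity_right[of g "gsrc G h" x] gh assms gsrc_identity by blast+
  then show "x \<in> A" using local_bisection_gsrc_inj[OF assms(3)] gh assms by blast
next
  fix x assume "x \<in> A"
  then show "x \<in> gset_mult G B (gsrc G ` A)"
    using assms gmult_gsrc unfolding gset_mult_def by blast
qed

lemma gset_mult_idempotent_iff:
  assumes "local_bisection G A"
  shows "gset_mult G A A = A \<longleftrightarrow> A \<subseteq> identities G"
proof
  assume idem: "gset_mult G A A = A"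
  show "A \<subseteq> identities G"
  proof
    fix g assume g: "g \<in> A"
    then have "g \<in> gset_mult G A A" using idem by simp
    then obtain h k where hk: "h \<in> A" "k \<in> A" "gmult G h k = Some g"
      by (auto simp: gset_mult_def)
    have c: "g \<in> carrier G" "h \<in> carrier G" "k \<in> carrier G"
      using g hk local_bisection_carrier[OF assms] by auto
    have "g = k" "g = h"
      using gmult_gsrc_gtgt[OF c(2,3) hk(3)] local_bisection_gsrc_inj[OF assms]
        local_bisection_gtgt_inj[OF assms] g hk by metis+
    then have "gmult G (ginv G g) g = Some g"
      using ginv_cancel[of g g g] hk c by auto
    then have "gsrc G g = g" using gmult_ginv_left[OF c(1)] by simp
    then show "g \<in> identities G" using c gsrc_identity by metis
  qed
next
  assume "A \<subseteq> identities G"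
  then show "gset_mult G A A = A" using gset_mult_subset_identities by blast
qed

text \<open>If \<open>ABA = A\<close>, then every \<open>g \<in> A\<close> is a product \<open>h b k\<close>, where \<open>h = g = k\<close> because
  the source and the target of \<open>g\<close> determine it in \<open>A\<close>; and \<open>g b g = g\<close> says that \<open>b = g\<^sup>-\<^sup>1\<close>.\<close>

lemma ginv_image_subset_if_inverse:
  assumes "local_bisection G A" "B \<subseteq> carrier G" "gset_mult G (gset_mult G A B) A = A"
  shows "ginv G ` A \<subseteq> B"
proof
  fix x assume "x \<in> ginv G ` A"
  then obtain g where g: "g \<in> A" "x = ginv G g" by blast
  have "g \<in> gset_mult G (gset_mult G A B) A" using g assms by simp
  then obtain h b k y where e: "h \<in> A" "b \<in> B" "k \<in> A" "gmult G h b = Some y" "gmult G y k = Some g"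
    by (auto simp: gset_mult_def)
  have c: "g \<in> carrier G" "h \<in> carrier G" "k \<in> carrier G" "b \<in> carrier G" "y \<in> carrier G"
    using g e local_bisection_carrier[OF assms(1)] assms(2) gmult_closed by blast+
  have "gsrc G g = gsrc G k" "gtgt G g = gtgt G h"
    using gmult_gsrc_gtgt[OF c(5,3) e(5)] gmult_gsrc_gtgt[OF c(2,4) e(4)] by auto
  then have "g = k" "g = h"
    using local_bisection_gsrc_inj[OF assms(1)] local_bisection_gtgt_inj[OF assms(1)] g e by blast+
  then have "gmult G y g = Some g" "gmult G g b = Some y" using e by auto
  then have "gmult G g (ginv G g) = Some y" "gmult G (ginv G g) y = Some b"
    using ginv_cancel c by auto
  moreover have "gmult G (ginv G g) (gtgt G g) = Some (ginv G g)"
    using gmult_gsrc[OF ginv_closed[OF c(1)]] gsrc_ginv[OF c(1)] by simp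
  ultimately have "b = ginv G g" using gmult_ginv_right[OF c(1)] by auto
  then show "x \<in> B" using g e by simp
qed

lemma gset_mult_inverse_regular:
  assumes "local_bisection G A"
  shows "gset_mult G (gset_mult G A (ginv G ` A)) A = A"
proof -
  note c = local_bisection_carrier[OF assms]
  have "ginv G ` A \<subseteq> carrier G" using c ginv_closed by blast
  then have "gset_mult G (gset_mult G A (ginv G ` A)) A = gset_mult G A (gsrc G ` A)"
    using gset_mult_assoc c gset_mult_inverse[OF assms] by simp
  then show ?thesis using gset_mult_restrict[OF c _ assms] by simp
qed

text \<open>Compatibility says that \<open>g\<^sup>-\<^sup>1h\<close> and \<open>gh\<^sup>-\<^sup>1\<close> are identities whenever they are defined for
  \<open>g \<in> A\<close> and \<open>h \<in> B\<close>, that is, \<open>g = h\<close> as soon as the targets or the sources coincide.\<close>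

lemma compatible_union_local_bisection:
  assumes "local_bisection G A" "local_bisection G B"
    and "gset_mult G (ginv G ` A) B \<subseteq> identities G" "gset_mult G A (ginv G ` B) \<subseteq> identities G"
  shows "local_bisection G (A \<union> B)"
proof -
  have eq: "g = h" if gh: "g \<in> A" "h \<in> B" and st: "gsrc G g = gsrc G h \<or> gtgt G g = gtgt G h" for g h
  proof -
    have c: "g \<in> carrier G" "h \<in> carrier G"
      using gh assms local_bisection_carrier by blast+
    from st show ?thesis
    proof
      assume "gsrc G g = gsrc G h"
      then obtain x where x: "gmult G g (ginv G h) = Some x"
        using gmult_defined_iff[of g "ginv G h"] c ginv_closed gtgt_ginv by auto
      then have "x \<in> gset_mult G A (ginv G ` B)" using gh by (auto simp: gset_mult_def)
      then have i: "x \<in> identities G" using assms by blast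
      have "gmult G x h = Some g"
        using ginv_cancel[OF c(1) ginv_closed[OF c(2)] x] ginv_ginv c by simp
      then show ?thesis using gmult_identity_left(1)[OF c(2) i] by simp
    next
      assume "gtgt G g = gtgt G h"
      then obtain x where x: "gmult G (ginv G g) h = Some x"
        using gmult_defined_iff[of "ginv G g" h] c ginv_closed gsrc_ginv by auto
      then have "x \<in> gset_mult G (ginv G ` A) B" using gh by (auto simp: gset_mult_def)
      then have i: "x \<in> identities G" using assms by blast
      have "gmult G g x = Some h"
        using ginv_cancel[OF ginv_closed[OF c(1)] c(2) x] ginv_ginv c by simp
      then show ?thesis using gmult_identity_right(1)[OF c(1) i] by simp
    qed
  qed
  show ?thesis
    unfolding local_bisection_def
  proof (intro conjI ballI)
    show "A \<union> B \<subseteq> carrier G" using assms local_bisection_carrier by blast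
    fix g h assume gh: "g \<in> A \<union> B" "h \<in> A \<union> B"
    show "gsrc G g = gsrc G h \<longrightarrow> g = h"
      using gh eq local_bisection_gsrc_inj[OF assms(1)] local_bisection_gsrc_inj[OF assms(2)]
      by (metis Un_iff)
    show "gtgt G g = gtgt G h \<longrightarrow> g = h"
      using gh eq local_bisection_gtgt_inj[OF assms(1)] local_bisection_gtgt_inj[OF assms(2)]
      by (metis Un_iff)
  qed
qed

lemma bisection_subset_eq:
  assumes "bisection G A" "local_bisection G B" "A \<subseteq> B"
  shows "A = B"
proof
  show "B \<subseteq> A"
  proof
    fix g assume g: "g \<in> B"
    have A: "local_bisection G A" "gset_mult G (ginv G ` A) A = identities G"
      using assms(1) by (simp_all add: bisection_def)
    have "gsrc G g \<in> identities G" using g local_bisection_carrier[OF assms(2)] gsrc_identity by blast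
    then obtain h where "h \<in> A" "gsrc G g = gsrc G h" using gset_mult_inverse[OF A(1)] A(2) by auto
    then show "g \<in> A" using local_bisection_gsrc_inj[OF assms(2)] g assms(3) by blast
  qed
qed fact

end

section \<open>Boolean inverse monoids of local bisections\<close>

text \<open>A criterion that hides the choice operators in the joins, meets and bounds of an abstract
  lattice: it suffices to embed the order into a field of subsets of some set \<open>T\<close>.\<close>

lemma boolean_lattice_if_field_of_sets:
  fixes I :: "'a set" and f :: "'a \<Rightarrow> 'b set"
  assumes inj: "inj_on f I"
    and leq: "\<And>x y. \<lbrakk>x \<in> I; y \<in> I\<rbrakk> \<Longrightarrow> leq x y \<longleftrightarrow> f x \<subseteq> f y"
    and top: "T \<in> f ` I" "\<And>x. x \<in> I \<Longrightarrow> f x \<subseteq> T"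
    and Un: "\<And>x y. \<lbrakk>x \<in> I; y \<in> I\<rbrakk> \<Longrightarrow> f x \<union> f y \<in> f ` I"
    and compl: "\<And>x. x \<in> I \<Longrightarrow> T - f x \<in> f ` I"
  shows "boolean_lattice \<lparr>carrier = I, eq = (=), le = leq\<rparr>"
proof -
  let ?L = "\<lparr>carrier = I, eq = (=), le = leq\<rparr>"
  have Int: "f x \<inter> f y \<in> f ` I" if xy: "x \<in> I" "y \<in> I" for x y
  proof -
    have "f x \<inter> f y = T - ((T - f x) \<union> (T - f y))" using top(2) xy by blast
    then show ?thesis using Un compl xy by (smt (verit, best) imageE)
  qed
  have empty: "{} \<in> f ` I" using compl top(1) by (metis Diff_cancel imageE)
  have eqI: "x = y" if "x \<in> I" "y \<in> I" "f x = f y" for x y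
    using inj that by (simp add: inj_on_eq_iff)
  interpret partial_order ?L
    by unfold_locales (use leq eqI in \<open>auto, blast?\<close>)
  have lub: "least ?L s (Upper ?L {x, y})" if "x \<in> I" "y \<in> I" "s \<in> I" "f s = f x \<union> f y" for x y s
    by (rule least_UpperI) (use that leq in \<open>auto simp: Upper_def\<close>)
  have glb: "greatest ?L s (Lower ?L {x, y})" if "x \<in> I" "y \<in> I" "s \<in> I" "f s = f x \<inter> f y" for x y s
    by (rule greatest_LowerI) (use that leq in \<open>auto simp: Lower_def\<close>)
  obtain t where t: "t \<in> I" "f t = T" using top(1) by blast
  obtain z where z: "z \<in> I" "f z = {}" using empty by blast
  have greatest_t: "greatest ?L t (carrier ?L)" using t top(2) leq by (simp add: greatest_def)
  have least_z: "least ?L z (carrier ?L)" using z leq by (simp add: least_def)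
  interpret bounded_lattice ?L
  proof unfold_locales
    show "\<exists>s. least ?L s (Upper ?L {x, y})" if "x \<in> carrier ?L" "y \<in> carrier ?L" for x y
      using that lub Un by (metis (no_types, lifting) imageE partial_object.select_convs(1))
    show "\<exists>s. greatest ?L s (Lower ?L {x, y})" if "x \<in> carrier ?L" "y \<in> carrier ?L" for x y
      using that glb Int by (metis (no_types, lifting) imageE partial_object.select_convs(1))
    show "\<exists>x. least ?L x (carrier ?L)" using least_z by blast
    show "\<exists>x. greatest ?L x (carrier ?L)" using greatest_t by blast
  qed
  have f_join: "f (x \<squnion>\<^bsub>?L\<^esub> y) = f x \<union> f y \<and> x \<squnion>\<^bsub>?L\<^esub> y \<in> I" if xy: "x \<in> I" "y \<in> I" for x y
  proof -
    obtain s where s: "s \<in> I" "f s = f x \<union> f y" using Un[OF xy] by (metis imageE)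
    then have "x \<squnion>\<^bsub>?L\<^esub> y = s"
      unfolding join_def sup_def using lub[OF xy s] least_unique by (metis someI_ex)
    then show ?thesis using s by simp
  qed
  have f_meet: "f (x \<sqinter>\<^bsub>?L\<^esub> y) = f x \<inter> f y \<and> x \<sqinter>\<^bsub>?L\<^esub> y \<in> I" if xy: "x \<in> I" "y \<in> I" for x y
  proof -
    obtain s where s: "s \<in> I" "f s = f x \<inter> f y" using Int[OF xy] by (metis imageE)
    then have "x \<sqinter>\<^bsub>?L\<^esub> y = s"
      unfolding meet_def inf_def using glb[OF xy s] greatest_unique by (metis someI_ex)
    then show ?thesis using s by simp
  qed
  have f_top: "\<top>\<^bsub>?L\<^esub> = t" using greatest_t top_greatest greatest_unique by blast
  have f_bot: "\<bottom>\<^bsub>?L\<^esub> = z" using least_z bottom_least least_unique by blast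
  show ?thesis
  proof unfold_locales
    fix x y w assume "x \<in> carrier ?L" "y \<in> carrier ?L" "w \<in> carrier ?L"
    then have c: "x \<in> I" "y \<in> I" "w \<in> I" by auto
    show "x \<sqinter>\<^bsub>?L\<^esub> (y \<squnion>\<^bsub>?L\<^esub> w) = (x \<sqinter>\<^bsub>?L\<^esub> y) \<squnion>\<^bsub>?L\<^esub> (x \<sqinter>\<^bsub>?L\<^esub> w)"
      by (rule eqI) (use c f_join f_meet in auto)
  next
    fix x assume "x \<in> carrier ?L"
    then have x: "x \<in> I" by simp
    obtain y where y: "y \<in> I" "f y = T - f x" using compl[OF x] by (metis imageE)
    have "x \<sqinter>\<^bsub>?L\<^esub> y = z" by (rule eqI) (use f_meet[OF x y(1)] y z in auto)
    moreover have "x \<squnion>\<^bsub>?L\<^esub> y = t" by (rule eqI) (use f_join[OF x y(1)] y t top(2)[OF x] in auto)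
    ultimately show "\<exists>y\<in>carrier ?L. x \<sqinter>\<^bsub>?L\<^esub> y = \<bottom>\<^bsub>?L\<^esub> \<and> x \<squnion>\<^bsub>?L\<^esub> y = \<top>\<^bsub>?L\<^esub>"
      using y f_top f_bot by auto
  qed
qed

text \<open>The axioms of an inverse monoid are verified through a faithful representation by sets of
  arrows. Taking the representation as a parameter makes the same lemmas available for \<open>KB\<close>, for its isomorphic copy \<open>C(S)\<close> and for
  monoids of partial bijections.\<close>

locale local_bisection_representation = groupoid G for G :: "('g, 'n) groupoid_scheme" +
  fixes M :: "('a, 'm) monoid_scheme" and \<phi> :: "'a \<Rightarrow> 'g set"
  assumes inj_rep: "inj_on \<phi> (carrier M)"
    and local_bisection_rep: "a \<in> carrier M \<Longrightarrow> local_bisection G (\<phi> a)"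
    and mult_closed: "\<lbrakk>a \<in> carrier M; b \<in> carrier M\<rbrakk> \<Longrightarrow> a \<otimes>\<^bsub>M\<^esub> b \<in> carrier M"
    and rep_mult: "\<lbrakk>a \<in> carrier M; b \<in> carrier M\<rbrakk> \<Longrightarrow> \<phi> (a \<otimes>\<^bsub>M\<^esub> b) = gset_mult G (\<phi> a) (\<phi> b)"
    and unit_closed: "\<one>\<^bsub>M\<^esub> \<in> carrier M"
    and rep_one: "\<phi> \<one>\<^bsub>M\<^esub> = identities G"
    and ginv_rep: "a \<in> carrier M \<Longrightarrow> ginv G ` \<phi> a \<in> \<phi> ` carrier M"
begin

lemma rep_eqI: "\<lbrakk>a \<in> carrier M; b \<in> carrier M; \<phi> a = \<phi> b\<rbrakk> \<Longrightarrow> a = b"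
  using inj_rep by (simp add: inj_on_eq_iff)

lemma rep_carrier: "a \<in> carrier M \<Longrightarrow> \<phi> a \<subseteq> carrier G"
  using local_bisection_rep local_bisection_carrier by blast

lemma monoid_represented: "monoid M"
proof unfold_locales
  show "x \<otimes>\<^bsub>M\<^esub> y \<in> carrier M" if "x \<in> carrier M" "y \<in> carrier M" for x y
    using mult_closed that by blast
  show "\<one>\<^bsub>M\<^esub> \<in> carrier M" by (rule unit_closed)
  show "x \<otimes>\<^bsub>M\<^esub> y \<otimes>\<^bsub>M\<^esub> z = x \<otimes>\<^bsub>M\<^esub> (y \<otimes>\<^bsub>M\<^esub> z)"
    if "x \<in> carrier M" "y \<in> carrier M" "z \<in> carrier M" for x y z
    by (rule rep_eqI) (use that in \<open>simp_all add: mult_closed rep_mult gset_mult_assoc rep_carrier\<close>)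
  show "\<one>\<^bsub>M\<^esub> \<otimes>\<^bsub>M\<^esub> x = x" if "x \<in> carrier M" for x
    by (rule rep_eqI)
      (use that in \<open>simp_all add: mult_closed unit_closed rep_mult rep_one gset_mult_identities rep_carrier\<close>)
  show "x \<otimes>\<^bsub>M\<^esub> \<one>\<^bsub>M\<^esub> = x" if "x \<in> carrier M" for x
    by (rule rep_eqI)
      (use that in \<open>simp_all add: mult_closed unit_closed rep_mult rep_one gset_mult_identities rep_carrier\<close>)
qed

text \<open>A local bisection \<open>A\<close> determines its generalised inverse: each of the two equations forces one
  inclusion between \<open>A\<^sup>-\<^sup>1\<close> and the candidate.\<close>

lemma inverse_iff:
  assumes "x \<in> carrier M" "y \<in> carrier M"
  shows "(x \<otimes>\<^bsub>M\<^esub> y \<otimes>\<^bsub>M\<^esub> x = x \<and> y \<otimes>\<^bsub>M\<^esub> x \<otimes>\<^bsub>M\<^esub> y = y) \<longleftrightarrow> \<phi> y = ginv G ` \<phi> x"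
proof -
  have "x \<otimes>\<^bsub>M\<^esub> y \<otimes>\<^bsub>M\<^esub> x = x \<longleftrightarrow> gset_mult G (gset_mult G (\<phi> x) (\<phi> y)) (\<phi> x) = \<phi> x"
    "y \<otimes>\<^bsub>M\<^esub> x \<otimes>\<^bsub>M\<^esub> y = y \<longleftrightarrow> gset_mult G (gset_mult G (\<phi> y) (\<phi> x)) (\<phi> y) = \<phi> y"
    using assms rep_eqI rep_mult mult_closed by metis+
  moreover have "ginv G ` \<phi> x = \<phi> y"
    if "gset_mult G (gset_mult G (\<phi> x) (\<phi> y)) (\<phi> x) = \<phi> x"
      "gset_mult G (gset_mult G (\<phi> y) (\<phi> x)) (\<phi> y) = \<phi> y"
  proof
    show "ginv G ` \<phi> x \<subseteq> \<phi> y"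
      using ginv_image_subset_if_inverse that assms rep_carrier local_bisection_rep by blast
    have "ginv G ` \<phi> y \<subseteq> \<phi> x"
      using ginv_image_subset_if_inverse that assms rep_carrier local_bisection_rep by blast
    then show "\<phi> y \<subseteq> ginv G ` \<phi> x"
      using ginv_image_ginv_image[OF rep_carrier[OF assms(2)]] by blast
  qed
  moreover have "gset_mult G (gset_mult G (\<phi> x) (\<phi> y)) (\<phi> x) = \<phi> x \<and>
      gset_mult G (gset_mult G (\<phi> y) (\<phi> x)) (\<phi> y) = \<phi> y" if y: "\<phi> y = ginv G ` \<phi> x"
  proof -
    have "\<phi> x = ginv G ` \<phi> y"
      using y ginv_image_ginv_image[OF rep_carrier[OF assms(1)]] by simp
    then show ?thesis using gset_mult_inverse_regular local_bisection_rep assms y by metis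
  qed
  ultimately show ?thesis by blast
qed

lemma inverse_monoid_represented: "inverse_monoid M"
proof -
  interpret monoid M by (rule monoid_represented)
  show ?thesis
  proof unfold_locales
    fix x assume x: "x \<in> carrier M"
    obtain y where y: "y \<in> carrier M" "\<phi> y = ginv G ` \<phi> x" using ginv_rep[OF x] by (metis imageE)
    show "\<exists>!y. y \<in> carrier M \<and> x \<otimes>\<^bsub>M\<^esub> y \<otimes>\<^bsub>M\<^esub> x = x \<and> y \<otimes>\<^bsub>M\<^esub> x \<otimes>\<^bsub>M\<^esub> y = y"
    proof (rule ex1I[of _ y])
      show "y \<in> carrier M \<and> x \<otimes>\<^bsub>M\<^esub> y \<otimes>\<^bsub>M\<^esub> x = x \<and> y \<otimes>\<^bsub>M\<^esub> x \<otimes>\<^bsub>M\<^esub> y = y"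
        using inverse_iff[OF x y(1)] y by blast
      show "y' = y" if "y' \<in> carrier M \<and> x \<otimes>\<^bsub>M\<^esub> y' \<otimes>\<^bsub>M\<^esub> x = x \<and> y' \<otimes>\<^bsub>M\<^esub> x \<otimes>\<^bsub>M\<^esub> y' = y'" for y'
        using inverse_iff[OF x, of y'] that y rep_eqI by metis
    qed
  qed
qed

lemma gen_inverse_represented:
  assumes "x \<in> carrier M"
  shows "gen_inverse M x \<in> carrier M" "\<phi> (gen_inverse M x) = ginv G ` \<phi> x"
proof -
  interpret inverse_monoid M by (rule inverse_monoid_represented)
  let ?y = "gen_inverse M x"
  have *: "?y \<in> carrier M \<and> x \<otimes>\<^bsub>M\<^esub> ?y \<otimes>\<^bsub>M\<^esub> x = x \<and> ?y \<otimes>\<^bsub>M\<^esub> x \<otimes>\<^bsub>M\<^esub> ?y = ?y"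
    unfolding gen_inverse_def by (rule theI'[OF ex1_gen_inverse[OF assms]])
  then show "?y \<in> carrier M" by blast
  then show "\<phi> ?y = ginv G ` \<phi> x" using inverse_iff[OF assms] * by blast
qed

lemma idempotents_iff: "e \<in> idempotents M \<longleftrightarrow> e \<in> carrier M \<and> \<phi> e \<subseteq> identities G"
proof (cases "e \<in> carrier M")
  case True
  then have "e \<otimes>\<^bsub>M\<^esub> e = e \<longleftrightarrow> gset_mult G (\<phi> e) (\<phi> e) = \<phi> e"
    using rep_eqI rep_mult mult_closed by metis
  then show ?thesis
    using True gset_mult_idempotent_iff[OF local_bisection_rep[OF True]]
    by (simp add: idempotents_def)
qed (simp add: idempotents_def)

lemma natural_le_iff:
  assumes "a \<in> carrier M" "b \<in> carrier M"
  shows "natural_le M a b \<longleftrightarrow> \<phi> a \<subseteq> \<phi> b"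
proof
  assume "natural_le M a b"
  then obtain e where e: "e \<in> idempotents M" "a = b \<otimes>\<^bsub>M\<^esub> e" by (auto simp: natural_le_def)
  then have "\<phi> a = gset_mult G (\<phi> b) (\<phi> e)" "\<phi> e \<subseteq> identities G"
    using idempotents_iff rep_mult assms by auto
  then show "\<phi> a \<subseteq> \<phi> b"
    using gmult_identity_right(1) rep_carrier[OF assms(2)] unfolding gset_mult_def by blast
next
  assume sub: "\<phi> a \<subseteq> \<phi> b"
  have A: "local_bisection G (\<phi> a)" "\<phi> a \<subseteq> carrier G"
    using assms local_bisection_rep rep_carrier by auto
  define e where "e = gen_inverse M a \<otimes>\<^bsub>M\<^esub> a"
  have e: "e \<in> carrier M" "\<phi> e = gsrc G ` \<phi> a"
    using assms gen_inverse_represented mult_closed rep_mult gset_mult_inverse[OF A(1)]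
    by (auto simp: e_def)
  have "e \<in> idempotents M" using e idempotents_iff gsrc_identity A by auto
  moreover have "a = b \<otimes>\<^bsub>M\<^esub> e"
    by (rule rep_eqI)
      (use assms e mult_closed rep_mult gset_mult_restrict sub rep_carrier local_bisection_rep in auto)
  ultimately show "natural_le M a b" by (auto simp: natural_le_def)
qed

lemma is_zeroI:
  assumes "z \<in> carrier M" "\<phi> z = {}"
  shows "is_zero M z"
  unfolding is_zero_def
proof (intro conjI ballI)
  show "z \<in> carrier M" by fact
  fix x assume x: "x \<in> carrier M"
  show "z \<otimes>\<^bsub>M\<^esub> x = z" "x \<otimes>\<^bsub>M\<^esub> z = z"
    by (rule rep_eqI; use assms x mult_closed rep_mult in \<open>auto simp: gset_mult_def\<close>)+
qed

lemma mzero_eqI: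
  assumes "z \<in> carrier M" "\<phi> z = {}"
  shows "mzero M = z"
  unfolding mzero_def
proof (rule the_equality)
  show z: "is_zero M z" by (rule is_zeroI[OF assms])
  show "z' = z" if "is_zero M z'" for z'
    using z that unfolding is_zero_def by metis
qed

lemma meet_eqI:
  assumes "x \<in> carrier M" "y \<in> carrier M" "z \<in> carrier M" "\<phi> z = \<phi> x \<inter> \<phi> y"
  shows "x \<sqinter>\<^bsub>natural_order M\<^esub> y = z"
  unfolding meet_def inf_def
proof (rule some_equality)
  let ?N = "natural_order M"
  show z: "greatest ?N z (Lower ?N {x, y})"
    by (rule greatest_LowerI) (use assms natural_le_iff in \<open>auto simp: natural_order_def Lower_def\<close>)
  fix z' assume z': "greatest ?N z' (Lower ?N {x, y})"
  have c: "z' \<in> carrier M"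
    using greatest_closed[OF z'] by (simp add: natural_order_def)
  have "natural_le M z z'" "natural_le M z' z"
    using greatest_le[OF z' greatest_mem[OF z]] greatest_le[OF z greatest_mem[OF z']]
    by (simp_all add: natural_order_def)
  then show "z' = z" using natural_le_iff c assms(3) rep_eqI by blast
qed

lemma compatible_union:
  assumes "a \<in> carrier M" "b \<in> carrier M" "compatible M a b"
  shows "local_bisection G (\<phi> a \<union> \<phi> b)"
proof -
  have "\<phi> (gen_inverse M a \<otimes>\<^bsub>M\<^esub> b) \<subseteq> identities G" "\<phi> (a \<otimes>\<^bsub>M\<^esub> gen_inverse M b) \<subseteq> identities G"
    using assms(3) idempotents_iff by (auto simp: compatible_def)
  then show ?thesis
    using compatible_union_local_bisection[of "\<phi> a" "\<phi> b"] assms gen_inverse_represented rep_mult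
      local_bisection_rep by simp
qed

lemma is_joinI:
  assumes "a \<in> carrier M" "b \<in> carrier M" "c \<in> carrier M" "\<phi> c = \<phi> a \<union> \<phi> b"
  shows "is_join M c a b"
  unfolding is_join_def
  by (rule least_UpperI) (use assms natural_le_iff in \<open>auto simp: natural_order_def Upper_def\<close>)

lemma is_join_unique:
  assumes "is_join M c a b" "is_join M c' a b"
  shows "c = c'"
proof -
  have c: "c \<in> carrier M" "c' \<in> carrier M"
    using assms unfolding is_join_def by (metis least_closed natural_order_def partial_object.select_convs(1))+
  have "natural_le M c c'" "natural_le M c' c"
    using assms by (auto simp: is_join_def least_def natural_order_def)
  then show ?thesis using natural_le_iff c rep_eqI by blast
qed

text \<open>Joins of compatible elements are unions, over which the product of sets of arrows distributes;
  idempotents are represented by sets of identities, which form a field of sets.\<close>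

theorem boolean_inverse_monoid_represented:
  assumes empty: "{} \<in> \<phi> ` carrier M"
    and union: "\<And>a b. \<lbrakk>a \<in> carrier M; b \<in> carrier M; local_bisection G (\<phi> a \<union> \<phi> b)\<rbrakk>
      \<Longrightarrow> \<phi> a \<union> \<phi> b \<in> \<phi> ` carrier M"
    and compl: "\<And>a. \<lbrakk>a \<in> carrier M; \<phi> a \<subseteq> identities G\<rbrakk> \<Longrightarrow> identities G - \<phi> a \<in> \<phi> ` carrier M"
  shows "boolean_inverse_monoid M"
proof -
  interpret inverse_monoid M by (rule inverse_monoid_represented)
  have join: "\<exists>c\<in>carrier M. \<phi> c = \<phi> a \<union> \<phi> b"
    if "a \<in> carrier M" "b \<in> carrier M" "compatible M a b" for a b
    using union[OF that(1,2) compatible_union[OF that]] by (metis imageE)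
  show ?thesis
  proof (intro boolean_inverse_monoid.intro boolean_inverse_monoid_axioms.intro
      inverse_monoid_represented)
    show "\<exists>z. is_zero M z" using empty is_zeroI by (metis imageE)
    show "\<exists>c. is_join M c a b" if "a \<in> carrier M" "b \<in> carrier M" "compatible M a b" for a b
      using join[OF that] is_joinI that by blast
    fix a b c s
    assume ab: "a \<in> carrier M" "b \<in> carrier M" "compatible M a b" "is_join M c a b" "s \<in> carrier M"
    obtain c' where c': "c' \<in> carrier M" "\<phi> c' = \<phi> a \<union> \<phi> b" using join ab by blast
    then have c: "c \<in> carrier M" "\<phi> c = \<phi> a \<union> \<phi> b"
      using is_join_unique is_joinI ab by blast+
    have "gset_mult G (\<phi> s) (\<phi> a \<union> \<phi> b) = gset_mult G (\<phi> s) (\<phi> a) \<union> gset_mult G (\<phi> s) (\<phi> b)"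
      "gset_mult G (\<phi> a \<union> \<phi> b) (\<phi> s) = gset_mult G (\<phi> a) (\<phi> s) \<union> gset_mult G (\<phi> b) (\<phi> s)"
      by (auto simp: gset_mult_def)
    then show "is_join M (s \<otimes>\<^bsub>M\<^esub> c) (s \<otimes>\<^bsub>M\<^esub> a) (s \<otimes>\<^bsub>M\<^esub> b) \<and>
        is_join M (c \<otimes>\<^bsub>M\<^esub> s) (a \<otimes>\<^bsub>M\<^esub> s) (b \<otimes>\<^bsub>M\<^esub> s)"
      using ab c by (simp add: is_joinI mult_closed rep_mult)
  next
    have I: "idempotents M \<subseteq> carrier M" by (auto simp: idempotents_def)
    have mem: "X \<in> \<phi> ` idempotents M" if "X \<in> \<phi> ` carrier M" "X \<subseteq> identities G" for X
      using that idempotents_iff by auto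
    show "boolean_lattice (idempotent_order M)"
      unfolding idempotent_order_def
    proof (rule boolean_lattice_if_field_of_sets[where f = \<phi> and T = "identities G"])
      show "inj_on \<phi> (idempotents M)" using inj_rep I inj_on_subset by blast
      show "natural_le M x y \<longleftrightarrow> \<phi> x \<subseteq> \<phi> y" if "x \<in> idempotents M" "y \<in> idempotents M" for x y
        using natural_le_iff that I by blast
      show "identities G \<in> \<phi> ` idempotents M"
        using mem rep_one unit_closed by blast
      show "\<phi> x \<subseteq> identities G" if "x \<in> idempotents M" for x
        using idempotents_iff that by blast
      show "\<phi> x \<union> \<phi> y \<in> \<phi> ` idempotents M" if "x \<in> idempotents M" "y \<in> idempotents M" for x y
        using that idempotents_iff union local_bisection_identities[of "\<phi> x \<union> \<phi> y"] mem
        by (metis (no_types, lifting) Un_least)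
      show "identities G - \<phi> x \<in> \<phi> ` idempotents M" if "x \<in> idempotents M" for x
        using compl[of x] mem[of "identities G - \<phi> x"] idempotents_iff[of x] that by simp
    qed
  qed
qed

lemma Units_represented:
  "Units M = {a \<in> carrier M. bisection G (\<phi> a)}"
proof (intro equalityI subsetI)
  interpret inverse_monoid M by (rule inverse_monoid_represented)
  fix a assume "a \<in> Units M"
  then obtain b where ab: "a \<in> carrier M" "b \<in> carrier M" "a \<otimes>\<^bsub>M\<^esub> b = \<one>\<^bsub>M\<^esub>" "b \<otimes>\<^bsub>M\<^esub> a = \<one>\<^bsub>M\<^esub>"
    unfolding Units_def by blast
  then have "a \<otimes>\<^bsub>M\<^esub> b \<otimes>\<^bsub>M\<^esub> a = a \<and> b \<otimes>\<^bsub>M\<^esub> a \<otimes>\<^bsub>M\<^esub> b = b" by simp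
  then have "\<phi> b = ginv G ` \<phi> a" using inverse_iff ab by blast
  then have "bisection G (\<phi> a)"
    using ab rep_mult rep_one local_bisection_rep unfolding bisection_def by metis
  then show "a \<in> {a \<in> carrier M. bisection G (\<phi> a)}" using ab by blast
next
  fix a assume "a \<in> {a \<in> carrier M. bisection G (\<phi> a)}"
  then have a: "a \<in> carrier M" "bisection G (\<phi> a)" by auto
  let ?b = "gen_inverse M a"
  have b: "?b \<in> carrier M" "\<phi> ?b = ginv G ` \<phi> a" using gen_inverse_represented a by auto
  have "a \<otimes>\<^bsub>M\<^esub> ?b = \<one>\<^bsub>M\<^esub>" "?b \<otimes>\<^bsub>M\<^esub> a = \<one>\<^bsub>M\<^esub>"
    using a b rep_eqI mult_closed unit_closed rep_mult rep_one unfolding bisection_def by metis+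
  then show "a \<in> Units M" unfolding Units_def using a b by blast
qed

end

section \<open>Quotients by the kernel of a homomorphism\<close>

text \<open>The first isomorphism theorem, for structures with a product and a unit. The axioms of monoids
  and groups are transported to the quotient along the isomorphism afterwards; this is why
  closure of the quotient under products is among the conclusions.\<close>

lemma quotient_by_kernel:
  fixes M :: "('a, 'm) monoid_scheme" and N :: "('b, 'n) monoid_scheme"
  assumes r: "r = {(s, t). s \<in> carrier M \<and> t \<in> carrier M \<and> f s = f t}"
    and closed: "\<And>s t. \<lbrakk>s \<in> carrier M; t \<in> carrier M\<rbrakk> \<Longrightarrow> s \<otimes>\<^bsub>M\<^esub> t \<in> carrier M"
    and hom: "\<And>s t. \<lbrakk>s \<in> carrier M; t \<in> carrier M\<rbrakk> \<Longrightarrow> f (s \<otimes>\<^bsub>M\<^esub> t) = f s \<otimes>\<^bsub>N\<^esub> f t"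
    and onto: "f ` carrier M = carrier N"
    and one: "\<one>\<^bsub>M\<^esub> \<in> carrier M" "f \<one>\<^bsub>M\<^esub> = \<one>\<^bsub>N\<^esub>"
  obtains h where "h \<in> iso (quotient_monoid M r) N" "h \<one>\<^bsub>quotient_monoid M r\<^esub> = \<one>\<^bsub>N\<^esub>"
    and "\<one>\<^bsub>quotient_monoid M r\<^esub> \<in> carrier (quotient_monoid M r)"
    and "\<And>A B. \<lbrakk>A \<in> carrier (quotient_monoid M r); B \<in> carrier (quotient_monoid M r)\<rbrakk>
      \<Longrightarrow> A \<otimes>\<^bsub>quotient_monoid M r\<^esub> B \<in> carrier (quotient_monoid M r)"
proof -
  let ?Q = "quotient_monoid M r"
  define h where "h A = the_elem (f ` A)" for A
  have cls: "r `` {s} = {t \<in> carrier M. f t = f s}" if "s \<in> carrier M" for s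
    using that by (auto simp: r)
  have h: "h (r `` {s}) = f s" if "s \<in> carrier M" for s
  proof -
    have "f ` (r `` {s}) = {f s}" using cls[OF that] that by auto
    then show ?thesis by (simp add: h_def)
  qed
  have carr: "carrier ?Q = (\<lambda>s. r `` {s}) ` carrier M"
    by (auto simp: quotient_monoid_def quotient_def)
  have mult: "r `` {s} \<otimes>\<^bsub>?Q\<^esub> r `` {t} = r `` {s \<otimes>\<^bsub>M\<^esub> t}"
    if st: "s \<in> carrier M" "t \<in> carrier M" for s t
  proof -
    have "r `` {a \<otimes>\<^bsub>M\<^esub> b} = r `` {s \<otimes>\<^bsub>M\<^esub> t}" if "a \<in> r `` {s}" "b \<in> r `` {t}" for a b
    proof -
      have "a \<in> carrier M" "b \<in> carrier M" "f a = f s" "f b = f t"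
        using that cls st by auto
      then show ?thesis using cls[OF closed[of a b]] cls[OF closed[of s t]] hom st by simp
    qed
    moreover have "s \<in> r `` {s}" "t \<in> r `` {t}" using cls st by auto
    ultimately have "(\<Union>a\<in>r `` {s}. \<Union>b\<in>r `` {t}. r `` {a \<otimes>\<^bsub>M\<^esub> b}) = r `` {s \<otimes>\<^bsub>M\<^esub> t}"
      by blast
    then show ?thesis by (simp add: quotient_monoid_def)
  qed
  have "h \<in> iso ?Q N"
    unfolding iso_def
  proof (intro CollectI conjI)
    show "h \<in> hom ?Q N"
      by (rule homI) (use carr h mult closed hom onto in auto)
    show "bij_betw h (carrier ?Q) (carrier N)"
      unfolding bij_betw_def
    proof
      show "inj_on h (carrier ?Q)"
        unfolding carr using h cls by (auto intro!: inj_onI)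
      show "h ` carrier ?Q = carrier N"
        unfolding carr onto[symmetric] using h by (force simp: image_image)
    qed
  qed
  moreover have "\<one>\<^bsub>?Q\<^esub> = r `` {\<one>\<^bsub>M\<^esub>}" by (simp add: quotient_monoid_def)
  then have "\<one>\<^bsub>?Q\<^esub> \<in> carrier ?Q" "h \<one>\<^bsub>?Q\<^esub> = \<one>\<^bsub>N\<^esub>" using carr h one by auto
  moreover have "A \<otimes>\<^bsub>?Q\<^esub> B \<in> carrier ?Q" if "A \<in> carrier ?Q" "B \<in> carrier ?Q" for A B
    using that mult closed by (auto simp: carr)
  ultimately show ?thesis using that by blast
qed

section \<open>Factorisation in \<open>k\<close>-monoids\<close>

lemma nat_vec_le_add: "m \<le> m + (n :: nat ^ 'k)" "m \<le> n + (m :: nat ^ 'k)"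
  by (simp_all add: less_eq_vec_def)

lemma nat_vec_le_iff_add: "m \<le> n \<longleftrightarrow> (\<exists>q. n = m + (q :: nat ^ 'k))"
proof
  assume "m \<le> n"
  then have "n = m + (n - m)" by (simp add: vec_eq_iff less_eq_vec_def)
  then show "\<exists>q. n = m + q" ..
qed (auto simp: nat_vec_le_add)

lemma nat_vec_add_diff: "(m + n) - m = (n :: nat ^ 'k)"
  by (simp add: vec_eq_iff)

lemma nat_vec_zero_le: "0 \<le> (m :: nat ^ 'k)"
  by (simp add: less_eq_vec_def)

lemma nat_vec_add_le_iff: "m + p \<le> n + p \<longleftrightarrow> m \<le> (n :: nat ^ 'k)"
  by (simp add: less_eq_vec_def)

lemma vec_int_add: "vec_int (m + n) = vec_int m + vec_int n"
  by (simp add: vec_int_def vec_eq_iff)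

lemma vec_int_eq_iff: "vec_int m = vec_int n \<longleftrightarrow> m = n"
  by (simp add: vec_int_def vec_eq_iff)

lemma vec_int_diff_eq_iff:
  "vec_int a - vec_int b = vec_int c - vec_int e \<longleftrightarrow> a + e = c + b"
proof -
  have "vec_int a - vec_int b = vec_int c - vec_int e \<longleftrightarrow> vec_int a + vec_int e = vec_int c + vec_int b"
    by (auto simp: algebra_simps)
  then show ?thesis by (simp add: vec_int_add[symmetric] vec_int_eq_iff)
qed

context k_monoid
begin

text \<open>Unique factorisation gives cancellation on both sides: equal products with equal first degrees
  have equal second degrees, and so are two factorisations of one element of the same type.\<close>

lemma factor_eq:
  assumes "x \<in> carrier S" "y \<in> carrier S" "x' \<in> carrier S" "y' \<in> carrier S"
    and "x \<otimes> y = x' \<otimes> y'" "d x = d x'"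
  shows "x = x'" "y = y'"
proof -
  have "d x + d y = d x + d y'" using assms d_mult by metis
  then have dy: "d y = d y'" by simp
  let ?P = "\<lambda>p. case p of (x1, x2) \<Rightarrow> x1 \<in> carrier S \<and> x2 \<in> carrier S \<and> x \<otimes> y = x1 \<otimes> x2 \<and>
      d x1 = d x \<and> d x2 = d y"
  have ex1: "\<exists>!p. ?P p"
    using unique_factorization[OF m_closed[OF assms(1,2)] d_mult[OF assms(1,2)]] .
  have P: "?P (x, y)" "?P (x', y')" using assms dy by simp_all
  have "(x, y) = (x', y')"
    using the1_equality[of ?P, OF ex1 P(1)] the1_equality[of ?P, OF ex1 P(2)] by (rule trans[OF sym])
  then show "x = x'" "y = y'" by auto
qed

lemma left_cancel:
  assumes "x \<in> carrier S" "y \<in> carrier S" "z \<in> carrier S" "x \<otimes> y = x \<otimes> z"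
  shows "y = z"
  using factor_eq(2)[of x y x z] assms by blast

lemma right_cancel:
  assumes "x \<in> carrier S" "y \<in> carrier S" "z \<in> carrier S" "x \<otimes> z = y \<otimes> z"
  shows "x = y"
proof -
  have "d x + d z = d y + d z" using assms d_mult by metis
  then have "d x = d y" by simp
  then show ?thesis using factor_eq(1)[of x z y z] assms by blast
qed

lemma factor_at:
  assumes "x \<in> carrier S" "m \<le> d x"
  obtains y z where "y \<in> carrier S" "z \<in> carrier S" "x = y \<otimes> z" "d y = m"
proof -
  obtain n where "d x = m + n" using assms(2) nat_vec_le_iff_add by blast
  then show ?thesis using unique_factorization[OF assms(1), of m n] that by blast
qed

text \<open>If \<open>a\<close> and \<open>y\<close> have a common multiple and the degree of \<open>a\<close> is at least that of \<open>y\<close>, then \<open>y\<close> is a prefix of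
  \<open>a\<close>: cut \<open>a\<close> at the degree of \<open>y\<close> and compare the two first factors of the common multiple.\<close>

lemma prefix_of_common_multiple:
  assumes "a \<in> carrier S" "s \<in> carrier S" "y \<in> carrier S" "t \<in> carrier S"
    and "a \<otimes> s = y \<otimes> t" "d y \<le> d a"
  obtains u where "u \<in> carrier S" "a = y \<otimes> u"
proof -
  obtain y' u where yu: "y' \<in> carrier S" "u \<in> carrier S" "a = y' \<otimes> u" "d y' = d y"
    using factor_at[OF assms(1,6)] by blast
  then have "y' \<otimes> (u \<otimes> s) = y \<otimes> t" using assms m_assoc by simp
  then have "y' = y" using factor_eq(1)[of y' "u \<otimes> s" y t] yu assms by auto
  then show ?thesis using that yu by blast
qed

lemma degree_zero_iff:
  assumes "x \<in> carrier S"
  shows "d x = 0 \<longleftrightarrow> x = \<one>"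
  using factor_eq(1)[of x \<one> \<one> x] assms d_one by auto

section \<open>Tilings\<close>

abbreviation T :: "('a, 'k) tiling set" where "T \<equiv> tilings S d"

lemma tiling_closed: "w \<in> T \<Longrightarrow> m \<le> n \<Longrightarrow> w m n \<in> carrier S"
  by (simp add: tilings_def)

lemma tiling_degree: "w \<in> T \<Longrightarrow> d (w m (m + n)) = n"
  by (simp add: tilings_def nat_vec_le_add nat_vec_add_diff)

lemma tiling_degree0: "w \<in> T \<Longrightarrow> d (w 0 n) = n"
  using tiling_degree[of w 0 n] by simp

lemma tiling_closed_add: "w \<in> T \<Longrightarrow> w m (m + n) \<in> carrier S"
  by (simp add: tiling_closed nat_vec_le_add)

lemma tiling_closed0: "w \<in> T \<Longrightarrow> w 0 n \<in> carrier S"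
  by (simp add: tiling_closed nat_vec_zero_le)

lemma tiling_mult: "w \<in> T \<Longrightarrow> m \<le> n \<Longrightarrow> n \<le> p \<Longrightarrow> w m n \<otimes> w n p = w m p"
  by (simp add: tilings_def)

lemma tiling_mult_add: "w \<in> T \<Longrightarrow> w 0 m \<otimes> w m (m + n) = w 0 (m + n)"
  by (simp add: tiling_mult nat_vec_zero_le nat_vec_le_add)

lemma tiling_prefix_eq:
  assumes "w \<in> T" "v \<in> T" "w 0 (m + n) = v 0 (m + n)"
  shows "w 0 m = v 0 m" "w m (m + n) = v m (m + n)"
  using factor_eq[of "w 0 m" "w m (m + n)" "v 0 m" "v m (m + n)"] assms
    tiling_closed0 tiling_closed_add tiling_mult_add tiling_degree0 by metis+

text \<open>The prefixes determine a tiling, and it is enough to know those beyond a given degree \<open>p\<close>.\<close>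

lemma tiling_eqI:
  assumes "w \<in> T" "v \<in> T" and eq: "\<And>n. w 0 (p + n) = v 0 (p + n)"
  shows "w = v"
proof (intro ext)
  fix m n
  show "w m n = v m n"
  proof (cases "m \<le> n")
    case True
    then obtain q where q: "n = m + q" using nat_vec_le_iff_add by blast
    have "w 0 ((m + q) + p) = v 0 ((m + q) + p)" using eq[of "m + q"] by (simp add: add.commute)
    then have "w 0 (m + q) = v 0 (m + q)" by (rule tiling_prefix_eq(1)[OF assms(1,2)])
    then show ?thesis using tiling_prefix_eq(2) assms q by blast
  next
    case False
    then show ?thesis using assms by (simp add: tilings_def)
  qed
qed

text \<open>A tiling is the same thing as a coherent choice of prefixes \<open>f n\<close>, one of each degree
  \<open>n\<close>; the value at \<open>(m, n)\<close> is the quotient of \<open>f n\<close> by \<open>f m\<close>.\<close>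

lemma tiling_of_prefixes:
  assumes f: "\<And>n. f n \<in> carrier S" "\<And>n. d (f n) = n"
    and ext: "\<And>m n. m \<le> n \<Longrightarrow> \<exists>u\<in>carrier S. f n = f m \<otimes> u"
  obtains w where "w \<in> T" "\<And>n. w 0 n = f n"
proof -
  obtain u where u: "\<And>m n. m \<le> n \<Longrightarrow> u m n \<in> carrier S \<and> f n = f m \<otimes> u m n"
    using ext by metis
  define w where "w m n = (if m \<le> n then u m n else undefined)" for m n
  have w0: "w 0 n = f n" for n
  proof -
    have "f 0 = \<one>" using f degree_zero_iff by blast
    then show ?thesis using u[of 0 n] by (simp add: w_def nat_vec_zero_le)
  qed
  have "w \<in> T"
    unfolding tilings_def
  proof (intro CollectI conjI allI impI)
    show "w m n \<in> carrier S" if "m \<le> n" for m n using u that by (simp add: w_def)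
    show "d (w m n) = n - m" if "m \<le> n" for m n
    proof -
      have "n = m + d (u m n)" using u[OF that] f d_mult by metis
      then show ?thesis using that nat_vec_add_diff by (metis w_def)
    qed
    show "w m m = \<one>" for m
    proof -
      have "f m \<otimes> u m m = f m \<otimes> \<one>" using u[of m m] f by simp
      then show ?thesis using left_cancel[of "f m" "u m m" \<one>] u[of m m] f by (simp add: w_def)
    qed
    show "w m n \<otimes> w n p = w m p" if "m \<le> n \<and> n \<le> p" for m n p
    proof -
      have le: "m \<le> n" "n \<le> p" "m \<le> p" using that by auto
      note uu = u[OF le(1)] u[OF le(2)] u[OF le(3)]
      have "f m \<otimes> (u m n \<otimes> u n p) = f m \<otimes> u m p" using uu f m_assoc by metis
      then have "u m n \<otimes> u n p = u m p" using left_cancel uu f by (metis m_closed)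
      then show ?thesis using le by (simp add: w_def)
    qed
    show "w m n = undefined" if "\<not> m \<le> n" for m n using that by (simp add: w_def)
  qed
  then show ?thesis using that w0 by blast
qed

lemma shift_tiling:
  assumes "w \<in> T"
  shows "shift p w \<in> T"
proof -
  have "n + p - (m + p) = n - m" for m n :: "nat ^ 'k" by (simp add: vec_eq_iff)
  then show ?thesis using assms by (simp add: tilings_def shift_def nat_vec_add_le_iff)
qed

lemma shift_shift: "shift p (shift q w) = shift (p + q) w"
  by (simp add: shift_def add.assoc)

lemma shift_prefix: "shift p w 0 n = w p (p + n)"
  by (simp add: shift_def add.commute)

lemma tiling_prefix_shift: "w \<in> T \<Longrightarrow> w 0 p \<otimes> shift p w 0 n = w 0 (p + n)"
  using tiling_mult_add by (simp add: shift_prefix)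

lemma tiling_eq_if_shift_eq:
  assumes "v \<in> T" "w \<in> T" "v 0 p = w 0 p" "shift p v = shift p w"
  shows "v = w"
  by (rule tiling_eqI[OF assms(1,2), of p]) (use tiling_prefix_shift assms in metis)

text \<open>The prefix of degree \<open>n\<close> of the tiling \<open>aw\<close> is cut from \<open>a w(0, n)\<close>, whose degree \<open>d a + n\<close>
  is large enough.\<close>

lemma prefix_tiling_exists:
  assumes "a \<in> carrier S" "w \<in> T"
  obtains v where "v \<in> T" "v 0 (d a) = a" "shift (d a) v = w"
proof -
  have aw: "a \<otimes> w 0 n \<in> carrier S" "d (a \<otimes> w 0 n) = d a + n" for n
    using assms tiling_closed0 tiling_degree0 d_mult by auto
  have "\<exists>y z. y \<in> carrier S \<and> z \<in> carrier S \<and> a \<otimes> w 0 n = y \<otimes> z \<and> d y = n" for n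
    using factor_at[OF aw(1), of n n] aw(2)[of n] nat_vec_le_add by metis
  then obtain f g where fg: "\<And>n. f n \<in> carrier S" "\<And>n. g n \<in> carrier S"
    "\<And>n. a \<otimes> w 0 n = f n \<otimes> g n" "\<And>n. d (f n) = n"
    by metis
  have "\<exists>u\<in>carrier S. f n = f m \<otimes> u" if le: "m \<le> n" for m n
  proof -
    have c: "w m n \<in> carrier S" using tiling_closed assms le by blast
    have "a \<otimes> w 0 n = (a \<otimes> w 0 m) \<otimes> w m n"
      using tiling_mult[OF assms(2) nat_vec_zero_le le] assms tiling_closed0 c m_assoc by metis
    then have "f n \<otimes> g n = f m \<otimes> (g m \<otimes> w m n)" using fg c m_assoc by simp
    then obtain u where "u \<in> carrier S" "f n = f m \<otimes> u"
      using prefix_of_common_multiple[of "f n" "g n" "f m" "g m \<otimes> w m n"] fg c le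
      by (metis m_closed)
    then show ?thesis by blast
  qed
  then obtain v where v: "v \<in> T" "\<And>n. v 0 n = f n"
    using tiling_of_prefixes[of f] fg by metis
  have "f (d a) \<otimes> g (d a) = a \<otimes> w 0 (d a)" using fg by simp
  then have va: "v 0 (d a) = a"
    using factor_eq(1)[of "f (d a)" "g (d a)" a "w 0 (d a)"] fg assms tiling_closed0 v by auto
  have "shift (d a) v 0 n = w 0 n" for n
  proof -
    have "(a \<otimes> w 0 n) \<otimes> w n (n + d a) = a \<otimes> w 0 (n + d a)"
      using tiling_mult_add[OF assms(2), of n "d a"] assms
        tiling_closed0 tiling_closed_add m_assoc by simp
    also have "\<dots> = f (d a + n) \<otimes> g (d a + n)" using fg by (simp add: add.commute)
    finally have "a \<otimes> w 0 n = f (d a + n)"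
      using factor_eq(1)[of "a \<otimes> w 0 n" "w n (n + d a)" "f (d a + n)" "g (d a + n)"]
        fg aw tiling_closed_add assms by simp
    then have "a \<otimes> w 0 n = a \<otimes> shift (d a) v 0 n" using v va tiling_prefix_shift by metis
    then show ?thesis
      using left_cancel[of a "shift (d a) v 0 n" "w 0 n"] assms v shift_tiling tiling_closed0 by metis
  qed
  then have "shift (d a) v = w"
    using tiling_eqI[of "shift (d a) v" w 0] v assms shift_tiling by simp
  then show ?thesis using that v va by blast
qed

lemma prefix_tiling_iff:
  assumes "a \<in> carrier S" "w \<in> T"
  shows "v = prefix_tiling S d a w \<longleftrightarrow> v \<in> T \<and> v 0 (d a) = a \<and> shift (d a) v = w"
proof -
  obtain v' where v': "v' \<in> T" "v' 0 (d a) = a" "shift (d a) v' = w"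
    using prefix_tiling_exists assms by blast
  have uniq: "v'' = v'" if "v'' \<in> T \<and> v'' 0 (d a) = a \<and> shift (d a) v'' = w" for v''
    by (rule tiling_eq_if_shift_eq[of _ _ "d a"]) (use that v' in simp_all)
  have "prefix_tiling S d a w = v'"
    unfolding prefix_tiling_def
  proof (rule the_equality)
    show "v' \<in> T \<and> v' 0 (d a) = a \<and> shift (d a) v' = w" using v' by simp
  qed (rule uniq)
  then show ?thesis using v' uniq by metis
qed

lemma prefix_tiling:
  assumes "a \<in> carrier S" "w \<in> T"
  shows "prefix_tiling S d a w \<in> T" "prefix_tiling S d a w 0 (d a) = a"
    "shift (d a) (prefix_tiling S d a w) = w"
  using prefix_tiling_iff[OF assms, of "prefix_tiling S d a w"] by auto

lemma prefix_tiling_shift: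
  assumes "w \<in> T"
  shows "prefix_tiling S d (w 0 p) (shift p w) = w"
  using prefix_tiling_iff[of "w 0 p" "shift p w" w] assms shift_tiling tiling_closed0 tiling_degree0
  by auto

definition cyl :: "'a \<Rightarrow> ('a, 'k) tiling set" where
  "cyl a = {w \<in> T. w 0 (d a) = a}"

lemma prefix_tiling_image:
  assumes "a \<in> carrier S"
  shows "prefix_tiling S d a ` T = cyl a"
proof (intro equalityI subsetI)
  fix v assume "v \<in> prefix_tiling S d a ` T"
  then show "v \<in> cyl a" using prefix_tiling assms by (auto simp: cyl_def)
next
  fix v assume "v \<in> cyl a"
  then have v: "v \<in> T" "v 0 (d a) = a" by (auto simp: cyl_def)
  have "v = prefix_tiling S d a (shift (d a) v)" using prefix_tiling_shift[OF v(1), of "d a"] v by simp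
  then show "v \<in> prefix_tiling S d a ` T" using shift_tiling v by blast
qed

end

section \<open>The groupoid of tilings\<close>

text \<open>A topology generated by a subbasis consists of unions of members of the subbasis if
  intersections of two members are such unions.\<close>

lemma openin_topology_generated_by_basis:
  assumes "\<And>U V g. \<lbrakk>U \<in> \<B>; V \<in> \<B>; g \<in> U; g \<in> V\<rbrakk> \<Longrightarrow> \<exists>W\<in>\<B>. g \<in> W \<and> W \<subseteq> U \<and> W \<subseteq> V"
    and "openin (topology_generated_by \<B>) U" "g \<in> U"
  shows "\<exists>W\<in>\<B>. g \<in> W \<and> W \<subseteq> U"
proof -
  have "generate_topology_on \<B> U" using assms(2) by (simp add: openin_topology_generated_by_iff)
  then show ?thesis using assms(3)
  proof (induction arbitrary: g)
    case (Int a b)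
    then have "\<exists>A\<in>\<B>. g \<in> A \<and> A \<subseteq> a" "\<exists>B\<in>\<B>. g \<in> B \<and> B \<subseteq> b" by simp_all
    then obtain A B where AB: "A \<in> \<B>" "g \<in> A" "A \<subseteq> a" "B \<in> \<B>" "g \<in> B" "B \<subseteq> b"
      by (elim bexE conjE) (rule that)
    then obtain W where "W \<in> \<B>" "g \<in> W" "W \<subseteq> A" "W \<subseteq> B"
      using assms(1)[OF AB(1,4,2,5)] by blast
    then show ?case using AB by (meson le_inf_iff order_trans)
  next
    case (UN K)
    then obtain k where k: "k \<in> K" "g \<in> k" by blast
    obtain W where "W \<in> \<B>" "g \<in> W" "W \<subseteq> k" using UN.IH[OF k] by blast
    then show ?case using k by (meson Union_upper order_trans)
  next
    case (Basis s)
    then show ?case by blast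
  qed blast
qed

text \<open>An arrow \<open>(v, n, w)\<close> has level \<open>(l, m)\<close> if \<open>v\<close> and \<open>w\<close> coincide once their prefixes of degrees
  \<open>l\<close> and \<open>m\<close> are removed and \<open>n = l - m\<close>. The levels of an arrow are closed under adding a common
  vector to both entries, which is what allows two arrows to be compared at a common level.\<close>

definition has_level ::
  "('a, 'k::finite) tiling_arrow \<Rightarrow> nat ^ 'k \<Rightarrow> nat ^ 'k \<Rightarrow> bool" where
  "has_level g l m \<longleftrightarrow>
    (case g of (v, n, w) \<Rightarrow> shift l v = shift m w \<and> n = vec_int l - vec_int m)"

lemma has_level_simp:
  "has_level (v, n, w) l m \<longleftrightarrow> shift l v = shift m w \<and> n = vec_int l - vec_int m"
  by (simp add: has_level_def)

context k_monoid
begin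

abbreviation TG :: "('a, 'k) tiling_arrow top_groupoid" where
  "TG \<equiv> tiling_groupoid S d"

abbreviation Z :: "'a \<Rightarrow> 'a \<Rightarrow> ('a, 'k) tiling_arrow set" where
  "Z \<equiv> Z_set S d"

lemma has_level_add:
  assumes "has_level (v, n, w) l m"
  shows "has_level (v, n, w) (l + q) (m + q)"
proof -
  have "shift q (shift l v) = shift q (shift m w)" using assms by (simp add: has_level_simp)
  then show ?thesis using assms by (simp add: has_level_simp shift_shift vec_int_add add.commute)
qed

lemma TG_carrier: "(v, n, w) \<in> carrier TG \<longleftrightarrow> v \<in> T \<and> w \<in> T \<and> (\<exists>l m. has_level (v, n, w) l m)"
  by (simp add: tiling_groupoid_def has_level_simp)

lemma TG_gmult: "gmult TG (v, n, w) (v', n', w') = (if w = v' then Some (v, n + n', w') else None)"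
  by (simp add: tiling_groupoid_def)

lemma TG_ginv: "ginv TG (v, n, w) = (w, - n, v)"
  by (simp add: tiling_groupoid_def)

lemma TG_gsrc: "gsrc TG (v, n, w) = (w, 0, w)"
  by (simp add: gsrc_def TG_ginv TG_gmult)

lemma TG_gtgt: "gtgt TG (v, n, w) = (v, 0, v)"
  by (simp add: gtgt_def TG_ginv TG_gmult)

lemma has_level_identity: "has_level (w, 0, w) m m"
  by (simp add: has_level_simp)

lemma TG_identities: "identities TG = (\<lambda>w. (w, 0, w)) ` T"
proof -
  have "(w, 0, w) \<in> carrier TG" if "w \<in> T" for w
    using that has_level_identity TG_carrier by blast
  then have "(w, 0, w) \<in> identities TG" if "w \<in> T" for w
    using that TG_gsrc[of w 0 w] unfolding identities_def by (metis imageI)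
  moreover have "gsrc TG g \<in> (\<lambda>w. (w, 0, w)) ` T" if "g \<in> carrier TG" for g
    using that by (cases g) (simp add: TG_carrier TG_gsrc)
  ultimately show ?thesis unfolding identities_def by blast
qed

text \<open>A description of \<open>Z(x, y)\<close> by prefixes and levels, without the operation that prefixes a tiling.\<close>

lemma Z_iff:
  assumes "x \<in> carrier S" "y \<in> carrier S"
  shows "(v, n, w) \<in> Z x y \<longleftrightarrow>
    v \<in> T \<and> w \<in> T \<and> v 0 (d x) = x \<and> w 0 (d y) = y \<and> has_level (v, n, w) (d x) (d y)"
proof
  assume "(v, n, w) \<in> Z x y"
  then show "v \<in> T \<and> w \<in> T \<and> v 0 (d x) = x \<and> w 0 (d y) = y \<and> has_level (v, n, w) (d x) (d y)"
    using prefix_tiling assms by (auto simp: Z_set_def has_level_simp)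
next
  assume *: "v \<in> T \<and> w \<in> T \<and> v 0 (d x) = x \<and> w 0 (d y) = y \<and> has_level (v, n, w) (d x) (d y)"
  let ?t = "shift (d x) v"
  have "v = prefix_tiling S d x ?t" "w = prefix_tiling S d y ?t"
    using prefix_tiling_shift[of v "d x"] prefix_tiling_shift[of w "d y"] *
    by (auto simp: has_level_simp)
  moreover have "?t \<in> T" using * shift_tiling by blast
  ultimately show "(v, n, w) \<in> Z x y"
    using * unfolding Z_set_def has_level_simp by blast
qed

lemma Z_at_level:
  assumes "v \<in> T" "w \<in> T" "has_level (v, n, w) l m"
  shows "(v, n, w) \<in> Z (v 0 l) (w 0 m)"
  using assms by (simp add: Z_iff tiling_closed0 tiling_degree0)

lemma Z_level_mono:
  assumes "v \<in> T" "w \<in> T" "has_level (v, n, w) l m"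
  shows "Z (v 0 (l + q)) (w 0 (m + q)) \<subseteq> Z (v 0 l) (w 0 m)"
proof
  fix g assume g: "g \<in> Z (v 0 (l + q)) (w 0 (m + q))"
  obtain v' n' w' where g': "g = (v', n', w')" by (cases g)
  have *: "v' \<in> T" "w' \<in> T" "v' 0 (l + q) = v 0 (l + q)" "w' 0 (m + q) = w 0 (m + q)"
    "has_level (v', n', w') (l + q) (m + q)"
    using g assms by (auto simp: g' Z_iff tiling_closed0 tiling_degree0)
  have "shift l v' 0 q = shift l v 0 q" "shift m w' 0 q = shift m w 0 q"
    using tiling_prefix_eq(2) * assms by (auto simp: shift_prefix)
  then have "shift l v' 0 q = shift m w' 0 q" using assms by (simp add: has_level_simp)
  moreover have "shift q (shift l v') = shift q (shift m w')"
    using * by (simp add: has_level_simp shift_shift add.commute)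
  ultimately have "shift l v' = shift m w'"
    using tiling_eq_if_shift_eq shift_tiling * by blast
  then have "has_level (v', n', w') l m"
    using * by (simp add: has_level_simp vec_int_add)
  moreover have "v' 0 l = v 0 l" "w' 0 m = w 0 m"
    using tiling_prefix_eq(1) * assms by blast+
  ultimately show "g \<in> Z (v 0 l) (w 0 m)"
    using * assms by (simp add: g' Z_iff tiling_closed0 tiling_degree0)
qed

text \<open>Two levels of an arrow have a common refinement: if \<open>d x - d y = l - m\<close>, then
  \<open>(l + d x, m + d x) = (d x + l, d y + l)\<close>.\<close>

lemma Z_shrink:
  assumes "x \<in> carrier S" "y \<in> carrier S" "(v, n, w) \<in> Z x y" "has_level (v, n, w) l m"
  shows "Z (v 0 (l + d x)) (w 0 (m + d x)) \<subseteq> Z x y"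
proof -
  have *: "v \<in> T" "w \<in> T" "v 0 (d x) = x" "w 0 (d y) = y" "has_level (v, n, w) (d x) (d y)"
    using assms Z_iff by auto
  have "d x + m = l + d y"
    using *(5) assms(4) by (simp add: has_level_simp vec_int_diff_eq_iff)
  then have "l + d x = d x + l" "m + d x = d y + l" by (simp_all add: add.commute)
  then show ?thesis using Z_level_mono[OF *(1,2,5), of l] * by simp
qed

section \<open>The topology of the groupoid of tilings\<close>

definition basic_sets :: "('a, 'k) tiling_arrow set set" where
  "basic_sets = {Z x y |x y. x \<in> carrier S \<and> y \<in> carrier S}"

lemma TG_gtop: "gtop TG = topology_generated_by basic_sets"
  by (simp add: tiling_groupoid_def basic_sets_def)

lemma openin_Z: "x \<in> carrier S \<Longrightarrow> y \<in> carrier S \<Longrightarrow> openin (gtop TG) (Z x y)"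
  unfolding TG_gtop by (rule topology_generated_by_Basis) (auto simp: basic_sets_def)

lemma openin_TG_Z:
  assumes "openin (gtop TG) U" "g \<in> U"
  obtains x y where "x \<in> carrier S" "y \<in> carrier S" "g \<in> Z x y" "Z x y \<subseteq> U"
proof -
  have "\<exists>W\<in>basic_sets. g \<in> W \<and> W \<subseteq> U"
  proof (rule openin_topology_generated_by_basis)
    fix U V g assume UV: "U \<in> basic_sets" "V \<in> basic_sets" "g \<in> U" "g \<in> V"
    obtain v n w where g: "g = (v, n, w)" by (cases g)
    obtain x y x' y' where xy: "U = Z x y" "V = Z x' y'" "x \<in> carrier S" "y \<in> carrier S"
      "x' \<in> carrier S" "y' \<in> carrier S"
      using UV by (auto simp: basic_sets_def)
    have *: "v \<in> T" "w \<in> T" "v 0 (d x) = x" "w 0 (d y) = y" "has_level (v, n, w) (d x) (d y)"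
      "has_level (v, n, w) (d x') (d y')"
      using UV xy Z_iff g by auto
    let ?W = "Z (v 0 (d x + d x')) (w 0 (d y + d x'))"
    have "?W \<subseteq> V" using Z_shrink[of x' y' v n w "d x" "d y"] xy UV g * by simp
    moreover have "?W \<subseteq> U" using Z_level_mono[OF *(1,2,5), of "d x'"] * xy by simp
    moreover have "g \<in> ?W" unfolding g by (rule Z_at_level) (use * has_level_add in auto)
    moreover have "?W \<in> basic_sets" using * tiling_closed0 by (auto simp: basic_sets_def)
    ultimately show "\<exists>W\<in>basic_sets. g \<in> W \<and> W \<subseteq> U \<and> W \<subseteq> V" by blast
  qed (use assms TG_gtop in auto)
  then show ?thesis using that by (auto simp: basic_sets_def)
qed

text \<open>A neighbourhood base at an arrow can be read off from any one of its levels. For the continuity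
  of the operations this lets the neighbourhoods of all arrows involved be chosen at matching
  levels.\<close>

lemma openin_TG_level:
  assumes "openin (gtop TG) U" "(v, n, w) \<in> U" "has_level (v, n, w) l m"
  obtains q where "Z (v 0 (l + q)) (w 0 (m + q)) \<subseteq> U"
proof -
  obtain x y where xy: "x \<in> carrier S" "y \<in> carrier S" "(v, n, w) \<in> Z x y" "Z x y \<subseteq> U"
    using openin_TG_Z[OF assms(1,2)] .
  then show ?thesis using that[of "d x"] Z_shrink[of x y v n w l m] assms by blast
qed

lemma Z_subset_carrier:
  assumes "x \<in> carrier S" "y \<in> carrier S"
  shows "Z x y \<subseteq> carrier TG"
proof
  fix g assume "g \<in> Z x y"
  then show "g \<in> carrier TG" using assms by (cases g) (auto simp: Z_iff TG_carrier)
qed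

lemma carrier_level_E:
  assumes "g \<in> carrier TG"
  obtains v n w l m where "g = (v, n, w)" "v \<in> T" "w \<in> T" "has_level (v, n, w) l m"
  using assms TG_carrier by (cases g) auto

lemma TG_topspace: "topspace (gtop TG) = carrier TG"
proof
  show "topspace (gtop TG) \<subseteq> carrier TG"
    using Z_subset_carrier by (auto simp: TG_gtop basic_sets_def)
  show "carrier TG \<subseteq> topspace (gtop TG)"
  proof
    fix g assume "g \<in> carrier TG"
    then obtain v n w l m where "g = (v, n, w)" "v \<in> T" "w \<in> T" "has_level (v, n, w) l m"
      by (rule carrier_level_E)
    then have "g \<in> Z (v 0 l) (w 0 m)" "v 0 l \<in> carrier S" "w 0 m \<in> carrier S"
      using Z_at_level tiling_closed0 by simp_all
    then have "g \<in> \<Union>basic_sets" unfolding basic_sets_def by blast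
    then show "g \<in> topspace (gtop TG)" by (auto simp: TG_gtop)
  qed
qed

lemma has_level_mult:
  assumes "has_level (v3, n', v2) l m" "has_level (v2, n, v1) l' m'"
  shows "has_level (v3, n', v2) (l + l') (m + l')" "has_level (v2, n, v1) (m + l') (m' + m)"
    "has_level (v3, n' + n, v1) (l + l') (m' + m)"
proof -
  show 1: "has_level (v3, n', v2) (l + l') (m + l')" using has_level_add assms by blast
  show 2: "has_level (v2, n, v1) (m + l') (m' + m)"
    using has_level_add[OF assms(2), of m] by (simp add: add.commute)
  show "has_level (v3, n' + n, v1) (l + l') (m' + m)"
    using 1 2 by (simp add: has_level_simp)
qed

lemma has_level_ginv: "has_level (v, n, w) l m \<Longrightarrow> has_level (w, - n, v) m l"
  by (simp add: has_level_simp)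

lemma groupoid_TG: "groupoid TG"
proof
  show "ginv TG g \<in> carrier TG" if g: "g \<in> carrier TG" for g
  proof -
    obtain v n w l m where "g = (v, n, w)" "v \<in> T" "w \<in> T" "has_level (v, n, w) l m"
      using g by (rule carrier_level_E)
    then show ?thesis using has_level_ginv[of v n w l m] unfolding \<open>g = (v, n, w)\<close> TG_ginv TG_carrier
      by blast
  qed
  show "x \<in> carrier TG" if gh: "g \<in> carrier TG" "h \<in> carrier TG" "gmult TG g h = Some x" for g h x
  proof -
    obtain v3 n' v2 l m where g: "g = (v3, n', v2)" "v3 \<in> T" "v2 \<in> T" "has_level (v3, n', v2) l m"
      using gh(1) by (rule carrier_level_E)
    obtain v2' n v1 l' m' where
      h: "h = (v2', n, v1)" "v2' \<in> T" "v1 \<in> T" "has_level (v2', n, v1) l' m'"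
      using gh(2) by (rule carrier_level_E)
    have "v2' = v2" "x = (v3, n' + n, v1)" using gh(3) g h by (auto simp: TG_gmult split: if_splits)
    then show ?thesis using g h has_level_mult(3)[of v3 n' v2 l m n v1 l' m']
      unfolding \<open>x = (v3, n' + n, v1)\<close> TG_carrier by blast
  qed
  show "\<exists>z. gmult TG x k = Some z \<and> gmult TG g y = Some z"
    if "gmult TG g h = Some x" "gmult TG h k = Some y" for g h k x y
    using that by (cases g; cases h; cases k) (auto simp: TG_gmult add.assoc split: if_splits)
  show "ginv TG (ginv TG g) = g" for g by (cases g) (simp add: TG_ginv)
  show "gmult TG (ginv TG g) g \<noteq> None" for g by (cases g) (simp add: TG_ginv TG_gmult)
  show "gmult TG (ginv TG g) x = Some h \<and> gmult TG x (ginv TG h) = Some g"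
    if "gmult TG g h = Some x" for g h x
    using that by (cases g; cases h) (auto simp: TG_gmult TG_ginv split: if_splits)
qed

sublocale TG: groupoid "tiling_groupoid S d" by (rule groupoid_TG)

lemma Z_mult:
  assumes "x \<in> carrier S" "y \<in> carrier S" "z \<in> carrier S"
    and "g \<in> Z x y" "h \<in> Z y z" "gmult TG g h = Some k"
  shows "k \<in> Z x z"
proof -
  obtain v n w v' n' w' where gh: "g = (v, n, w)" "h = (v', n', w')" by (cases g; cases h)
  have "w = v'" "k = (v, n + n', w')" using assms(6) gh by (auto simp: TG_gmult split: if_splits)
  then show ?thesis using assms gh by (auto simp: Z_iff has_level_simp)
qed

lemma Z_ginv:
  assumes "x \<in> carrier S" "y \<in> carrier S" "g \<in> Z x y"
  shows "ginv TG g \<in> Z y x"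
  using assms by (cases g) (auto simp: Z_iff TG_ginv has_level_simp)

text \<open>Since a prefix and a shift determine a tiling, \<open>Z(y, y)\<close> consists of identities; these sets are
  the images of the basic open sets of the space of tilings.\<close>

lemma Z_diagonal:
  assumes "y \<in> carrier S"
  shows "Z y y = (\<lambda>w. (w, 0, w)) ` cyl y"
proof (intro equalityI subsetI)
  fix g assume g: "g \<in> Z y y"
  obtain v n w where g': "g = (v, n, w)" by (cases g)
  have "v \<in> T" "w \<in> T" "v 0 (d y) = y" "w 0 (d y) = y" "shift (d y) v = shift (d y) w" "n = 0"
    using g assms by (auto simp: g' Z_iff has_level_simp)
  then show "g \<in> (\<lambda>w. (w, 0 :: int ^ 'k, w)) ` cyl y"
    using tiling_eq_if_shift_eq[of v w "d y"] by (auto simp: g' cyl_def)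
next
  fix g assume "g \<in> (\<lambda>w. (w, 0 :: int ^ 'k, w)) ` cyl y"
  then show "g \<in> Z y y" using assms by (auto simp: Z_iff has_level_simp cyl_def)
qed

lemma Z_diagonal_identities: "y \<in> carrier S \<Longrightarrow> Z y y \<subseteq> identities TG"
  by (auto simp: Z_diagonal TG_identities cyl_def)

lemma Z_one: "Z \<one> \<one> = identities TG"
proof -
  have "w 0 0 = \<one>" if "w \<in> T" for w using that by (simp add: tilings_def)
  then show ?thesis by (auto simp: Z_diagonal TG_identities cyl_def d_one)
qed

lemma openin_identities: "openin (gtop TG) (identities TG)"
  using openin_Z[of \<one> \<one>] by (simp add: Z_one)

lemma gsrc_Z:
  assumes "x \<in> carrier S" "y \<in> carrier S"
  shows "gsrc TG ` Z x y = Z y y"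
proof (intro equalityI subsetI)
  fix g assume "g \<in> gsrc TG ` Z x y"
  then obtain v n w where "(v, n, w) \<in> Z x y" "g = (w, 0, w)"
    by (auto simp: TG_gsrc)
  then show "g \<in> Z y y" using assms by (simp add: Z_diagonal Z_iff cyl_def)
next
  fix g assume "g \<in> Z y y"
  then obtain w where w: "w \<in> T" "w 0 (d y) = y" "g = (w, 0, w)"
    using assms by (auto simp: Z_diagonal cyl_def)
  let ?n = "vec_int (d x) - vec_int (d y)"
  let ?v = "prefix_tiling S d x (shift (d y) w)"
  have "(?v, ?n, w) \<in> Z x y"
    using prefix_tiling[of x "shift (d y) w"] w assms shift_tiling
    by (simp add: Z_iff has_level_simp)
  then show "g \<in> gsrc TG ` Z x y" using w TG_gsrc by (metis imageI)
qed

lemma Z_gsrc_inj: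
  assumes "x \<in> carrier S" "y \<in> carrier S" "g \<in> Z x y" "h \<in> Z x y" "gsrc TG g = gsrc TG h"
  shows "g = h"
proof -
  obtain v n w v' n' w' where gh: "g = (v, n, w)" "h = (v', n', w')" by (cases g; cases h)
  have *: "v \<in> T" "v' \<in> T" "v 0 (d x) = x" "v' 0 (d x) = x" "shift (d x) v = shift (d y) w"
    "shift (d x) v' = shift (d y) w'" "n = n'" "w = w'"
    using assms gh by (auto simp: Z_iff has_level_simp TG_gsrc)
  have "v = v'" by (rule tiling_eq_if_shift_eq[of _ _ "d x"]) (use * in simp_all)
  then show ?thesis using gh * by simp
qed

lemma continuous_gsrc: "continuous_map (gtop TG) (gtop TG) (gsrc TG)"
  unfolding continuous_map_def
proof (intro conjI allI impI)
  show "gsrc TG \<in> topspace (gtop TG) \<rightarrow> topspace (gtop TG)"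
    using TG.gsrc_closed by (simp add: TG_topspace)
  fix U assume U: "openin (gtop TG) U"
  show "openin (gtop TG) {g \<in> topspace (gtop TG). gsrc TG g \<in> U}"
  proof (subst openin_subopen, intro ballI)
    fix g assume g: "g \<in> {g \<in> topspace (gtop TG). gsrc TG g \<in> U}"
    then have "g \<in> carrier TG" by (simp add: TG_topspace)
    then obtain v n w l m where g': "g = (v, n, w)" "v \<in> T" "w \<in> T" "has_level (v, n, w) l m"
      by (rule carrier_level_E)
    have "(w, 0, w) \<in> U" using g g' by (simp add: TG_gsrc)
    then obtain q where q: "Z (w 0 (m + q)) (w 0 (m + q)) \<subseteq> U"
      using openin_TG_level[OF U _ has_level_identity] by blast
    let ?Z = "Z (v 0 (l + q)) (w 0 (m + q))"
    have c: "v 0 (l + q) \<in> carrier S" "w 0 (m + q) \<in> carrier S" using g' tiling_closed0 by auto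
    have "g \<in> ?Z" using g' Z_at_level has_level_add by metis
    moreover have "?Z \<subseteq> {g \<in> topspace (gtop TG). gsrc TG g \<in> U}"
      using Z_subset_carrier[OF c] gsrc_Z[OF c] q TG_topspace by blast
    ultimately show "\<exists>V. openin (gtop TG) V \<and> g \<in> V \<and> V \<subseteq> {g \<in> topspace (gtop TG). gsrc TG g \<in> U}"
      using openin_Z[OF c] by blast
  qed
qed

lemma open_gsrc:
  assumes "openin (gtop TG) U"
  shows "openin (gtop TG) (gsrc TG ` U)"
proof (subst openin_subopen, intro ballI)
  fix e assume "e \<in> gsrc TG ` U"
  then obtain g where g: "g \<in> U" "e = gsrc TG g" by blast
  obtain x y where xy: "x \<in> carrier S" "y \<in> carrier S" "g \<in> Z x y" "Z x y \<subseteq> U"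
    using openin_TG_Z[OF assms g(1)] .
  then have "e \<in> Z y y" "Z y y \<subseteq> gsrc TG ` U" using g gsrc_Z[of x y] by blast+
  then show "\<exists>V. openin (gtop TG) V \<and> e \<in> V \<and> V \<subseteq> gsrc TG ` U" using openin_Z xy by blast
qed

lemma continuous_ginv_TG: "continuous_map (gtop TG) (gtop TG) (ginv TG)"
  unfolding continuous_map_def
proof (intro conjI allI impI)
  show "ginv TG \<in> topspace (gtop TG) \<rightarrow> topspace (gtop TG)"
    using TG.ginv_closed by (simp add: TG_topspace)
  fix U assume U: "openin (gtop TG) U"
  show "openin (gtop TG) {g \<in> topspace (gtop TG). ginv TG g \<in> U}"
  proof (subst openin_subopen, intro ballI)
    fix g assume "g \<in> {g \<in> topspace (gtop TG). ginv TG g \<in> U}"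
    then have g: "g \<in> carrier TG" "ginv TG g \<in> U" by (simp_all add: TG_topspace)
    obtain x y where xy: "x \<in> carrier S" "y \<in> carrier S" "ginv TG g \<in> Z x y" "Z x y \<subseteq> U"
      using openin_TG_Z[OF U g(2)] .
    have "g \<in> Z y x" using Z_ginv[OF xy(1-3)] TG.ginv_ginv g by simp
    moreover have "Z y x \<subseteq> {g \<in> topspace (gtop TG). ginv TG g \<in> U}"
      using Z_ginv[OF xy(2,1)] Z_subset_carrier[OF xy(2,1)] xy(4) TG_topspace by blast
    ultimately show "\<exists>V. openin (gtop TG) V \<and> g \<in> V \<and> V \<subseteq> {g \<in> topspace (gtop TG). ginv TG g \<in> U}"
      using openin_Z[OF xy(2,1)] by blast
  qed
qed

lemma continuous_gmult_TG:
  "continuous_map (subtopology (prod_topology (gtop TG) (gtop TG)) (composable_pairs TG)) (gtop TG)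
     (\<lambda>(g, h). the (gmult TG g h))"
  (is "continuous_map ?X _ ?f")
  unfolding continuous_map_def
proof (intro conjI allI impI)
  have top: "topspace ?X = composable_pairs TG"
    by (auto simp: TG_topspace composable_pairs_def)
  show "?f \<in> topspace ?X \<rightarrow> topspace (gtop TG)"
    unfolding top TG_topspace
  proof (rule Pi_I)
    fix p assume p: "p \<in> composable_pairs TG"
    obtain g h where gh: "p = (g, h)" by (cases p)
    obtain k where "gmult TG g h = Some k" using p gh by (auto simp: composable_pairs_def)
    then show "?f p \<in> carrier TG"
      using TG.gmult_closed[of g h k] p gh by (simp add: composable_pairs_def)
  qed
  fix U assume U: "openin (gtop TG) U"
  show "openin ?X {p \<in> topspace ?X. ?f p \<in> U}"
  proof (subst openin_subopen, intro ballI)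
    fix p assume "p \<in> {p \<in> topspace ?X. ?f p \<in> U}"
    then obtain g h where p: "p = (g, h)" "(g, h) \<in> composable_pairs TG" "the (gmult TG g h) \<in> U"
      unfolding top by (cases p) auto
    then have gh: "g \<in> carrier TG" "h \<in> carrier TG" "gmult TG g h \<noteq> None"
      by (auto simp: composable_pairs_def)
    obtain v3 n' v2 l m where g: "g = (v3, n', v2)" "v3 \<in> T" "v2 \<in> T" "has_level (v3, n', v2) l m"
      using gh(1) by (rule carrier_level_E)
    obtain v2' n v1 l' m' where
      h: "h = (v2', n, v1)" "v2' \<in> T" "v1 \<in> T" "has_level (v2', n, v1) l' m'"
      using gh(2) by (rule carrier_level_E)
    have eq: "v2' = v2" using gh(3) g h by (auto simp: TG_gmult split: if_splits)
    then have "(v3, n' + n, v1) \<in> U" using p g h by (simp add: TG_gmult)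
    note lv = has_level_mult[OF g(4) h(4)[unfolded eq]]
    obtain q where q: "Z (v3 0 (l + l' + q)) (v1 0 (m' + m + q)) \<subseteq> U"
      using openin_TG_level[OF U \<open>(v3, n' + n, v1) \<in> U\<close> lv(3)] .
    let ?a = "v3 0 (l + l' + q)" and ?b = "v2 0 (m + l' + q)" and ?c = "v1 0 (m' + m + q)"
    have c: "?a \<in> carrier S" "?b \<in> carrier S" "?c \<in> carrier S" using g h tiling_closed0 by auto
    let ?V = "(Z ?a ?b \<times> Z ?b ?c) \<inter> composable_pairs TG"
    have "g \<in> Z ?a ?b" "h \<in> Z ?b ?c"
      using g h eq Z_at_level has_level_add[OF lv(1)] has_level_add[OF lv(2)] by auto
    then have "p \<in> ?V" using p by blast
    moreover have "openin ?X ?V"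
      using c by (intro openin_subtopology_Int) (simp add: openin_prod_Times_iff openin_Z)
    moreover have "?V \<subseteq> {p \<in> topspace ?X. ?f p \<in> U}"
    proof
      fix p' assume p': "p' \<in> ?V"
      obtain g' h' where gh': "p' = (g', h')" by (cases p')
      obtain k where k: "gmult TG g' h' = Some k" using p' gh' by (auto simp: composable_pairs_def)
      have "k \<in> U" using Z_mult[OF c, of g' h' k] p' gh' k q by blast
      then show "p' \<in> {p \<in> topspace ?X. ?f p \<in> U}" using p' gh' k unfolding top by simp
    qed
    ultimately show "\<exists>V. openin ?X V \<and> p \<in> V \<and> V \<subseteq> {p \<in> topspace ?X. ?f p \<in> U}" by blast
  qed
qed

lemma gsrc_homeomorphic_on_Z:
  assumes "x \<in> carrier S" "y \<in> carrier S"
  shows "homeomorphic_map (subtopology (gtop TG) (Z x y)) (subtopology (gtop TG) (Z y y)) (gsrc TG)"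
proof (rule bijective_open_imp_homeomorphic_map)
  have top: "topspace (subtopology (gtop TG) (Z x y)) = Z x y"
    if "x \<in> carrier S" "y \<in> carrier S" for x y
    using Z_subset_carrier[OF that] by (auto simp: TG_topspace)
  show "continuous_map (subtopology (gtop TG) (Z x y)) (subtopology (gtop TG) (Z y y)) (gsrc TG)"
    using continuous_gsrc gsrc_Z[OF assms]
    by (auto simp: continuous_map_in_subtopology continuous_map_from_subtopology)
  show "open_map (subtopology (gtop TG) (Z x y)) (subtopology (gtop TG) (Z y y)) (gsrc TG)"
    unfolding open_map_def
  proof (intro allI impI)
    fix U assume "openin (subtopology (gtop TG) (Z x y)) U"
    then have "openin (gtop TG) U" "U \<subseteq> Z x y"
      using openin_open_subtopology[OF openin_Z[OF assms]] by auto
    then show "openin (subtopology (gtop TG) (Z y y)) (gsrc TG ` U)"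
      using openin_open_subtopology[OF openin_Z[OF assms(2,2)]] open_gsrc gsrc_Z[OF assms] by blast
  qed
  show "gsrc TG ` topspace (subtopology (gtop TG) (Z x y)) = topspace (subtopology (gtop TG) (Z y y))"
    using top assms gsrc_Z by simp
  show "inj_on (gsrc TG) (topspace (subtopology (gtop TG) (Z x y)))"
    unfolding top[OF assms] using Z_gsrc_inj[OF assms] by (intro inj_onI)
qed

lemma etale_groupoid_TG: "etale_groupoid TG"
proof (intro etale_groupoid.intro etale_groupoid_axioms.intro groupoid_TG TG_topspace
    continuous_gmult_TG continuous_ginv_TG)
  fix g assume "g \<in> carrier TG"
  then obtain x y where xy: "x \<in> carrier S" "y \<in> carrier S" "g \<in> Z x y"
    using openin_TG_Z[OF openin_topspace] TG_topspace by metis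
  have "openin (identity_space TG) (gsrc TG ` Z x y)"
    using openin_open_subtopology[OF openin_identities] gsrc_Z[OF xy(1,2)] openin_Z[OF xy(2,2)]
      Z_diagonal_identities[OF xy(2)] by simp
  then show "\<exists>U. openin (gtop TG) U \<and> g \<in> U \<and> openin (identity_space TG) (gsrc TG ` U) \<and>
      homeomorphic_map (subtopology (gtop TG) U) (subtopology (gtop TG) (gsrc TG ` U)) (gsrc TG)"
    using openin_Z xy gsrc_homeomorphic_on_Z gsrc_Z by metis
qed

lemma tiling_topspace: "topspace (tiling_topology S d) = T"
proof -
  have "cyl \<one> = T" by (auto simp: cyl_def d_one tilings_def)
  then have "T \<in> {prefix_tiling S d a ` T |a. a \<in> carrier S}" using prefix_tiling_image by blast
  moreover have "X \<subseteq> T" if "X \<in> {prefix_tiling S d a ` T |a. a \<in> carrier S}" for X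
    using that prefix_tiling_image by (auto simp: cyl_def)
  ultimately show ?thesis unfolding tiling_topology_def topology_generated_by_topspace by blast
qed

lemma openin_cyl: "a \<in> carrier S \<Longrightarrow> openin (tiling_topology S d) (cyl a)"
  unfolding tiling_topology_def
  by (rule topology_generated_by_Basis) (auto simp: prefix_tiling_image[symmetric])

text \<open>\<open>Z(x, y)\<close> is a continuous image of the space of tilings, from which it inherits compactness.\<close>

lemma continuous_tiling_to_Z:
  assumes "x \<in> carrier S" "y \<in> carrier S"
  shows "continuous_map (tiling_topology S d) (gtop TG)
    (\<lambda>w. (prefix_tiling S d x w, vec_int (d x) - vec_int (d y), prefix_tiling S d y w))"
    (is "continuous_map _ _ ?f")
  unfolding continuous_map_def tiling_topspace
proof (intro conjI allI impI)
  have f: "?f w \<in> Z x y" if "w \<in> T" for w using that by (auto simp: Z_set_def)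
  then show "?f \<in> T \<rightarrow> topspace (gtop TG)"
    using Z_subset_carrier[OF assms] TG_topspace by blast
  fix U assume U: "openin (gtop TG) U"
  show "openin (tiling_topology S d) {w \<in> T. ?f w \<in> U}"
  proof (subst openin_subopen, intro ballI)
    fix w assume "w \<in> {w \<in> T. ?f w \<in> U}"
    then have w: "w \<in> T" "?f w \<in> U" by auto
    have lev: "has_level (?f t) (d x) (d y)" if "t \<in> T" for t
      using f[OF that] assms Z_iff by blast
    obtain q where q: "Z (prefix_tiling S d x w 0 (d x + q)) (prefix_tiling S d y w 0 (d y + q)) \<subseteq> U"
      using openin_TG_level[OF U w(2) lev[OF w(1)]] .
    have pre: "prefix_tiling S d a t 0 (d a + q) = a \<otimes> t 0 q" if "t \<in> T" "a \<in> carrier S" for a t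
      using tiling_prefix_shift[of "prefix_tiling S d a t" "d a" q] prefix_tiling[OF that(2,1)] by simp
    have w0: "w 0 q \<in> carrier S" "d (w 0 q) = q" using w tiling_closed0 tiling_degree0 by auto
    have "?f t \<in> U" if t: "t \<in> cyl (w 0 q)" for t
    proof -
      have tT: "t \<in> T" "t 0 q = w 0 q" using t w0 by (auto simp: cyl_def)
      have "?f t \<in> Z (prefix_tiling S d x t 0 (d x + q)) (prefix_tiling S d y t 0 (d y + q))"
        using Z_at_level has_level_add[OF lev[OF tT(1)]] prefix_tiling tT assms by blast
      then show ?thesis using q pre tT w assms by auto
    qed
    then have "cyl (w 0 q) \<subseteq> {w \<in> T. ?f w \<in> U}" by (auto simp: cyl_def)
    moreover have "w \<in> cyl (w 0 q)" using w w0 by (simp add: cyl_def)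
    ultimately show "\<exists>V. openin (tiling_topology S d) V \<and> w \<in> V \<and> V \<subseteq> {w \<in> T. ?f w \<in> U}"
      using openin_cyl w0 by blast
  qed
qed

lemma compactin_Z:
  assumes "compact_space (tiling_topology S d)" "x \<in> carrier S" "y \<in> carrier S"
  shows "compactin (gtop TG) (Z x y)"
proof -
  have "compactin (tiling_topology S d) T"
    using assms(1) by (simp add: compact_space_def tiling_topspace)
  then show ?thesis
    using image_compactin[OF _ continuous_tiling_to_Z[OF assms(2,3)]] unfolding Z_set_def by blast
qed

lemma boolean_groupoid_TG:
  assumes "compact_space (tiling_topology S d)"
  shows "boolean_groupoid TG"
proof (intro boolean_groupoid.intro boolean_groupoid_axioms.intro etale_groupoid_TG)
  let ?I = "identity_space TG"
  have sub: "identities TG \<subseteq> carrier TG" by (rule TG.identities_subset_carrier)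
  have open_iff: "openin ?I U \<longleftrightarrow> openin (gtop TG) U \<and> U \<subseteq> identities TG" for U
    by (rule openin_open_subtopology[OF openin_identities])
  have top: "topspace ?I = identities TG" using sub by (auto simp: TG_topspace)
  show "compact_space ?I"
    using compactin_Z[OF assms one_closed one_closed] by (simp add: Z_one compact_space_subtopology)
  have open_Z: "openin ?I (Z y y)" if "y \<in> carrier S" for y
    using open_iff openin_Z Z_diagonal_identities that by blast
  show "Hausdorff_space ?I"
    unfolding Hausdorff_space_def top
  proof (intro allI impI)
    fix e f assume "e \<in> identities TG \<and> f \<in> identities TG \<and> e \<noteq> f"
    then obtain v w where e: "v \<in> T" "w \<in> T" "e = (v, 0, v)" "f = (w, 0, w)" "v \<noteq> w"
      by (auto simp: TG_identities)
    then obtain n where n: "v 0 n \<noteq> w 0 n" using tiling_eqI[of v w 0] by auto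
    have c: "v 0 n \<in> carrier S" "w 0 n \<in> carrier S" "d (v 0 n) = n" "d (w 0 n) = n"
      using e tiling_closed0 tiling_degree0 by auto
    show "\<exists>U V. openin ?I U \<and> openin ?I V \<and> e \<in> U \<and> f \<in> V \<and> disjnt U V"
    proof (intro exI conjI)
      show "openin ?I (Z (v 0 n) (v 0 n))" "openin ?I (Z (w 0 n) (w 0 n))" using open_Z c by auto
      show "e \<in> Z (v 0 n) (v 0 n)" "f \<in> Z (w 0 n) (w 0 n)"
        using e c by (auto simp: Z_diagonal cyl_def)
      show "disjnt (Z (v 0 n) (v 0 n)) (Z (w 0 n) (w 0 n))"
        using n c by (auto simp: Z_diagonal cyl_def disjnt_def)
    qed
  qed
  have closed_Z: "closedin ?I (Z y y)" if y: "y \<in> carrier S" for y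
    unfolding closedin_def top
  proof
    show "Z y y \<subseteq> identities TG" using Z_diagonal_identities y by blast
    show "openin ?I (identities TG - Z y y)"
    proof (subst openin_subopen, intro ballI)
      fix e assume "e \<in> identities TG - Z y y"
      then obtain w where w: "w \<in> T" "e = (w, 0, w)" "w 0 (d y) \<noteq> y"
        using y by (auto simp: TG_identities Z_diagonal cyl_def)
      let ?b = "w 0 (d y)"
      have b: "?b \<in> carrier S" "d ?b = d y" using w tiling_closed0 tiling_degree0 by auto
      have "e \<in> Z ?b ?b" "Z ?b ?b \<subseteq> identities TG - Z y y"
        using w b y Z_diagonal_identities[OF b(1)] by (auto simp: Z_diagonal cyl_def)
      then show "\<exists>V. openin ?I V \<and> e \<in> V \<and> V \<subseteq> identities TG - Z y y" using open_Z b by blast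
    qed
  qed
  show "neighbourhood_base_of (\<lambda>V. openin ?I V \<and> closedin ?I V) ?I"
    unfolding neighbourhood_base_of
  proof (intro allI impI)
    fix W e assume We: "openin ?I W \<and> e \<in> W"
    then obtain w where w: "w \<in> T" "e = (w, 0, w)" "openin (gtop TG) W"
      using open_iff[of W] by (auto simp: TG_identities)
    obtain q where q: "Z (w 0 (0 + q)) (w 0 (0 + q)) \<subseteq> W"
      using openin_TG_level[OF w(3) _ has_level_identity] We w by blast
    let ?a = "w 0 (0 + q)"
    have a: "?a \<in> carrier S" using w tiling_closed0 by blast
    have "e \<in> Z ?a ?a" using w Z_at_level has_level_identity by blast
    then show "\<exists>U V. openin ?I U \<and> (openin ?I V \<and> closedin ?I V) \<and> e \<in> U \<and> U \<subseteq> V \<and> V \<subseteq> W"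
      using open_Z[OF a] closed_Z[OF a] q by blast
  qed
qed

section \<open>Finitely generated right ideals\<close>

lemma mem_ideal: "a \<in> X <#> carrier S \<longleftrightarrow> (\<exists>x\<in>X. \<exists>s\<in>carrier S. a = x \<otimes> s)"
  by (auto simp: set_mult_def)

lemma mem_principal_ideal: "a \<in> x <# carrier S \<longleftrightarrow> (\<exists>s\<in>carrier S. a = x \<otimes> s)"
  by (auto simp: l_coset_def)

lemma generators_subset_ideal: "X \<subseteq> carrier S \<Longrightarrow> X \<subseteq> X <#> carrier S"
proof
  fix x assume "X \<subseteq> carrier S" "x \<in> X"
  then have "x = x \<otimes> \<one>" by auto
  then show "x \<in> X <#> carrier S" unfolding mem_ideal using \<open>x \<in> X\<close> one_closed by blast
qed

lemma fg_right_ideal_E: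
  assumes "fg_right_ideal S I"
  obtains X where "finite X" "X \<subseteq> carrier S" "X \<subseteq> I" "\<forall>a. a \<in> I \<longleftrightarrow> (\<exists>x\<in>X. \<exists>s\<in>carrier S. a = x \<otimes> s)"
proof -
  obtain X where X: "finite X" "X \<subseteq> carrier S" "I = X <#> carrier S"
    using assms by (auto simp: fg_right_ideal_def)
  have "\<forall>a. a \<in> I \<longleftrightarrow> (\<exists>x\<in>X. \<exists>s\<in>carrier S. a = x \<otimes> s)" using X(3) mem_ideal by simp
  moreover have "X \<subseteq> I" using X generators_subset_ideal by simp
  ultimately show ?thesis using that X by blast
qed

lemma fg_right_ideal_I:
  assumes "finite X" "X \<subseteq> carrier S" "\<And>a. a \<in> I \<longleftrightarrow> (\<exists>x\<in>X. \<exists>s\<in>carrier S. a = x \<otimes> s)"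
  shows "fg_right_ideal S I"
proof -
  have "I = X <#> carrier S" by (rule Set.set_eqI) (simp add: assms(3) mem_ideal)
  then show ?thesis using assms fg_right_ideal_def by blast
qed

lemma fg_right_ideal_subset: "fg_right_ideal S I \<Longrightarrow> I \<subseteq> carrier S"
proof
  fix a assume "fg_right_ideal S I" "a \<in> I"
  then obtain X where "X \<subseteq> carrier S" "a \<in> X <#> carrier S" by (auto simp: fg_right_ideal_def)
  then obtain x s where "x \<in> carrier S" "s \<in> carrier S" "a = x \<otimes> s" unfolding mem_ideal by blast
  then show "a \<in> carrier S" by simp
qed

lemma fg_right_ideal_closed:
  assumes "fg_right_ideal S I" "a \<in> I" "s \<in> carrier S"
  shows "a \<otimes> s \<in> I"
proof -
  obtain X where X: "X \<subseteq> carrier S" "\<forall>a. a \<in> I \<longleftrightarrow> (\<exists>x\<in>X. \<exists>s\<in>carrier S. a = x \<otimes> s)"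
    using assms(1) by (elim fg_right_ideal_E) (rule that)
  obtain x t where "x \<in> X" "t \<in> carrier S" "a = x \<otimes> t" using X(2) assms(2) by blast
  then have "a \<otimes> s = x \<otimes> (t \<otimes> s)" "t \<otimes> s \<in> carrier S" using m_assoc X(1) assms(3) by auto
  then show ?thesis using X(2) \<open>x \<in> X\<close> by blast
qed

lemma fg_right_ideal_empty: "fg_right_ideal S {}"
  by (rule fg_right_ideal_I[of "{}"]) auto

lemma fg_right_ideal_carrier: "fg_right_ideal S (carrier S)"
  by (rule fg_right_ideal_I[of "{\<one>}"]) auto

lemma fg_right_ideal_principal: "a \<in> carrier S \<Longrightarrow> fg_right_ideal S (a <# carrier S)"
  by (rule fg_right_ideal_I[of "{a}"]) (auto simp: l_coset_def)

lemma fg_right_ideal_Un: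
  assumes "fg_right_ideal S I" "fg_right_ideal S J"
  shows "fg_right_ideal S (I \<union> J)"
proof -
  obtain X where X: "finite X" "X \<subseteq> carrier S" "\<forall>a. a \<in> I \<longleftrightarrow> (\<exists>x\<in>X. \<exists>s\<in>carrier S. a = x \<otimes> s)"
    using assms(1) by (elim fg_right_ideal_E) (rule that)
  obtain Y where Y: "finite Y" "Y \<subseteq> carrier S" "\<forall>a. a \<in> J \<longleftrightarrow> (\<exists>x\<in>Y. \<exists>s\<in>carrier S. a = x \<otimes> s)"
    using assms(2) by (elim fg_right_ideal_E) (rule that)
  show ?thesis
    by (rule fg_right_ideal_I[of "X \<union> Y"]) (use X Y in blast)+
qed

lemma fg_right_ideal_UN:
  assumes "finite A" "\<And>i. i \<in> A \<Longrightarrow> fg_right_ideal S (f i)"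
  shows "fg_right_ideal S (\<Union>i\<in>A. f i)"
  using assms by (induction rule: finite_induct) (auto simp: fg_right_ideal_empty fg_right_ideal_Un)

text \<open>Finite alignment extends from principal ideals to all finitely generated ones because
  intersection distributes over the finite unions of principal ideals.\<close>

lemma fg_right_ideal_Int:
  assumes "finitely_aligned S" "fg_right_ideal S I" "fg_right_ideal S J"
  shows "fg_right_ideal S (I \<inter> J)"
proof -
  obtain X where X: "finite X" "X \<subseteq> carrier S" "\<forall>a. a \<in> I \<longleftrightarrow> (\<exists>x\<in>X. \<exists>s\<in>carrier S. a = x \<otimes> s)"
    using assms(2) by (elim fg_right_ideal_E) (rule that)
  obtain Y where Y: "finite Y" "Y \<subseteq> carrier S" "\<forall>a. a \<in> J \<longleftrightarrow> (\<exists>x\<in>Y. \<exists>s\<in>carrier S. a = x \<otimes> s)"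
    using assms(3) by (elim fg_right_ideal_E) (rule that)
  have "I = (\<Union>x\<in>X. x <# carrier S)" "J = (\<Union>y\<in>Y. y <# carrier S)"
    using X(3) Y(3) by (simp_all add: Set.set_eq_iff mem_principal_ideal)
  then have "I \<inter> J = (\<Union>x\<in>X. \<Union>y\<in>Y. (x <# carrier S) \<inter> (y <# carrier S))" by blast
  moreover have "fg_right_ideal S ((x <# carrier S) \<inter> (y <# carrier S))" if "x \<in> X" "y \<in> Y" for x y
  proof -
    have "x \<in> carrier S" "y \<in> carrier S" using that X(2) Y(2) by auto
    then show ?thesis using assms(1) fg_right_ideal_empty unfolding finitely_aligned_def by metis
  qed
  then have "fg_right_ideal S (\<Union>x\<in>X. \<Union>y\<in>Y. (x <# carrier S) \<inter> (y <# carrier S))"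
    by (intro fg_right_ideal_UN X(1) Y(1))
  ultimately show ?thesis by (rule ssubst)
qed

lemma fg_right_ideal_image:
  assumes "fg_right_ideal S I" "f ` I \<subseteq> carrier S"
    and "\<And>a s. \<lbrakk>a \<in> I; s \<in> carrier S\<rbrakk> \<Longrightarrow> f (a \<otimes> s) = f a \<otimes> s"
  shows "fg_right_ideal S (f ` I)"
proof -
  obtain X where X: "finite X" "X \<subseteq> carrier S" "X \<subseteq> I"
    "\<forall>a. a \<in> I \<longleftrightarrow> (\<exists>x\<in>X. \<exists>s\<in>carrier S. a = x \<otimes> s)"
    using assms(1) by (elim fg_right_ideal_E) (rule that)
  show ?thesis
  proof (rule fg_right_ideal_I[of "f ` X"])
    show "finite (f ` X)" using X(1) by (rule finite_imageI)
    show "f ` X \<subseteq> carrier S" using image_mono[OF X(3), of f] assms(2) by (rule subset_trans)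
    fix b
    show "b \<in> f ` I \<longleftrightarrow> (\<exists>x\<in>f ` X. \<exists>s\<in>carrier S. b = x \<otimes> s)"
    proof
      assume "b \<in> f ` I"
      then obtain a where a: "a \<in> I" "b = f a" by (rule imageE)
      then obtain x s where "x \<in> X" "s \<in> carrier S" "a = x \<otimes> s" using X(4) by blast
      with a have xs: "x \<in> X" "s \<in> carrier S" "b = f (x \<otimes> s)" by simp_all
      moreover have "x \<in> I" using X(3) xs(1) by (rule subsetD)
      ultimately have "b = f x \<otimes> s" using assms(3)[of x s] by simp
      then show "\<exists>x\<in>f ` X. \<exists>s\<in>carrier S. b = x \<otimes> s" using xs by blast
    next
      assume "\<exists>x\<in>f ` X. \<exists>s\<in>carrier S. b = x \<otimes> s"
      then obtain x s where xs: "x \<in> X" "s \<in> carrier S" "b = f x \<otimes> s" by blast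
      moreover have "x \<in> I" using X(3) xs(1) by (rule subsetD)
      ultimately have "b = f (x \<otimes> s)" using assms(3)[of x s] by simp
      moreover have "x \<otimes> s \<in> I" using X(4) xs(1,2) by blast
      ultimately show "b \<in> f ` I" by (rule image_eqI)
    qed
  qed
qed

section \<open>The inverse monoid of bijective morphisms between right ideals\<close>

abbreviation R :: "('a \<rightharpoonup> 'a) monoid" where "R \<equiv> R_monoid S"

lemma R_dom: "\<alpha> \<in> carrier R \<Longrightarrow> fg_right_ideal S (dom \<alpha>)"
  by (simp add: R_monoid_def)

lemma R_closed:
  assumes "\<alpha> \<in> carrier R" "\<alpha> a = Some b"
  shows "a \<in> carrier S" "b \<in> carrier S"
proof -
  have "fg_right_ideal S (dom \<alpha>)" "fg_right_ideal S (ran \<alpha>)" using assms by (simp_all add: R_monoid_def)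
  moreover have "a \<in> dom \<alpha>" "b \<in> ran \<alpha>" using assms(2) by (auto intro: ranI)
  ultimately show "a \<in> carrier S" "b \<in> carrier S" using fg_right_ideal_subset by blast+
qed

lemma R_morphism:
  assumes "\<alpha> \<in> carrier R" "\<alpha> a = Some b" "s \<in> carrier S"
  shows "\<alpha> (a \<otimes> s) = Some (b \<otimes> s)"
  using assms by (simp add: R_monoid_def right_ideal_morphism_def domIff)

lemma R_inj:
  assumes "\<alpha> \<in> carrier R" "\<alpha> a = Some c" "\<alpha> b = Some c"
  shows "a = b"
proof -
  have "inj_on \<alpha> (dom \<alpha>)" using assms by (simp add: R_monoid_def)
  then show ?thesis by (rule inj_onD) (use assms in auto)
qed

text \<open>The range of a morphism is finitely generated together with its domain: the images of the
  generators generate it.\<close>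

lemma R_I:
  assumes "fg_right_ideal S (dom \<alpha>)"
    and "\<And>a b. \<alpha> a = Some b \<Longrightarrow> b \<in> carrier S"
    and mor: "\<And>a b s. \<lbrakk>\<alpha> a = Some b; s \<in> carrier S\<rbrakk> \<Longrightarrow> \<alpha> (a \<otimes> s) = Some (b \<otimes> s)"
    and "\<And>a a' b. \<lbrakk>\<alpha> a = Some b; \<alpha> a' = Some b\<rbrakk> \<Longrightarrow> a = a'"
  shows "\<alpha> \<in> carrier R"
proof -
  let ?f = "\<lambda>a. the (\<alpha> a)"
  have f: "?f (a \<otimes> s) = ?f a \<otimes> s" if as: "a \<in> dom \<alpha>" "s \<in> carrier S" for a s
  proof -
    obtain b where "\<alpha> a = Some b" using as by blast
    then show ?thesis using mor as by simp
  qed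
  moreover have "?f ` dom \<alpha> \<subseteq> carrier S" using assms(2) by fastforce
  ultimately have "fg_right_ideal S (?f ` dom \<alpha>)"
    using fg_right_ideal_image[OF assms(1)] by blast
  moreover have "?f ` dom \<alpha> = ran \<alpha>" by (force simp: ran_def)
  moreover have "inj_on \<alpha> (dom \<alpha>)"
    by (rule inj_onI) (use assms(4) in auto)
  moreover have "right_ideal_morphism S \<alpha>"
    using mor by (auto simp: right_ideal_morphism_def)
  ultimately show ?thesis using assms(1) by (simp add: R_monoid_def)
qed

lemma R_one: "\<one>\<^bsub>R\<^esub> = Some |` carrier S" "\<one>\<^bsub>R\<^esub> \<in> carrier R"
proof -
  show 1: "\<one>\<^bsub>R\<^esub> = Some |` carrier S" by (simp add: R_monoid_def)
  have "dom (Some |` carrier S) = carrier S" by auto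
  then have fg: "fg_right_ideal S (dom (Some |` carrier S))" by (simp add: fg_right_ideal_carrier)
  show "\<one>\<^bsub>R\<^esub> \<in> carrier R"
    unfolding 1
    by (rule R_I[OF fg]) (auto simp: restrict_map_def split: if_splits)
qed

lemma R_mult: "\<alpha> \<otimes>\<^bsub>R\<^esub> \<beta> = \<alpha> \<circ>\<^sub>m \<beta>"
  by (simp add: R_monoid_def)

lemma R_empty: "Map.empty \<in> carrier R"
  by (rule R_I) (auto simp: fg_right_ideal_empty)

lemma R_restrict:
  assumes "\<alpha> \<in> carrier R" "fg_right_ideal S I" "I \<subseteq> dom \<alpha>"
  shows "\<alpha> |` I \<in> carrier R"
proof (rule R_I)
  have "dom (\<alpha> |` I) = I" using assms(3) by auto
  then show "fg_right_ideal S (dom (\<alpha> |` I))" using assms(2) by simp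
  show "b \<in> carrier S" if "(\<alpha> |` I) a = Some b" for a b
    using that R_closed[OF assms(1)] by (auto simp: restrict_map_def split: if_splits)
  show "(\<alpha> |` I) (a \<otimes> s) = Some (b \<otimes> s)" if "(\<alpha> |` I) a = Some b" "s \<in> carrier S" for a b s
    using that R_morphism[OF assms(1)] fg_right_ideal_closed[OF assms(2)]
    by (auto simp: restrict_map_def split: if_splits)
  show "a = a'" if "(\<alpha> |` I) a = Some b" "(\<alpha> |` I) a' = Some b" for a a' b
    using that R_inj[OF assms(1)] by (auto simp: restrict_map_def split: if_splits)
qed

definition map_inverse :: "('a \<rightharpoonup> 'a) \<Rightarrow> ('a \<rightharpoonup> 'a)" where
  "map_inverse \<alpha> b = (if b \<in> ran \<alpha> then Some (SOME a. \<alpha> a = Some b) else None)"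

lemma map_inverse_iff:
  assumes "\<alpha> \<in> carrier R"
  shows "map_inverse \<alpha> b = Some a \<longleftrightarrow> \<alpha> a = Some b"
proof
  assume m: "map_inverse \<alpha> b = Some a"
  then have "b \<in> ran \<alpha>" "a = (SOME a. \<alpha> a = Some b)"
    by (auto simp: map_inverse_def split: if_splits)
  then show "\<alpha> a = Some b" unfolding ran_def by (metis (mono_tags, lifting) mem_Collect_eq someI_ex)
next
  assume a: "\<alpha> a = Some b"
  then have "\<alpha> (SOME a. \<alpha> a = Some b) = Some b" by (rule someI)
  then show "map_inverse \<alpha> b = Some a"
    using a R_inj[OF assms a] by (auto simp: map_inverse_def ranI)
qed

lemma R_map_inverse:
  assumes "\<alpha> \<in> carrier R"
  shows "map_inverse \<alpha> \<in> carrier R"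
proof (rule R_I)
  have "dom (map_inverse \<alpha>) = ran \<alpha>" by (auto simp: map_inverse_def split: if_splits)
  then show "fg_right_ideal S (dom (map_inverse \<alpha>))" using assms by (simp add: R_monoid_def)
qed (use assms in \<open>auto simp: map_inverse_iff R_closed R_morphism\<close>)

text \<open>The domain of \<open>\<alpha> \<circ> \<beta>\<close> is the image of \<open>ran \<beta> \<inter> dom \<alpha>\<close> under the inverse of \<open>\<beta>\<close>. This is where
  finite alignment makes \<open>R(S)\<close> closed under composition.\<close>

lemma R_comp:
  assumes "finitely_aligned S" "\<alpha> \<in> carrier R" "\<beta> \<in> carrier R"
  shows "\<alpha> \<circ>\<^sub>m \<beta> \<in> carrier R"
proof (rule R_I)
  let ?i = "map_inverse \<beta>" and ?I = "ran \<beta> \<inter> dom \<alpha>"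
  have i: "?i \<in> carrier R" using R_map_inverse assms(3) by blast
  have ran: "b \<in> ran \<beta> \<Longrightarrow> \<exists>a. ?i b = Some a" for b by (simp add: map_inverse_def)
  have "fg_right_ideal S ?I"
    using assms fg_right_ideal_Int by (simp add: R_monoid_def)
  moreover have "(\<lambda>b. the (?i b)) ` ?I \<subseteq> carrier S"
    using ran R_closed[OF i] by fastforce
  moreover have "the (?i (b \<otimes> s)) = the (?i b) \<otimes> s" if "b \<in> ?I" "s \<in> carrier S" for b s
    using ran[of b] R_morphism[OF i _ that(2)] that by fastforce
  ultimately have "fg_right_ideal S ((\<lambda>b. the (?i b)) ` ?I)" by (rule fg_right_ideal_image)
  moreover have "(\<lambda>b. the (?i b)) ` ?I = dom (\<alpha> \<circ>\<^sub>m \<beta>)"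
  proof (intro equalityI subsetI)
    fix a assume "a \<in> (\<lambda>b. the (?i b)) ` ?I"
    then obtain b c where b: "b \<in> ran \<beta>" "\<alpha> b = Some c" "a = the (?i b)" by blast
    then have "?i b = Some a" using ran by force
    then have "\<beta> a = Some b" using map_inverse_iff assms(3) by blast
    then show "a \<in> dom (\<alpha> \<circ>\<^sub>m \<beta>)" using b by (simp add: domIff)
  next
    fix a assume "a \<in> dom (\<alpha> \<circ>\<^sub>m \<beta>)"
    then obtain b c where b: "\<beta> a = Some b" "\<alpha> b = Some c" by (auto simp: map_comp_Some_iff)
    then have "b \<in> ?I" by (auto intro: ranI)
    moreover have "?i b = Some a" using map_inverse_iff[OF assms(3)] b by blast
    then have "a = the (?i b)" by simp
    ultimately show "a \<in> (\<lambda>b. the (?i b)) ` ?I" by blast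
  qed
  ultimately show "fg_right_ideal S (dom (\<alpha> \<circ>\<^sub>m \<beta>))" by simp
  show "b \<in> carrier S" if "(\<alpha> \<circ>\<^sub>m \<beta>) a = Some b" for a b
    using that R_closed(2)[OF assms(2)] by (auto simp: map_comp_Some_iff)
  show "(\<alpha> \<circ>\<^sub>m \<beta>) (a \<otimes> s) = Some (b \<otimes> s)" if "(\<alpha> \<circ>\<^sub>m \<beta>) a = Some b" "s \<in> carrier S" for a b s
    using that R_morphism[OF assms(2)] R_morphism[OF assms(3)] by (auto simp: map_comp_Some_iff)
  show "a = a'" if "(\<alpha> \<circ>\<^sub>m \<beta>) a = Some b" "(\<alpha> \<circ>\<^sub>m \<beta>) a' = Some b" for a a' b
    using that R_inj[OF assms(2)] R_inj[OF assms(3)] unfolding map_comp_Some_iff by metis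
qed

text \<open>The meet of two partial functions in the order of restriction.\<close>

definition agreement :: "('a \<rightharpoonup> 'a) \<Rightarrow> ('a \<rightharpoonup> 'a) \<Rightarrow> ('a \<rightharpoonup> 'a)" where
  "agreement \<alpha> \<beta> a = (if \<alpha> a = \<beta> a then \<alpha> a else None)"

lemma agreement_iff: "agreement \<alpha> \<beta> a = Some b \<longleftrightarrow> \<alpha> a = Some b \<and> \<beta> a = Some b"
  by (auto simp: agreement_def)

text \<open>Right cancellation is what makes the domain of the agreement finitely generated: if \<open>\<alpha>\<close> and \<open>\<beta>\<close>
  agree at \<open>xs\<close> and are both defined at \<open>x\<close>, then they agree at \<open>x\<close>. So the generators of
  \<open>dom \<alpha> \<inter> dom \<beta>\<close> at which the two agree suffice.\<close>

lemma R_agreement: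
  assumes "finitely_aligned S" "\<alpha> \<in> carrier R" "\<beta> \<in> carrier R"
  shows "agreement \<alpha> \<beta> \<in> carrier R"
proof (rule R_I)
  obtain X where X: "finite X" "X \<subseteq> carrier S" "X \<subseteq> dom \<alpha> \<inter> dom \<beta>"
    "\<forall>a. a \<in> dom \<alpha> \<inter> dom \<beta> \<longleftrightarrow> (\<exists>x\<in>X. \<exists>s\<in>carrier S. a = x \<otimes> s)"
    using fg_right_ideal_Int[OF assms(1) R_dom[OF assms(2)] R_dom[OF assms(3)]]
    by (elim fg_right_ideal_E) (rule that)
  show "fg_right_ideal S (dom (agreement \<alpha> \<beta>))"
  proof (rule fg_right_ideal_I[of "{x \<in> X. \<alpha> x = \<beta> x}"])
    show "finite {x \<in> X. \<alpha> x = \<beta> x}" "{x \<in> X. \<alpha> x = \<beta> x} \<subseteq> carrier S" using X by auto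
    fix a
    show "a \<in> dom (agreement \<alpha> \<beta>) \<longleftrightarrow> (\<exists>x\<in>{x \<in> X. \<alpha> x = \<beta> x}. \<exists>s\<in>carrier S. a = x \<otimes> s)"
    proof
      assume "a \<in> dom (agreement \<alpha> \<beta>)"
      then obtain b where b: "\<alpha> a = Some b" "\<beta> a = Some b" by (auto simp: agreement_iff)
      then have "a \<in> dom \<alpha> \<inter> dom \<beta>" by blast
      then obtain x s where x: "x \<in> X" "s \<in> carrier S" "a = x \<otimes> s" using X(4) by blast
      then obtain p q where pq: "\<alpha> x = Some p" "\<beta> x = Some q" using X(3) by blast
      then have "p \<otimes> s = q \<otimes> s"
        using b x R_morphism[OF assms(2) pq(1)] R_morphism[OF assms(3) pq(2)] by simp
      then have "p = q"
        using right_cancel R_closed(2)[OF assms(2) pq(1)] R_closed(2)[OF assms(3) pq(2)] x by blast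
      then show "\<exists>x\<in>{x \<in> X. \<alpha> x = \<beta> x}. \<exists>s\<in>carrier S. a = x \<otimes> s" using x pq by auto
    next
      assume "\<exists>x\<in>{x \<in> X. \<alpha> x = \<beta> x}. \<exists>s\<in>carrier S. a = x \<otimes> s"
      then obtain x s where x: "x \<in> X" "\<alpha> x = \<beta> x" "s \<in> carrier S" "a = x \<otimes> s" by blast
      then obtain p where "\<alpha> x = Some p" "\<beta> x = Some p" using X(3) by auto
      then have "agreement \<alpha> \<beta> a = Some (p \<otimes> s)"
        unfolding agreement_iff x(4) using R_morphism assms(2,3) x(3) by blast
      then show "a \<in> dom (agreement \<alpha> \<beta>)" by blast
    qed
  qed
qed (use assms R_closed R_morphism R_inj in \<open>auto simp: agreement_iff\<close>)

text \<open>The groupoid of all pairs \<open>(b, a)\<close>, regarded as an arrow from \<open>a\<close> to \<open>b\<close>. Its local bisections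
  are the graphs of partial bijections, so the general facts on representations by local
  bisections determine idempotents, inverses, order and meets in \<open>R(S)\<close>.\<close>

definition pair_groupoid :: "('a \<times> 'a) groupoid" where
  "pair_groupoid = \<lparr>carrier = carrier S \<times> carrier S,
     gmult = (\<lambda>(c, b) (b', a). if b = b' then Some (c, a) else None),
     ginv = (\<lambda>(b, a). (a, b))\<rparr>"

definition map_graph :: "('a \<rightharpoonup> 'a) \<Rightarrow> ('a \<times> 'a) set" where
  "map_graph \<alpha> = {(b, a). \<alpha> a = Some b}"

lemma groupoid_pair_groupoid: "groupoid pair_groupoid"
  by unfold_locales (auto simp: pair_groupoid_def split: if_splits)

lemma pair_identities: "identities pair_groupoid = (\<lambda>a. (a, a)) ` carrier S"
  by (force simp: identities_def pair_groupoid_def gsrc_def)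

lemma R_representation:
  assumes "finitely_aligned S"
  shows "local_bisection_representation pair_groupoid R map_graph"
proof (intro local_bisection_representation.intro local_bisection_representation_axioms.intro
    groupoid_pair_groupoid)
  show "inj_on map_graph (carrier R)"
  proof (rule inj_onI)
    fix \<alpha> \<beta> assume eq: "map_graph \<alpha> = map_graph \<beta>"
    have graph: "\<gamma> a = Some b \<longleftrightarrow> (b, a) \<in> map_graph \<gamma>" for \<gamma> a b by (simp add: map_graph_def)
    show "\<alpha> = \<beta>"
    proof (rule ext)
      fix a
      have "\<alpha> a = Some b \<longleftrightarrow> \<beta> a = Some b" for b by (simp add: graph eq)
      then show "\<alpha> a = \<beta> a" by (metis not_None_eq)
    qed
  qed
  fix \<alpha> assume a: "\<alpha> \<in> carrier R"
  have "map_graph \<alpha> \<subseteq> carrier pair_groupoid"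
    using R_closed[OF a] by (auto simp: map_graph_def pair_groupoid_def)
  then show "local_bisection pair_groupoid (map_graph \<alpha>)"
    using R_inj[OF a]
    by (auto simp: local_bisection_def map_graph_def pair_groupoid_def gsrc_def gtgt_def)
  have "ginv pair_groupoid ` map_graph \<alpha> = map_graph (map_inverse \<alpha>)"
    by (force simp: map_graph_def map_inverse_iff[OF a] pair_groupoid_def)
  then show "ginv pair_groupoid ` map_graph \<alpha> \<in> map_graph ` carrier R"
    using R_map_inverse[OF a] by blast
next
  fix \<alpha> \<beta> assume ab: "\<alpha> \<in> carrier R" "\<beta> \<in> carrier R"
  show "\<alpha> \<otimes>\<^bsub>R\<^esub> \<beta> \<in> carrier R" using R_comp[OF assms ab] by (simp add: R_mult)
  show "map_graph (\<alpha> \<otimes>\<^bsub>R\<^esub> \<beta>) = gset_mult pair_groupoid (map_graph \<alpha>) (map_graph \<beta>)"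
    by (auto simp: R_mult map_graph_def gset_mult_def pair_groupoid_def map_comp_Some_iff
        split: if_splits)
next
  show "\<one>\<^bsub>R\<^esub> \<in> carrier R" by (rule R_one)
  show "map_graph \<one>\<^bsub>R\<^esub> = identities pair_groupoid"
    by (auto simp: pair_identities R_one map_graph_def restrict_map_def split: if_splits)
qed

lemma R_natural_le:
  assumes "finitely_aligned S" "\<alpha> \<in> carrier R" "\<beta> \<in> carrier R"
  shows "natural_le R \<alpha> \<beta> \<longleftrightarrow> (\<forall>a b. \<alpha> a = Some b \<longrightarrow> \<beta> a = Some b)"
  using local_bisection_representation.natural_le_iff[OF R_representation[OF assms(1)] assms(2,3)]
  by (auto simp: map_graph_def)

lemma R_mzero: "finitely_aligned S \<Longrightarrow> mzero R = Map.empty"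
  by (rule local_bisection_representation.mzero_eqI[OF R_representation])
    (auto simp: R_empty map_graph_def)

lemma R_meet:
  assumes "finitely_aligned S" "\<alpha> \<in> carrier R" "\<beta> \<in> carrier R"
  shows "\<alpha> \<sqinter>\<^bsub>natural_order R\<^esub> \<beta> = agreement \<alpha> \<beta>"
  by (rule local_bisection_representation.meet_eqI[OF R_representation[OF assms(1)] assms(2,3)
        R_agreement[OF assms]])
    (auto simp: map_graph_def agreement_iff)

lemma R_gen_inverse:
  assumes "finitely_aligned S" "\<alpha> \<in> carrier R"
  shows "gen_inverse R \<alpha> = map_inverse \<alpha>"
proof -
  interpret rep: local_bisection_representation pair_groupoid R map_graph
    by (rule R_representation[OF assms(1)])
  have "map_graph (map_inverse \<alpha>) = ginv pair_groupoid ` map_graph \<alpha>"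
    by (force simp: map_graph_def map_inverse_iff[OF assms(2)] pair_groupoid_def)
  then show ?thesis
    using rep.rep_eqI rep.gen_inverse_represented[OF assms(2)] R_map_inverse[OF assms(2)] by metis
qed

lemma R_idempotents:
  assumes "finitely_aligned S"
  shows "e \<in> idempotents R \<longleftrightarrow> e \<in> carrier R \<and> (\<forall>a b. e a = Some b \<longrightarrow> b = a)"
proof -
  interpret rep: local_bisection_representation pair_groupoid R map_graph
    by (rule R_representation[OF assms])
  show ?thesis
    using R_closed by (fastforce simp: rep.idempotents_iff map_graph_def pair_identities)
qed

section \<open>From morphisms of right ideals to bisections\<close>

text \<open>The map \<open>\<psi>\<close>. The union is over the whole domain rather than over a generating set, so that it
  involves no choice; \<open>arrows_of_generators\<close> below shows that generators give the same set.\<close>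

definition arrows_of :: "('a \<rightharpoonup> 'a) \<Rightarrow> ('a, 'k) tiling_arrow set" where
  "arrows_of \<alpha> = {g. \<exists>x y. \<alpha> x = Some y \<and> g \<in> Z y x}"

lemma arrows_of_I: "\<alpha> x = Some y \<Longrightarrow> g \<in> Z y x \<Longrightarrow> g \<in> arrows_of \<alpha>"
  by (auto simp: arrows_of_def)

text \<open>An arrow in \<open>Z(\<alpha> x, x)\<close> remains one when \<open>x\<close> is replaced by a longer prefix of its source, since
  the same piece is appended on both sides and \<open>\<alpha>\<close> is a morphism.\<close>

lemma arrow_extend:
  assumes "\<alpha> \<in> carrier R" "\<alpha> x = Some y" "(v, n, w) \<in> Z y x"
  shows "\<alpha> (w 0 (d x + q)) = Some (v 0 (d y + q))"
    "(v, n, w) \<in> Z (v 0 (d y + q)) (w 0 (d x + q))"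
proof -
  have c: "x \<in> carrier S" "y \<in> carrier S" using R_closed assms by blast+
  have *: "v \<in> T" "w \<in> T" "v 0 (d y) = y" "w 0 (d x) = x" "has_level (v, n, w) (d y) (d x)"
    using assms c Z_iff by auto
  let ?u = "shift (d x) w 0 q"
  have u: "?u \<in> carrier S" using * shift_tiling tiling_closed0 by blast
  have "w 0 (d x + q) = x \<otimes> ?u" using tiling_prefix_shift[of w "d x" q] * by simp
  moreover have "v 0 (d y + q) = y \<otimes> ?u"
    using tiling_prefix_shift[of v "d y" q] * by (simp add: has_level_simp)
  ultimately show "\<alpha> (w 0 (d x + q)) = Some (v 0 (d y + q))" using R_morphism assms u by simp
  show "(v, n, w) \<in> Z (v 0 (d y + q)) (w 0 (d x + q))" using * Z_at_level has_level_add by blast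
qed

lemma arrows_of_level:
  assumes "\<alpha> \<in> carrier R" "(v, n, w) \<in> arrows_of \<alpha>"
  obtains p where "\<And>q. \<exists>y. \<alpha> (w 0 (p + q)) = Some y \<and> (v, n, w) \<in> Z y (w 0 (p + q))"
proof -
  obtain x y where "\<alpha> x = Some y" "(v, n, w) \<in> Z y x" using assms(2) by (auto simp: arrows_of_def)
  then show ?thesis using that[of "d x"] arrow_extend assms(1) by blast
qed

lemma arrows_of_carrier:
  assumes "\<alpha> \<in> carrier R"
  shows "arrows_of \<alpha> \<subseteq> carrier TG"
proof
  fix g assume "g \<in> arrows_of \<alpha>"
  then obtain x y where "\<alpha> x = Some y" "g \<in> Z y x" by (auto simp: arrows_of_def)
  then show "g \<in> carrier TG" using R_closed[OF assms] Z_subset_carrier by blast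
qed

lemma arrows_of_inverse:
  assumes "\<alpha> \<in> carrier R"
  shows "arrows_of (map_inverse \<alpha>) = ginv TG ` arrows_of \<alpha>"
proof -
  have sub: "ginv TG ` arrows_of \<beta> \<subseteq> arrows_of (map_inverse \<beta>)" if \<beta>: "\<beta> \<in> carrier R" for \<beta>
  proof
    fix h assume "h \<in> ginv TG ` arrows_of \<beta>"
    then obtain g x y where g: "h = ginv TG g" "\<beta> x = Some y" "g \<in> Z y x"
      by (auto simp: arrows_of_def)
    then have "h \<in> Z x y" using Z_ginv R_closed[OF \<beta>] by blast
    then show "h \<in> arrows_of (map_inverse \<beta>)" using map_inverse_iff[OF \<beta>] g arrows_of_I by blast
  qed
  have i: "map_inverse \<alpha> \<in> carrier R" using R_map_inverse assms by blast
  have "map_inverse (map_inverse \<alpha>) a = \<alpha> a" for a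
    using map_inverse_iff[OF i, of a] map_inverse_iff[OF assms, of _ a] by (metis not_None_eq)
  then have "ginv TG ` arrows_of (map_inverse \<alpha>) \<subseteq> arrows_of \<alpha>" using sub[OF i] by (metis ext)
  then have "arrows_of (map_inverse \<alpha>) \<subseteq> ginv TG ` arrows_of \<alpha>"
    using TG.ginv_image_ginv_image[OF arrows_of_carrier[OF i]] by blast
  then show ?thesis using sub[OF assms] by blast
qed

text \<open>Two arrows with the same source lie in \<open>Z(y, x)\<close> for the same \<open>x\<close>, a long enough prefix of the
  source, and the same \<open>y = \<alpha> x\<close>. The statement on targets is the one on sources for the inverse
  of \<open>\<alpha>\<close>.\<close>

lemma local_bisection_arrows_of:
  assumes "\<alpha> \<in> carrier R"
  shows "local_bisection TG (arrows_of \<alpha>)"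
proof -
  have src: "g = h" if \<beta>: "\<beta> \<in> carrier R" and gh: "g \<in> arrows_of \<beta>" "h \<in> arrows_of \<beta>"
      "gsrc TG g = gsrc TG h" for \<beta> g h
  proof -
    obtain v n w where g: "g = (v, n, w)" by (cases g)
    obtain v' n' w' where h: "h = (v', n', w')" by (cases h)
    have w: "w' = w" using gh g h by (simp add: TG_gsrc)
    obtain p where p: "\<And>q. \<exists>y. \<beta> (w 0 (p + q)) = Some y \<and> (v, n, w) \<in> Z y (w 0 (p + q))"
      using arrows_of_level[OF \<beta> gh(1)[unfolded g]] by blast
    obtain p' where p': "\<And>q. \<exists>y. \<beta> (w 0 (p' + q)) = Some y \<and> (v', n', w) \<in> Z y (w 0 (p' + q))"
      using arrows_of_level[OF \<beta> gh(2)[unfolded h w]] by blast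
    let ?x = "w 0 (p + p')"
    obtain y where y: "\<beta> ?x = Some y" "g \<in> Z y ?x" using p[of p'] g by blast
    have "h \<in> Z y ?x" using p'[of p] y h w by (auto simp: add.commute)
    then show "g = h" using Z_gsrc_inj[of y ?x g h] R_closed[OF \<beta> y(1)] y gh by blast
  qed
  have tgt: "g = h" if gh: "g \<in> arrows_of \<alpha>" "h \<in> arrows_of \<alpha>" "gtgt TG g = gtgt TG h" for g h
  proof -
    have c: "g \<in> carrier TG" "h \<in> carrier TG" using gh arrows_of_carrier[OF assms] by blast+
    have "ginv TG g = ginv TG h"
    proof (rule src[OF R_map_inverse[OF assms]])
      show "ginv TG g \<in> arrows_of (map_inverse \<alpha>)" "ginv TG h \<in> arrows_of (map_inverse \<alpha>)"
        using gh arrows_of_inverse[OF assms] by blast+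
      show "gsrc TG (ginv TG g) = gsrc TG (ginv TG h)" using c gh TG.gsrc_ginv by simp
    qed
    then show ?thesis using TG.ginv_ginv c by metis
  qed
  show ?thesis
    unfolding local_bisection_def using arrows_of_carrier[OF assms] src[OF assms] tgt by blast
qed

lemma arrows_of_one: "arrows_of \<one>\<^bsub>R\<^esub> = identities TG"
proof -
  have "arrows_of \<one>\<^bsub>R\<^esub> = (\<Union>x\<in>carrier S. Z x x)"
    by (auto simp: arrows_of_def R_one restrict_map_def split: if_splits)
  then show ?thesis using Z_one Z_diagonal_identities one_closed by blast
qed

text \<open>An arrow in \<open>Z(\<alpha> (\<beta> x), x)\<close> factors through the tiling that starts with \<open>\<beta> x\<close>. Conversely, the
  prefix at which the second arrow is given and the one at which the first is given are made
  equal by extending both.\<close>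

lemma arrows_of_comp:
  assumes "\<alpha> \<in> carrier R" "\<beta> \<in> carrier R"
  shows "arrows_of (\<alpha> \<circ>\<^sub>m \<beta>) = gset_mult TG (arrows_of \<alpha>) (arrows_of \<beta>)"
proof (intro equalityI subsetI)
  fix g assume "g \<in> arrows_of (\<alpha> \<circ>\<^sub>m \<beta>)"
  then obtain x y z where xyz: "\<beta> x = Some y" "\<alpha> y = Some z" "g \<in> Z z x"
    by (auto simp: arrows_of_def map_comp_Some_iff)
  have c: "x \<in> carrier S" "y \<in> carrier S" "z \<in> carrier S" using xyz R_closed assms by blast+
  obtain v n w where g: "g = (v, n, w)" by (cases g)
  have *: "v \<in> T" "w \<in> T" "v 0 (d z) = z" "w 0 (d x) = x" "shift (d z) v = shift (d x) w"
    "n = vec_int (d z) - vec_int (d x)"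
    using xyz g c by (auto simp: Z_iff has_level_simp)
  let ?u = "prefix_tiling S d y (shift (d x) w)"
  have u: "?u \<in> T" "?u 0 (d y) = y" "shift (d y) ?u = shift (d x) w"
    using prefix_tiling[OF c(2) shift_tiling] * by auto
  have "(v, vec_int (d z) - vec_int (d y), ?u) \<in> Z z y" "(?u, vec_int (d y) - vec_int (d x), w) \<in> Z y x"
    using * u c by (simp_all add: Z_iff has_level_simp)
  then have "(v, vec_int (d z) - vec_int (d y), ?u) \<in> arrows_of \<alpha>"
    "(?u, vec_int (d y) - vec_int (d x), w) \<in> arrows_of \<beta>"
    using xyz arrows_of_I by blast+
  moreover have "gmult TG (v, vec_int (d z) - vec_int (d y), ?u) (?u, vec_int (d y) - vec_int (d x), w)
      = Some g"
    by (simp add: TG_gmult g *(6))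
  ultimately show "g \<in> gset_mult TG (arrows_of \<alpha>) (arrows_of \<beta>)" unfolding gset_mult_def by blast
next
  fix k assume "k \<in> gset_mult TG (arrows_of \<alpha>) (arrows_of \<beta>)"
  then obtain g h where gh: "g \<in> arrows_of \<alpha>" "h \<in> arrows_of \<beta>" "gmult TG g h = Some k"
    by (auto simp: gset_mult_def)
  obtain v n' u where g: "g = (v, n', u)" by (cases g)
  obtain u' n w where h: "h = (u', n, w)" by (cases h)
  have u: "u' = u" using gh g h by (simp add: TG_gmult split: if_splits)
  obtain x y where xy: "\<beta> x = Some y" "(u, n, w) \<in> Z y x" using gh h u by (auto simp: arrows_of_def)
  obtain p where p: "\<And>q. \<exists>z. \<alpha> (u 0 (p + q)) = Some z \<and> (v, n', u) \<in> Z z (u 0 (p + q))"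
    using arrows_of_level[OF assms(1) gh(1)[unfolded g]] by blast
  \<comment> \<open>extending \<open>y\<close> by \<open>p\<close> and \<open>p\<close> by \<open>d y\<close> leads to the same prefix of the middle tiling\<close>
  let ?y = "u 0 (d y + p)" and ?x = "w 0 (d x + p)"
  have b: "\<beta> ?x = Some ?y" "h \<in> Z ?y ?x" using arrow_extend[OF assms(2) xy] h u by auto
  obtain z where z: "\<alpha> ?y = Some z" "g \<in> Z z ?y" using p[of "d y"] g by (auto simp: add.commute)
  have "k \<in> Z z ?x"
    using Z_mult[of z ?y ?x g h k] b z gh R_closed[OF assms(1) z(1)] R_closed[OF assms(2) b(1)] by blast
  then show "k \<in> arrows_of (\<alpha> \<circ>\<^sub>m \<beta>)" using arrows_of_I[of "\<alpha> \<circ>\<^sub>m \<beta>" ?x z k] b z by simp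
qed

text \<open>At a common prefix \<open>x\<close> of the source, the middle component of the arrow fixes the degree of
  \<open>\<alpha> x\<close> and of \<open>\<beta> x\<close>, and both are prefixes of its target.\<close>

lemma arrows_of_agreement:
  assumes "\<alpha> \<in> carrier R" "\<beta> \<in> carrier R"
  shows "arrows_of (agreement \<alpha> \<beta>) = arrows_of \<alpha> \<inter> arrows_of \<beta>"
proof (intro equalityI subsetI)
  fix g assume "g \<in> arrows_of (agreement \<alpha> \<beta>)"
  then show "g \<in> arrows_of \<alpha> \<inter> arrows_of \<beta>" by (auto simp: arrows_of_def agreement_iff)
next
  fix g assume gi: "g \<in> arrows_of \<alpha> \<inter> arrows_of \<beta>"
  obtain v n w where g: "g = (v, n, w)" by (cases g)
  obtain p where p: "\<And>q. \<exists>y. \<alpha> (w 0 (p + q)) = Some y \<and> (v, n, w) \<in> Z y (w 0 (p + q))"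
    using arrows_of_level[of \<alpha> v n w] assms gi g by blast
  obtain p' where p': "\<And>q. \<exists>y. \<beta> (w 0 (p' + q)) = Some y \<and> (v, n, w) \<in> Z y (w 0 (p' + q))"
    using arrows_of_level[of \<beta> v n w] assms gi g by blast
  \<comment> \<open>a prefix of the source at which both functions are known to be defined\<close>
  let ?x = "w 0 (p + p')"
  obtain y where y: "\<alpha> ?x = Some y" "g \<in> Z y ?x" using p[of p'] g by blast
  obtain y' where y': "\<beta> ?x = Some y'" "g \<in> Z y' ?x" using p'[of p] g by (auto simp: add.commute)
  have c: "?x \<in> carrier S" "y \<in> carrier S" "y' \<in> carrier S" using y y' R_closed assms by blast+
  note yy = iffD1[OF Z_iff[OF c(2,1)] y(2)[unfolded g]] iffD1[OF Z_iff[OF c(3,1)] y'(2)[unfolded g]]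
  have "vec_int (d y) - vec_int (d ?x) = vec_int (d y') - vec_int (d ?x)"
    using yy unfolding has_level_simp by metis
  then have "d y = d y'" by (simp add: vec_int_eq_iff)
  then have "y = y'" using yy by metis
  then show "g \<in> arrows_of (agreement \<alpha> \<beta>)"
    using arrows_of_I[of "agreement \<alpha> \<beta>" ?x y g] y y' by (simp add: agreement_iff)
qed

lemma arrows_of_mono:
  "(\<And>a b. \<alpha> a = Some b \<Longrightarrow> \<beta> a = Some b) \<Longrightarrow> arrows_of \<alpha> \<subseteq> arrows_of \<beta>"
  unfolding arrows_of_def by blast

lemma arrows_of_empty: "arrows_of Map.empty = {}"
  by (simp add: arrows_of_def)

lemma arrows_of_nonempty:
  assumes "T \<noteq> {}" "\<alpha> \<noteq> Map.empty"
  shows "arrows_of \<alpha> \<noteq> {}"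
proof -
  obtain x y where xy: "\<alpha> x = Some y" using assms(2) by (metis ext not_None_eq)
  have "Z y x \<noteq> {}" using assms(1) by (simp add: Z_set_def)
  then show ?thesis using xy arrows_of_I by blast
qed

lemma Z_mult_subset:
  assumes "y \<in> carrier S" "x \<in> carrier S" "s \<in> carrier S"
  shows "Z (y \<otimes> s) (x \<otimes> s) \<subseteq> Z y x"
proof (cases "T = {}")
  case True
  then show ?thesis by (simp add: Z_set_def)
next
  case False
  then obtain t where "t \<in> T" by blast
  define t' where "t' = prefix_tiling S d s t"
  have t': "t' \<in> T" "t' 0 (d s) = s" using prefix_tiling assms(3) \<open>t \<in> T\<close> by (auto simp: t'_def)
  let ?v = "prefix_tiling S d y t'" and ?w = "prefix_tiling S d x t'"
  have *: "?v \<in> T" "?w \<in> T" "?v 0 (d y) = y" "?w 0 (d x) = x" "shift (d y) ?v = t'" "shift (d x) ?w = t'"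
    using prefix_tiling assms t' by auto
  have "?v 0 (d y + d s) = y \<otimes> s" "?w 0 (d x + d s) = x \<otimes> s"
    using tiling_prefix_shift[OF *(1), of "d y" "d s"] tiling_prefix_shift[OF *(2), of "d x" "d s"] * t'
    by auto
  moreover have "has_level (?v, vec_int (d y) - vec_int (d x), ?w) (d y) (d x)"
    using * by (simp add: has_level_simp)
  ultimately show ?thesis using Z_level_mono[OF *(1,2), of _ "d y" "d x" "d s"] * by simp
qed

text \<open>By the inclusion \<open>Z(ys, xs) \<subseteq> Z(y, x)\<close> the generators of the domain already contribute
  everything.\<close>

lemma arrows_of_generators:
  assumes "\<alpha> \<in> carrier R"
  obtains X where "finite X" "X \<subseteq> dom \<alpha>" "arrows_of \<alpha> = (\<Union>x\<in>X. Z (the (\<alpha> x)) x)"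
proof -
  obtain X where X: "finite X" "X \<subseteq> carrier S" "X \<subseteq> dom \<alpha>"
    "\<forall>a. a \<in> dom \<alpha> \<longleftrightarrow> (\<exists>x\<in>X. \<exists>s\<in>carrier S. a = x \<otimes> s)"
    using R_dom[OF assms] by (elim fg_right_ideal_E) (rule that)
  have "arrows_of \<alpha> = (\<Union>x\<in>X. Z (the (\<alpha> x)) x)"
  proof (intro equalityI subsetI)
    fix g assume "g \<in> arrows_of \<alpha>"
    then obtain a b where ab: "\<alpha> a = Some b" "g \<in> Z b a" by (auto simp: arrows_of_def)
    then have "a \<in> dom \<alpha>" by blast
    then obtain x s where xs: "x \<in> X" "s \<in> carrier S" "a = x \<otimes> s" using X(4) by blast
    then obtain y where y: "\<alpha> x = Some y" using X(3) by blast
    then have "b = y \<otimes> s" using R_morphism[OF assms y xs(2)] xs ab by simp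
    then have "g \<in> Z y x" using Z_mult_subset[of y x s] R_closed[OF assms y] xs ab by blast
    then show "g \<in> (\<Union>x\<in>X. Z (the (\<alpha> x)) x)" using xs y by force
  next
    fix g assume "g \<in> (\<Union>x\<in>X. Z (the (\<alpha> x)) x)"
    then obtain x where x: "x \<in> X" "g \<in> Z (the (\<alpha> x)) x" by blast
    then obtain y where "\<alpha> x = Some y" using X(3) by blast
    then show "g \<in> arrows_of \<alpha>" using arrows_of_I[of \<alpha> x y g] x by simp
  qed
  then show ?thesis using that X by blast
qed

lemma arrows_of_compact_open:
  assumes "compact_space (tiling_topology S d)" "\<alpha> \<in> carrier R"
  shows "openin (gtop TG) (arrows_of \<alpha>)" "compactin (gtop TG) (arrows_of \<alpha>)"
proof -
  obtain X where X: "finite X" "X \<subseteq> dom \<alpha>" "arrows_of \<alpha> = (\<Union>x\<in>X. Z (the (\<alpha> x)) x)"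
    using arrows_of_generators[OF assms(2)] .
  have c: "x \<in> carrier S \<and> the (\<alpha> x) \<in> carrier S" if x: "x \<in> X" for x
  proof -
    obtain y where "\<alpha> x = Some y" using x X(2) by blast
    then show ?thesis using R_closed[OF assms(2)] by simp
  qed
  show "openin (gtop TG) (arrows_of \<alpha>)" unfolding X(3) using c openin_Z by blast
  show "compactin (gtop TG) (arrows_of \<alpha>)"
    unfolding X(3) using X(1) c compactin_Z[OF assms(1)] by (intro compactin_Union) auto
qed

text \<open>Compactness yields finitely many pairs \<open>(x, y)\<close> such that the sets \<open>Z(y, x)\<close> cover \<open>A\<close>, and the
  morphism sends \<open>xs\<close> to \<open>ys\<close>. That it is well defined and injective is read off from the arrows
  attached to one fixed tiling \<open>t\<close>, because \<open>A\<close> contains at most one arrow with a given source or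
  target.\<close>

lemma compact_open_bisection_is_arrows_of:
  assumes "T \<noteq> {}" "openin (gtop TG) A" "compactin (gtop TG) A" "local_bisection TG A"
  obtains \<alpha> where "\<alpha> \<in> carrier R" "arrows_of \<alpha> = A"
proof -
  let ?C = "{Z y x |x y. x \<in> carrier S \<and> y \<in> carrier S \<and> Z y x \<subseteq> A}"
  have "A \<subseteq> \<Union>?C"
  proof
    fix g assume g: "g \<in> A"
    obtain y x where "y \<in> carrier S" "x \<in> carrier S" "g \<in> Z y x" "Z y x \<subseteq> A"
      using openin_TG_Z[OF assms(2) g] .
    then show "g \<in> \<Union>?C" by blast
  qed
  moreover have "\<forall>U\<in>?C. openin (gtop TG) U" using openin_Z by blast
  ultimately obtain F where F: "finite F" "F \<subseteq> ?C" "A \<subseteq> \<Union>F"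
    using assms(3) unfolding compactin_def by meson
  have "\<forall>U\<in>F. \<exists>p. fst p \<in> carrier S \<and> snd p \<in> carrier S \<and> U = Z (snd p) (fst p) \<and> U \<subseteq> A"
  proof
    fix U assume "U \<in> F"
    then obtain x y where "U = Z y x" "x \<in> carrier S" "y \<in> carrier S" "Z y x \<subseteq> A"
      using F(2) by blast
    then show "\<exists>p. fst p \<in> carrier S \<and> snd p \<in> carrier S \<and> U = Z (snd p) (fst p) \<and> U \<subseteq> A"
      by (intro exI[of _ "(x, y)"]) simp
  qed
  then have "\<exists>c. \<forall>U\<in>F. fst (c U) \<in> carrier S \<and> snd (c U) \<in> carrier S \<and>
      U = Z (snd (c U)) (fst (c U)) \<and> U \<subseteq> A"
    by (rule bchoice)
  then obtain c where c: "\<forall>U\<in>F. fst (c U) \<in> carrier S \<and> snd (c U) \<in> carrier S \<and>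
      U = Z (snd (c U)) (fst (c U)) \<and> U \<subseteq> A"
    by (elim exE) (rule that)
  define P where "P = c ` F"
  have P: "finite P" "P \<subseteq> carrier S \<times> carrier S"
    unfolding P_def using finite_imageI[OF F(1)] c by (blast, simp add: image_subset_iff mem_Times_iff)
  have "(case c U of (x, y) \<Rightarrow> Z y x) = U" if "U \<in> F" for U
    using bspec[OF c that] unfolding split_beta by metis
  then have "(\<Union>U\<in>F. case c U of (x, y) \<Rightarrow> Z y x) = (\<Union>U\<in>F. U)" by (intro SUP_cong refl)
  then have "(\<Union>(x, y)\<in>P. Z y x) = \<Union>F" unfolding P_def image_image by simp
  moreover have "A = \<Union>F" using F(2,3) by blast
  ultimately have PA: "A = (\<Union>(x, y)\<in>P. Z y x)" by simp
  define rel where "rel a b \<longleftrightarrow> (\<exists>x y s. (x, y) \<in> P \<and> s \<in> carrier S \<and> a = x \<otimes> s \<and> b = y \<otimes> s)" for a b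
  have rel_closed: "a \<in> carrier S" "b \<in> carrier S" "Z b a \<subseteq> A" if r: "rel a b" for a b
  proof -
    obtain x y s where xys: "(x, y) \<in> P" "s \<in> carrier S" "a = x \<otimes> s" "b = y \<otimes> s"
      using r unfolding rel_def by blast
    then have c: "x \<in> carrier S" "y \<in> carrier S" using P(2) by auto
    then show "a \<in> carrier S" "b \<in> carrier S" using xys by auto
    have "Z b a \<subseteq> Z y x" using Z_mult_subset[of y x s] c xys by simp
    also have "\<dots> \<subseteq> A" using PA xys(1) by blast
    finally show "Z b a \<subseteq> A" .
  qed
  obtain t where t: "t \<in> T" using assms(1) by blast
  \<comment> \<open>\<open>arr b a\<close> is the arrow from \<open>a t\<close> to \<open>b t\<close>; its middle component remembers \<open>d b - d a\<close>\<close>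
  define arr where "arr b a = (prefix_tiling S d b t, vec_int (d b) - vec_int (d a), prefix_tiling S d a t)"
    for a b
  have arr: "arr b a \<in> A" if "rel a b" for a b
  proof -
    have "arr b a \<in> Z b a" using t by (auto simp: arr_def Z_set_def)
    then show ?thesis using rel_closed(3)[OF that] by blast
  qed
  have fun_rel: "b = b'" if r: "rel a b" "rel a b'" for a b b'
  proof -
    have "arr b a = arr b' a"
      using TG.local_bisection_gsrc_inj[OF assms(4) arr[OF r(1)] arr[OF r(2)]]
      by (simp add: arr_def TG_gsrc)
    then have "d b = d b'" "prefix_tiling S d b t = prefix_tiling S d b' t"
      by (simp_all add: arr_def vec_int_eq_iff)
    then show ?thesis using prefix_tiling(2) rel_closed(2) r t by metis
  qed
  have inj_rel: "a = a'" if r: "rel a b" "rel a' b" for a a' b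
  proof -
    have "arr b a = arr b a'"
      using TG.local_bisection_gtgt_inj[OF assms(4) arr[OF r(1)] arr[OF r(2)]]
      by (simp add: arr_def TG_gtgt)
    then have "d a = d a'" "prefix_tiling S d a t = prefix_tiling S d a' t"
      by (simp_all add: arr_def vec_int_eq_iff)
    then show ?thesis using prefix_tiling(2) rel_closed(1) r t by metis
  qed
  define \<alpha> where "\<alpha> a = (if \<exists>b. rel a b then Some (SOME b. rel a b) else None)" for a
  have \<alpha>: "\<alpha> a = Some b \<longleftrightarrow> rel a b" for a b
  proof
    assume "\<alpha> a = Some b"
    then have "\<exists>b. rel a b" "b = (SOME b. rel a b)" by (auto simp: \<alpha>_def split: if_splits)
    then show "rel a b" using someI_ex by metis
  next
    assume r: "rel a b"
    then have "(SOME b. rel a b) = b" using fun_rel by (intro some_equality) auto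
    then show "\<alpha> a = Some b" using r by (auto simp: \<alpha>_def)
  qed
  have "\<alpha> \<in> carrier R"
  proof (rule R_I)
    show "fg_right_ideal S (dom \<alpha>)"
    proof (rule fg_right_ideal_I[of "fst ` P"])
      show "finite (fst ` P)" "fst ` P \<subseteq> carrier S" using P by auto
      fix a
      have "a \<in> dom \<alpha> \<longleftrightarrow> (\<exists>b. rel a b)" using \<alpha> by blast
      also have "\<dots> \<longleftrightarrow> (\<exists>x\<in>fst ` P. \<exists>s\<in>carrier S. a = x \<otimes> s)"
        unfolding rel_def by force
      finally show "a \<in> dom \<alpha> \<longleftrightarrow> (\<exists>x\<in>fst ` P. \<exists>s\<in>carrier S. a = x \<otimes> s)" .
    qed
    show "b \<in> carrier S" if "\<alpha> a = Some b" for a b using that \<alpha> rel_closed by blast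
    show "a = a'" if "\<alpha> a = Some b" "\<alpha> a' = Some b" for a a' b using that \<alpha> inj_rel by blast
    show "\<alpha> (a \<otimes> s) = Some (b \<otimes> s)" if ab: "\<alpha> a = Some b" and s: "s \<in> carrier S" for a b s
    proof -
      obtain x y r where xyr: "(x, y) \<in> P" "r \<in> carrier S" "a = x \<otimes> r" "b = y \<otimes> r"
        using ab unfolding \<alpha> rel_def by blast
      then have "x \<in> carrier S" "y \<in> carrier S" using P(2) by auto
      then have "a \<otimes> s = x \<otimes> (r \<otimes> s)" "b \<otimes> s = y \<otimes> (r \<otimes> s)" "r \<otimes> s \<in> carrier S"
        using xyr s m_assoc by auto
      then have "rel (a \<otimes> s) (b \<otimes> s)" using xyr(1) unfolding rel_def by blast
      then show ?thesis using \<alpha> by blast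
    qed
  qed
  moreover have "arrows_of \<alpha> = A"
  proof (intro equalityI subsetI)
    fix g assume "g \<in> arrows_of \<alpha>"
    then show "g \<in> A" using \<alpha> rel_closed(3) unfolding arrows_of_def by blast
  next
    fix g assume "g \<in> A"
    then obtain x y where xy: "(x, y) \<in> P" "g \<in> Z y x" using PA by blast
    then have "x \<in> carrier S" "y \<in> carrier S" using P(2) by auto
    then have "rel x y" unfolding rel_def using xy(1) r_one one_closed by fastforce
    then show "g \<in> arrows_of \<alpha>" using \<alpha> arrows_of_I xy(2) by blast
  qed
  ultimately show ?thesis using that by blast
qed

section \<open>The two congruences as kernels\<close>

lemma nonempty_mapE:
  assumes "f \<noteq> Map.empty"
  obtains a b where "f a = Some b"
  using assms by (metis ext not_None_eq)

text \<open>A long element with a multiple in \<open>I\<close> is itself in \<open>I\<close>: it has a generator of \<open>I\<close> as a prefix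
  by \<open>prefix_of_common_multiple\<close>. The sum of the degrees of the generators is a convenient upper
  bound of them.\<close>

lemma fg_right_ideal_bound:
  assumes "fg_right_ideal S I"
  obtains q where "\<And>a r. \<lbrakk>a \<in> carrier S; r \<in> carrier S; q \<le> d a; a \<otimes> r \<in> I\<rbrakk> \<Longrightarrow> a \<in> I"
proof -
  obtain X where X: "finite X" "X \<subseteq> carrier S" "\<forall>a. a \<in> I \<longleftrightarrow> (\<exists>x\<in>X. \<exists>s\<in>carrier S. a = x \<otimes> s)"
    using assms by (elim fg_right_ideal_E) (rule that)
  have bound: "d x \<le> (\<Sum>x\<in>X. d x)" if "x \<in> X" for x
    unfolding less_eq_vec_def sum_component
    using member_le_sum[OF that _ X(1), of "\<lambda>x. d x $ i" for i] by simp
  have "a \<in> I" if a: "a \<in> carrier S" "r \<in> carrier S" "(\<Sum>x\<in>X. d x) \<le> d a" "a \<otimes> r \<in> I" for a r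
  proof -
    obtain x s where xs: "x \<in> X" "s \<in> carrier S" "a \<otimes> r = x \<otimes> s" using X(3) a(4) by blast
    have "x \<in> carrier S" using xs X(2) by blast
    moreover have "d x \<le> d a" using bound[OF xs(1)] a(3) by (rule order_trans)
    ultimately obtain u where "u \<in> carrier S" "a = x \<otimes> u"
      using prefix_of_common_multiple[of a r x s] a xs by metis
    then show ?thesis using X(3) xs(1) by blast
  qed
  then show ?thesis using that by blast
qed

text \<open>The density condition is applied to the restriction of \<open>s\<close> to the principal ideal of one
  prefix \<open>a\<close> of the source, chosen beyond the bound for the domain of \<open>t\<close>. It gives a multiple of
  \<open>a\<close> at which \<open>s\<close> and \<open>t\<close> agree, and then they agree at \<open>a\<close> by cancellation.\<close>

lemma arrows_of_subset_if_dense: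
  assumes "s \<in> carrier R" "t \<in> carrier R"
    and dense: "\<And>x. \<lbrakk>x \<in> carrier R; x \<noteq> Map.empty; \<And>a b. x a = Some b \<Longrightarrow> s a = Some b\<rbrakk>
      \<Longrightarrow> agreement x t \<noteq> Map.empty"
  shows "arrows_of s \<subseteq> arrows_of t"
proof
  fix g assume gs: "g \<in> arrows_of s"
  obtain v n w where g: "g = (v, n, w)" by (cases g)
  obtain p where p: "\<And>q. \<exists>y. s (w 0 (p + q)) = Some y \<and> (v, n, w) \<in> Z y (w 0 (p + q))"
    using arrows_of_level[OF assms(1) gs[unfolded g]] by blast
  obtain q where q: "\<And>a r. \<lbrakk>a \<in> carrier S; r \<in> carrier S; q \<le> d a; a \<otimes> r \<in> dom t\<rbrakk> \<Longrightarrow> a \<in> dom t"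
    using fg_right_ideal_bound[OF R_dom[OF assms(2)]] by blast
  let ?a = "w 0 (p + q)"
  obtain y where y: "s ?a = Some y" "g \<in> Z y ?a" using p g by blast
  have c: "?a \<in> carrier S" "y \<in> carrier S" using R_closed[OF assms(1) y(1)] by auto
  have "w \<in> T" using y(2) c g Z_iff by blast
  then have da: "q \<le> d ?a" using tiling_degree0 nat_vec_le_add(2) by simp
  let ?I = "?a <# carrier S"
  have I: "b \<in> ?I \<longleftrightarrow> (\<exists>r\<in>carrier S. b = ?a \<otimes> r)" for b by (rule mem_principal_ideal)
  have "?I \<subseteq> dom s"
  proof
    fix b assume "b \<in> ?I"
    then obtain r where "r \<in> carrier S" "b = ?a \<otimes> r" using I by blast
    then show "b \<in> dom s" using R_morphism[OF assms(1) y(1), of r] by (simp add: domIff)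
  qed
  then have x: "s |` ?I \<in> carrier R"
    using R_restrict[OF assms(1) fg_right_ideal_principal[OF c(1)]] by blast
  have "?a = ?a \<otimes> \<one>" using c(1) by simp
  then have "?a \<in> ?I" using I one_closed by blast
  then have "(s |` ?I) ?a = Some y" using y(1) by simp
  then have nonzero: "s |` ?I \<noteq> Map.empty" by (metis option.distinct(1))
  have sub: "s a = Some b" if "(s |` ?I) a = Some b" for a b
    using that by (cases "a \<in> ?I") simp_all
  have "agreement (s |` ?I) t \<noteq> Map.empty" by (rule dense[OF x nonzero sub])
  then obtain b e where "agreement (s |` ?I) t b = Some e" by (rule nonempty_mapE)
  then have be: "(s |` ?I) b = Some e" "t b = Some e" unfolding agreement_iff by simp_all
  have sb: "s b = Some e" by (rule sub[OF be(1)])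
  have "b \<in> ?I" using be(1) by (cases "b \<in> ?I") simp_all
  then obtain r where r: "r \<in> carrier S" "b = ?a \<otimes> r" using I by blast
  then have "?a \<in> dom t" using q[OF c(1) r(1) da] be(2) by blast
  then obtain y' where y': "t ?a = Some y'" by blast
  have "y \<otimes> r = y' \<otimes> r"
    using R_morphism[OF assms(1) y(1) r(1)] R_morphism[OF assms(2) y' r(1)] sb be r by simp
  then have "y = y'" using right_cancel c R_closed(2)[OF assms(2) y'] r by blast
  then show "g \<in> arrows_of t" using arrows_of_I[of t ?a y g] y y' by simp
qed

end

locale compact_k_monoid = k_monoid S d for S (structure) and d :: "'a \<Rightarrow> nat ^ 'k::finite" +
  assumes finitely_aligned: "finitely_aligned S"
    and tilings_nonempty: "tilings S d \<noteq> {}"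
    and compact_tilings: "compact_space (tiling_topology S d)"
begin

lemma arrows_of_eq_empty_iff: "arrows_of \<alpha> = {} \<longleftrightarrow> \<alpha> = Map.empty"
  using arrows_of_empty arrows_of_nonempty[OF tilings_nonempty] by blast

lemma dense_rel_eq_kernel:
  "dense_rel R = {(s, t). s \<in> carrier R \<and> t \<in> carrier R \<and> arrows_of s = arrows_of t}"
proof -
  have half: "(\<forall>x\<in>carrier R. x \<noteq> mzero R \<and> natural_le R x s \<longrightarrow> x \<sqinter>\<^bsub>natural_order R\<^esub> t \<noteq> mzero R)
      \<longleftrightarrow> arrows_of s \<subseteq> arrows_of t" (is "?D \<longleftrightarrow> _")
    if st: "s \<in> carrier R" "t \<in> carrier R" for s t
  proof
    assume D: ?D
    show "arrows_of s \<subseteq> arrows_of t"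
    proof (rule arrows_of_subset_if_dense[OF st])
      fix x assume x: "x \<in> carrier R" "x \<noteq> Map.empty" "\<And>a b. x a = Some b \<Longrightarrow> s a = Some b"
      then have "natural_le R x s" using R_natural_le[OF finitely_aligned x(1) st(1)] by blast
      then have "x \<sqinter>\<^bsub>natural_order R\<^esub> t \<noteq> mzero R" using D x R_mzero[OF finitely_aligned] by simp
      then show "agreement x t \<noteq> Map.empty"
        using R_meet[OF finitely_aligned x(1) st(2)] R_mzero[OF finitely_aligned] by simp
    qed
  next
    assume sub: "arrows_of s \<subseteq> arrows_of t"
    show ?D
    proof (intro ballI impI)
      fix x assume x: "x \<in> carrier R" "x \<noteq> mzero R \<and> natural_le R x s"
      then have "arrows_of x \<subseteq> arrows_of s"
        using R_natural_le[OF finitely_aligned x(1) st(1)] by (intro arrows_of_mono) blast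
      then have "arrows_of (agreement x t) = arrows_of x"
        using arrows_of_agreement[OF x(1) st(2)] sub by blast
      moreover have "arrows_of x \<noteq> {}"
        using x R_mzero[OF finitely_aligned] arrows_of_eq_empty_iff by simp
      ultimately have "agreement x t \<noteq> Map.empty" using arrows_of_eq_empty_iff by metis
      then show "x \<sqinter>\<^bsub>natural_order R\<^esub> t \<noteq> mzero R"
        using R_meet[OF finitely_aligned x(1) st(2)] R_mzero[OF finitely_aligned] by simp
    qed
  qed
  have "(s, t) \<in> dense_rel R \<longleftrightarrow> s \<in> carrier R \<and> t \<in> carrier R \<and> arrows_of s = arrows_of t" for s t
  proof (cases "s \<in> carrier R \<and> t \<in> carrier R")
    case True
    then show ?thesis using half[of s t] half[of t s] unfolding dense_rel_def by blast
  qed (auto simp: dense_rel_def)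
  then show ?thesis by auto
qed

text \<open>An essential idempotent agrees with the unit somewhere below every non-zero idempotent, so the
  density argument applies to it and the unit.\<close>

lemma essential_idempotent_iff:
  assumes "e \<in> idempotents R"
  shows "essential_idempotent R e \<longleftrightarrow> arrows_of e = identities TG"
proof
  have e: "e \<in> carrier R" "\<And>a b. e a = Some b \<Longrightarrow> b = a"
    using assms R_idempotents[OF finitely_aligned] by auto
  have one_iff: "\<one>\<^bsub>R\<^esub> a = Some b \<longleftrightarrow> a \<in> carrier S \<and> b = a" for a b
    by (auto simp: R_one(1) restrict_map_def)
  have zero: "mzero R = Map.empty" using R_mzero finitely_aligned by blast
  have "e a = Some b \<Longrightarrow> \<one>\<^bsub>R\<^esub> a = Some b" for a b
    unfolding one_iff using e(2) R_closed(1)[OF e(1)] by blast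
  then have sub: "arrows_of e \<subseteq> identities TG"
    using arrows_of_mono[of e "\<one>\<^bsub>R\<^esub>"] arrows_of_one by simp
  {
    assume ess: "essential_idempotent R e"
    have "arrows_of \<one>\<^bsub>R\<^esub> \<subseteq> arrows_of e"
    proof (rule arrows_of_subset_if_dense[OF R_one(2) e(1)])
      fix x assume x: "x \<in> carrier R" "x \<noteq> Map.empty" "\<And>a b. x a = Some b \<Longrightarrow> \<one>\<^bsub>R\<^esub> a = Some b"
      then have "x \<in> idempotents R" unfolding one_iff R_idempotents[OF finitely_aligned] by blast
      then have "e \<circ>\<^sub>m x \<noteq> Map.empty"
        using ess x(2) unfolding essential_idempotent_def zero R_mult by blast
      then obtain a c where "(e \<circ>\<^sub>m x) a = Some c" by (metis ext not_None_eq)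
      then obtain b where b: "x a = Some b" "e b = Some c" unfolding map_comp_Some_iff by blast
      then have "b = a" "c = b" using x(3) e(2) unfolding one_iff by blast+
      then have "agreement x e a = Some a" unfolding agreement_iff using b by simp
      then show "agreement x e \<noteq> Map.empty" by auto
    qed
    then show "arrows_of e = identities TG" using sub arrows_of_one by simp
  next
    assume eq: "arrows_of e = identities TG"
    have "identities TG \<noteq> {}" using tilings_nonempty by (simp add: TG_identities)
    then have "e \<noteq> Map.empty" using eq arrows_of_empty by auto
    moreover have "e \<otimes>\<^bsub>R\<^esub> f \<noteq> Map.empty" if f: "f \<in> idempotents R" "f \<noteq> Map.empty" for f
    proof -
      have fR: "f \<in> carrier R" using f by (simp add: idempotents_def)
      have "arrows_of (e \<otimes>\<^bsub>R\<^esub> f) = arrows_of f"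
        using arrows_of_comp[OF e(1) fR] TG.gset_mult_identities(2)[OF arrows_of_carrier[OF fR]] eq
        by (simp add: R_mult)
      then show ?thesis using arrows_of_eq_empty_iff f(2) by metis
    qed
    ultimately show "essential_idempotent R e"
      using assms by (simp add: essential_idempotent_def zero)
  }
qed

text \<open>The sets attached to \<open>s\<^sup>-\<^sup>1s\<close> and \<open>ss\<^sup>-\<^sup>1\<close> are \<open>A\<^sup>-\<^sup>1A\<close> and \<open>AA\<^sup>-\<^sup>1\<close> for \<open>A = \<psi>(s)\<close>.\<close>

lemma essential_part_carrier:
  "carrier (essential_part R) = {s \<in> carrier R. bisection TG (arrows_of s)}"
proof -
  have "essential_idempotent R (gen_inverse R s \<otimes>\<^bsub>R\<^esub> s) \<and> essential_idempotent R (s \<otimes>\<^bsub>R\<^esub> gen_inverse R s)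
      \<longleftrightarrow> bisection TG (arrows_of s)" if s: "s \<in> carrier R" for s
  proof -
    let ?t = "map_inverse s"
    have t: "?t \<in> carrier R" using R_map_inverse s by blast
    have "?t \<circ>\<^sub>m s \<in> idempotents R" "s \<circ>\<^sub>m ?t \<in> idempotents R"
      unfolding R_idempotents[OF finitely_aligned] map_comp_Some_iff map_inverse_iff[OF s]
      using R_comp[OF finitely_aligned] s t R_inj[OF s] by auto
    then show ?thesis
      using essential_idempotent_iff arrows_of_comp s t arrows_of_inverse[OF s]
        local_bisection_arrows_of[OF s]
      by (simp add: R_gen_inverse[OF finitely_aligned s] R_mult bisection_def)
  qed
  then show ?thesis by (auto simp: essential_part_def)
qed

text \<open>A common lower bound in \<open>R(S)\<^sup>e\<close> has a bisection as its set of arrows, which leaves no room between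
  it and the larger local bisections; conversely the agreement is such a lower bound.\<close>

lemma sigma_rel_eq_kernel:
  "sigma_rel R = {(s, t). s \<in> carrier (essential_part R) \<and> t \<in> carrier (essential_part R) \<and>
    arrows_of s = arrows_of t}"
proof -
  have "(\<exists>u\<in>carrier (essential_part R). natural_le R u s \<and> natural_le R u t) \<longleftrightarrow>
      arrows_of s = arrows_of t"
    if st: "s \<in> carrier (essential_part R)" "t \<in> carrier (essential_part R)" for s t
  proof
    have R: "s \<in> carrier R" "t \<in> carrier R" using st essential_part_carrier by auto
    {
      assume "\<exists>u\<in>carrier (essential_part R). natural_le R u s \<and> natural_le R u t"
      then obtain u where u: "u \<in> carrier R" "bisection TG (arrows_of u)"
        "natural_le R u s" "natural_le R u t"
        unfolding essential_part_carrier by blast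
      have "arrows_of u \<subseteq> arrows_of s" "arrows_of u \<subseteq> arrows_of t"
        using R_natural_le[OF finitely_aligned u(1) R(1)] R_natural_le[OF finitely_aligned u(1) R(2)]
          u(3,4) by (intro arrows_of_mono; blast)+
      then show "arrows_of s = arrows_of t"
        using TG.bisection_subset_eq[OF u(2)] local_bisection_arrows_of R by metis
    next
      assume eq: "arrows_of s = arrows_of t"
      let ?u = "agreement s t"
      have u: "?u \<in> carrier R" using R_agreement[OF finitely_aligned R] .
      have "arrows_of ?u = arrows_of s" using arrows_of_agreement[OF R] eq by simp
      then have "?u \<in> carrier (essential_part R)"
        using u st(1) unfolding essential_part_carrier by simp
      moreover have "natural_le R ?u s" "natural_le R ?u t"
        using R_natural_le[OF finitely_aligned u R(1)] R_natural_le[OF finitely_aligned u R(2)]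
          agreement_iff by blast+
      ultimately show "\<exists>u\<in>carrier (essential_part R). natural_le R u s \<and> natural_le R u t" by blast
    }
  qed
  then show ?thesis unfolding sigma_rel_def by blast
qed

section \<open>The isomorphisms\<close>

lemma KB_carrier: "carrier (KB TG) = arrows_of ` carrier R"
proof (intro equalityI subsetI)
  fix A assume "A \<in> carrier (KB TG)"
  then obtain \<alpha> where "\<alpha> \<in> carrier R" "arrows_of \<alpha> = A"
    using compact_open_bisection_is_arrows_of[OF tilings_nonempty] by (auto simp: KB_def)
  then show "A \<in> arrows_of ` carrier R" by blast
next
  fix A assume "A \<in> arrows_of ` carrier R"
  then show "A \<in> carrier (KB TG)"
    using arrows_of_compact_open[OF compact_tilings] local_bisection_arrows_of by (auto simp: KB_def)
qed

lemma KB_simps: "A \<otimes>\<^bsub>KB TG\<^esub> B = gset_mult TG A B" "\<one>\<^bsub>KB TG\<^esub> = identities TG"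
  by (simp_all add: KB_def)

text \<open>Complements exist because the identity space is compact Hausdorff: a compact-open set of
  identities is closed there, so its complement is open and, being closed, compact. Closure under
  inverses comes from \<open>R(S)\<close> through \<open>\<psi>\<close>.\<close>

lemma boolean_inverse_monoid_if_iso_KB:
  fixes M :: "('x, 'y) monoid_scheme"
  assumes "h \<in> iso M (KB TG)" "h \<one>\<^bsub>M\<^esub> = identities TG" "\<one>\<^bsub>M\<^esub> \<in> carrier M"
    and "\<And>a b. \<lbrakk>a \<in> carrier M; b \<in> carrier M\<rbrakk> \<Longrightarrow> a \<otimes>\<^bsub>M\<^esub> b \<in> carrier M"
  shows "local_bisection_representation TG M h" "boolean_inverse_monoid M"
proof -
  have img: "h ` carrier M = carrier (KB TG)" and inj: "inj_on h (carrier M)"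
    using assms(1) by (auto simp: iso_def bij_betw_def)
  have KB: "h a \<in> carrier (KB TG)" if "a \<in> carrier M" for a using img that by blast
  have hom: "h (a \<otimes>\<^bsub>M\<^esub> b) = gset_mult TG (h a) (h b)" if "a \<in> carrier M" "b \<in> carrier M" for a b
    using assms(1) that by (simp add: iso_def hom_def KB_simps)
  show rep: "local_bisection_representation TG M h"
  proof (intro local_bisection_representation.intro local_bisection_representation_axioms.intro
      groupoid_TG)
    show "local_bisection TG (h a)" if "a \<in> carrier M" for a
      using KB[OF that] by (simp add: KB_def)
    show "ginv TG ` h a \<in> h ` carrier M" if a: "a \<in> carrier M" for a
    proof -
      obtain \<alpha> where "\<alpha> \<in> carrier R" "h a = arrows_of \<alpha>" using KB[OF a] KB_carrier by blast
      then show ?thesis unfolding img KB_carrier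
        using R_map_inverse arrows_of_inverse by (metis imageI)
    qed
  qed (use assms inj hom in auto)
  interpret rep: local_bisection_representation TG M h by (rule rep)
  interpret boolean_groupoid TG by (rule boolean_groupoid_TG[OF compact_tilings])
  show "boolean_inverse_monoid M"
  proof (rule rep.boolean_inverse_monoid_represented)
    show "{} \<in> h ` carrier M" unfolding img by (simp add: KB_def local_bisection_def)
    show "h a \<union> h b \<in> h ` carrier M"
      if ab: "a \<in> carrier M" "b \<in> carrier M" "local_bisection TG (h a \<union> h b)" for a b
      using KB[OF ab(1)] KB[OF ab(2)] ab(3) unfolding img by (simp add: KB_def compactin_Un openin_Un)
    show "identities TG - h a \<in> h ` carrier M" if a: "a \<in> carrier M" "h a \<subseteq> identities TG" for a
    proof -
      let ?I = "identity_space TG"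
      have open_iff: "openin ?I U \<longleftrightarrow> openin (gtop TG) U \<and> U \<subseteq> identities TG" for U
        by (rule openin_open_subtopology[OF openin_identities])
      have top: "topspace ?I = identities TG"
        using TG.identities_subset_carrier by (auto simp: TG_topspace)
      have A: "openin (gtop TG) (h a)" "compactin (gtop TG) (h a)" using KB[OF a(1)] by (auto simp: KB_def)
      have "compactin ?I (h a)" using A(2) a(2) by (simp add: compactin_subtopology)
      then have "closedin ?I (h a)" using compactin_imp_closedin Hausdorff_identity_space by blast
      then have "openin ?I (identities TG - h a)" using top by (simp add: closedin_def)
      moreover have "closedin ?I (identities TG - h a)"
        using openin_closedin_eq[of ?I "h a"] open_iff A a(2) top by simp
      then have "compactin ?I (identities TG - h a)"
        using closedin_compact_space compact_identity_space by blast
      ultimately show ?thesis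
        unfolding img using TG.local_bisection_identities[of "identities TG - h a"]
        by (simp add: KB_def open_iff compactin_subtopology)
    qed
  qed
qed

text \<open>Products of compact-open local bisections are again such because \<open>R(S)\<close> is closed under
  composition and \<open>\<psi>\<close> is onto and multiplicative.\<close>

lemma KB_representation:
  "local_bisection_representation TG (KB TG) (\<lambda>A. A)" "boolean_inverse_monoid (KB TG)"
proof -
  have closed: "A \<otimes>\<^bsub>KB TG\<^esub> B \<in> carrier (KB TG)"
    if AB: "A \<in> carrier (KB TG)" "B \<in> carrier (KB TG)" for A B
  proof -
    obtain \<alpha> \<beta> where ab: "\<alpha> \<in> carrier R" "A = arrows_of \<alpha>" "\<beta> \<in> carrier R" "B = arrows_of \<beta>"
      using AB unfolding KB_carrier by blast
    then have "A \<otimes>\<^bsub>KB TG\<^esub> B = arrows_of (\<alpha> \<circ>\<^sub>m \<beta>)" by (simp add: KB_simps arrows_of_comp)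
    then show ?thesis unfolding KB_carrier using R_comp[OF finitely_aligned ab(1,3)] by (rule image_eqI)
  qed
  have "\<one>\<^bsub>KB TG\<^esub> \<in> carrier (KB TG)"
    unfolding KB_carrier KB_simps using R_one(2) arrows_of_one by (metis imageI)
  moreover have "(\<lambda>A. A) \<in> iso (KB TG) (KB TG)"
    using closed by (auto simp: iso_def hom_def bij_betw_def)
  ultimately show "local_bisection_representation TG (KB TG) (\<lambda>A. A)" "boolean_inverse_monoid (KB TG)"
    using boolean_inverse_monoid_if_iso_KB[of "\<lambda>A. A" "KB TG", OF _ _ _ closed]
    by (simp_all add: KB_simps)
qed

lemma C_monoid_iso_KB:
  "C_monoid S \<cong> KB TG" "boolean_inverse_monoid (C_monoid S)"
proof -
  obtain h where h: "h \<in> iso (C_monoid S) (KB TG)" "h \<one>\<^bsub>C_monoid S\<^esub> = \<one>\<^bsub>KB TG\<^esub>"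
    "\<one>\<^bsub>C_monoid S\<^esub> \<in> carrier (C_monoid S)"
    "\<And>A B. \<lbrakk>A \<in> carrier (C_monoid S); B \<in> carrier (C_monoid S)\<rbrakk>
      \<Longrightarrow> A \<otimes>\<^bsub>C_monoid S\<^esub> B \<in> carrier (C_monoid S)"
    unfolding C_monoid_def
  proof (rule quotient_by_kernel[OF dense_rel_eq_kernel, where N = "KB TG"])
    show "s \<otimes>\<^bsub>R\<^esub> t \<in> carrier R" "arrows_of (s \<otimes>\<^bsub>R\<^esub> t) = arrows_of s \<otimes>\<^bsub>KB TG\<^esub> arrows_of t"
      if "s \<in> carrier R" "t \<in> carrier R" for s t
      using that R_comp[OF finitely_aligned] arrows_of_comp by (simp_all add: R_mult KB_simps)
  qed (use KB_carrier R_one(2) arrows_of_one KB_simps in auto)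
  then show "C_monoid S \<cong> KB TG" by (auto simp: is_iso_def)
  show "boolean_inverse_monoid (C_monoid S)"
    by (rule boolean_inverse_monoid_if_iso_KB(2)[OF h(1) _ h(3,4)]) (simp_all add: h(2) KB_simps)
qed

lemma topological_full_group_units: "topological_full_group TG = units_of (KB TG)"
proof -
  interpret rep: local_bisection_representation TG "KB TG" "\<lambda>A. A" by (rule KB_representation)
  have "Units (KB TG) = {A. openin (gtop TG) A \<and> compactin (gtop TG) A \<and> bisection TG A}"
    unfolding rep.Units_represented by (auto simp: KB_def bisection_def)
  moreover have "mult (KB TG) = gset_mult TG" by (simp add: KB_def)
  ultimately show ?thesis by (simp add: topological_full_group_def units_of_def KB_simps)
qed

lemma group_topological_full_group: "group (topological_full_group TG)"
proof -
  interpret rep: local_bisection_representation TG "KB TG" "\<lambda>A. A" by (rule KB_representation)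
  interpret monoid "KB TG" by (rule rep.monoid_represented)
  show ?thesis unfolding topological_full_group_units by (rule units_group)
qed

lemma G_group_iso_topological_full_group:
  "G_group S \<cong> topological_full_group TG" "group (G_group S)"
proof -
  let ?F = "topological_full_group TG"
  interpret F: group ?F by (rule group_topological_full_group)
  have F: "A \<otimes>\<^bsub>?F\<^esub> B = gset_mult TG A B" "\<one>\<^bsub>?F\<^esub> = identities TG" for A B
    by (simp_all add: topological_full_group_def)
  have E: "s \<otimes>\<^bsub>essential_part R\<^esub> t = s \<circ>\<^sub>m t" "\<one>\<^bsub>essential_part R\<^esub> = \<one>\<^bsub>R\<^esub>" for s t
    by (simp_all add: essential_part_def R_mult)
  have carrier_F: "carrier ?F = {A \<in> carrier (KB TG). bisection TG A}"
    by (auto simp: topological_full_group_def KB_def bisection_def)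
  have onto: "arrows_of ` carrier (essential_part R) = carrier ?F"
    unfolding essential_part_carrier carrier_F KB_carrier by blast
  have mem: "s \<in> carrier (essential_part R) \<longleftrightarrow> s \<in> carrier R \<and> arrows_of s \<in> carrier ?F" for s
    unfolding essential_part_carrier carrier_F KB_carrier by blast
  obtain h where h: "h \<in> iso (G_group S) ?F" "h \<one>\<^bsub>G_group S\<^esub> = \<one>\<^bsub>?F\<^esub>"
    "\<one>\<^bsub>G_group S\<^esub> \<in> carrier (G_group S)"
    "\<And>A B. \<lbrakk>A \<in> carrier (G_group S); B \<in> carrier (G_group S)\<rbrakk>
      \<Longrightarrow> A \<otimes>\<^bsub>G_group S\<^esub> B \<in> carrier (G_group S)"
    unfolding G_group_def
  proof (rule quotient_by_kernel[OF sigma_rel_eq_kernel, where N = ?F])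
    fix s t assume st: "s \<in> carrier (essential_part R)" "t \<in> carrier (essential_part R)"
    then have R: "s \<in> carrier R" "t \<in> carrier R" using mem by auto
    show hom: "arrows_of (s \<otimes>\<^bsub>essential_part R\<^esub> t) = arrows_of s \<otimes>\<^bsub>?F\<^esub> arrows_of t"
      using arrows_of_comp[OF R] by (simp add: E F)
    show "s \<otimes>\<^bsub>essential_part R\<^esub> t \<in> carrier (essential_part R)"
      unfolding mem hom using st R_comp[OF finitely_aligned R] mem F.m_closed by (simp add: E)
  next
    show "\<one>\<^bsub>essential_part R\<^esub> \<in> carrier (essential_part R)"
      unfolding mem E arrows_of_one using R_one(2) F.one_closed F(2) by simp
  qed (use onto arrows_of_one E F in auto)
  then show "G_group S \<cong> ?F" by (auto simp: is_iso_def)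
  have bij: "bij_betw h (carrier (G_group S)) (carrier ?F)" and
    hom: "\<And>A B. \<lbrakk>A \<in> carrier (G_group S); B \<in> carrier (G_group S)\<rbrakk>
      \<Longrightarrow> h (A \<otimes>\<^bsub>G_group S\<^esub> B) = h A \<otimes>\<^bsub>?F\<^esub> h B"
    using h(1) by (auto simp: iso_def hom_def)
  let ?k = "inv_into (carrier (G_group S)) h"
  have k: "?k A \<in> carrier (G_group S)" "h (?k A) = A" if "A \<in> carrier ?F" for A
    using bij that by (auto simp: bij_betw_def inv_into_into f_inv_into_f)
  have kh: "?k (h A) = A" if "A \<in> carrier (G_group S)" for A
    using bij that by (simp add: bij_betw_def)
  have "?k \<in> iso ?F (G_group S)"
    unfolding iso_def
  proof (intro CollectI conjI homI)
    show "bij_betw ?k (carrier ?F) (carrier (G_group S))" using bij_betw_inv_into[OF bij] .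
    show "?k (A \<otimes>\<^bsub>?F\<^esub> B) = ?k A \<otimes>\<^bsub>G_group S\<^esub> ?k B" if "A \<in> carrier ?F" "B \<in> carrier ?F" for A B
      using kh[of "?k A \<otimes>\<^bsub>G_group S\<^esub> ?k B"] hom h(4) k that by simp
  qed (use k in auto)
  then have "group (G_group S \<lparr>one := ?k \<one>\<^bsub>?F\<^esub>\<rparr>)" by (rule F.iso_imp_img_group)
  moreover have "?k \<one>\<^bsub>?F\<^esub> = \<one>\<^bsub>G_group S\<^esub>" using kh[OF h(3)] h(2) by simp
  ultimately show "group (G_group S)" by simp
qed

end

lemma compact_Cantor_space: "compact_space Cantor_space"
  unfolding Cantor_space_def
  by (intro compact_space_product_topology[THEN iffD2]) (simp add: compact_space_discrete_topology)

theorem theorem10p9: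
  fixes S :: "('a, 'm) monoid_scheme" and d :: "'a \<Rightarrow> nat ^ 'k::finite"
  assumes "k_monoid S d"
    and "finitely_aligned S"
    and "\<And>i. finite (alphabet S d i) \<and> card (alphabet S d i) \<ge> 2"
    and "\<exists>w\<in>tilings S d. aperiodic w"
    and "tiling_topology S d homeomorphic_space Cantor_space"
  shows "boolean_groupoid (tiling_groupoid S d) \<and>
     (boolean_inverse_monoid (C_monoid S) \<and>
      boolean_inverse_monoid (KB (tiling_groupoid S d)) \<and>
      C_monoid S \<cong> KB (tiling_groupoid S d)) \<and>
     (group (G_group S) \<and>
      group (topological_full_group (tiling_groupoid S d)) \<and>
      G_group S \<cong> topological_full_group (tiling_groupoid S d))"
proof -
  have "compact_space (tiling_topology S d)"
    using assms(5) compact_Cantor_space homeomorphic_compact_space by blast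
  then interpret compact_k_monoid S d
    using assms(1,2,4) by (auto simp: compact_k_monoid_def compact_k_monoid_axioms_def)
  show ?thesis
    using boolean_groupoid_TG[OF compact_tilings] C_monoid_iso_KB KB_representation(2)
      G_group_iso_topological_full_group group_topological_full_group
    by blast
qed

end
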